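(* Let $p$ be an odd prime, let $\chi$ be a primitive odd Dirichlet character modulo $N$ with $p\nmid N$, and let $j\in\mathbb Z/(p-1)\mathbb Z$. The function $$L^{(p)}_{\chi^{-1},j}(s)=G(\chi)^{-1}\mathcal M_{\nu^\times_{\chi,N},j}(s)$$ is rigid analytic on every weight disc and satisfies $$L^{(p)}_{\chi^{-1},j}(n)=\bigl(1-\chi^{-1}(p)p^{n-1}\bigr)L(1-n,\chi^{-1})$$ for every integer $n\ge1$ with $n\equiv j\pmod{p-1}$. With the Kubota–Leopoldt normalization recalled in the context, one has the identity of analytic functions $$L^{(p)}_{\chi^{-1},j}(s)=L_p(1-s,\chi^{-1}\omega^j).$$
   Context: $K/\mathbb Q_p$ is a finite extension containing the values of $\chi$ and a primitive $N$-th root of unity $\zeta_N$; algebraic numbers are embedded compatibly in $\mathbb C$ and $K$. $G(\chi)=\sum_{a\in(\mathbb Z/N)^\times}\chi(a)\zeta_N^a$. For $x\in\mathbb Z_p^\times$, $x=\omega(x)\langle x\rangle$ with $\omega(x)\in\mu_{p-1}$, $\langle x\rangle\in1+p\mathbb Z_p$. For a root of unity $z\ne1$ of order prime to $p$, $\mu_z$ is the bounded measure on $\mathbb Z_p$ with $\mu_z(a+p^m\mathbb Z_p)=z^a/(1-z^{p^m})$, $0\le a<p^m$; $\nu_z^\times=x^{-1}\mathbf 1_{\mathbb Z_p^\times}\mu_z$, a bounded measure on $\mathbb Z_p^\times$; $\nu^\times_{\chi,N}=\sum_{a\in(\mathbb Z/N)^\times}\chi(a)\nu^\times_{\zeta_N^a}$.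 For a bounded measure $\rho$ on $\mathbb Z_p^\times$, $\mathcal M_{\rho,j}(s)=\int\omega(x)^j\langle x\rangle^s\,d\rho(x)$; with $\gamma$ a topological generator of $1+p\mathbb Z_p$ it is a power series with bounded coefficients in $X=\gamma^s-1$, $|X|<1$ (the weight disc of index $j$). **Kubota–Leopoldt normalization.** For a primitive Dirichlet character $\theta$ of conductor prime to $p$ (here $\theta=\chi^{-1}$), the reflected branch $L_p(1-s,\theta\omega^j)$ is the $p$-adic analytic function normalized by $L_p(1-n,\theta\omega^j)=(1-\theta(p)p^{n-1})L(1-n,\theta)$ for every integer $n\ge1$ with $n\equiv j\pmod{p-1}$; if $\theta(-1)\ne(-1)^j$ these values vanish and the branch is identically zero. *)

theory Defs
  imports
    "HOL-Complex_Analysis.Complex_Analysis"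
    "HOL-Number_Theory.Number_Theory"
    "HOL-Library.FuncSet"
begin

section \<open>Finite extensions of the p-adic numbers\<close>

text \<open>
  A field of characteristic 0, complete for a non-archimedean absolute value,
  which is encoded by the distance to 0.
  Topological notions (\<open>closure\<close>, \<open>compact\<close>, \<open>sums\<close>, \<open>lim\<close>, ...) then refer to that absolute value.
\<close>

class complete_nonarch_field = field_char_0 + complete_space +
  assumes dist_add_right: "dist (x + z) (y + z) = dist x y"
    and dist_mult_zero: "dist (x * y) 0 = dist x 0 * dist y 0"
    and dist_ultrametric: "dist x z \<le> max (dist x y) (dist y z)"

definition absval :: "'k::complete_nonarch_field \<Rightarrow> real" where
  "absval x = dist x 0"

text \<open>
  When the absolute value restricts to the p-adic one on the rationals, the closure of the
  rationals in the complete field is their p-adic completion, and the closure of the integers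
  is the ring of p-adic integers.
\<close>

definition Qp :: "'k::complete_nonarch_field set" where
  "Qp = closure \<rat>"

definition Zp :: "'k::complete_nonarch_field set" where
  "Zp = closure \<int>"

definition Zp_units :: "'k::complete_nonarch_field set" where
  "Zp_units = {x \<in> Zp. \<exists>y\<in>Zp. x * y = 1}"

text \<open>
  For prime p, the normalization of the absolute value of p forces it to be the p-adic absolute
  value on the rationals (Ostrowski), so this says that the field is a finite extension of the
  p-adic numbers, equipped with the unique extension of the p-adic absolute value.
\<close>

definition finite_extension_of_Qp :: "nat \<Rightarrow> 'k::complete_nonarch_field itself \<Rightarrow> bool" where
  "finite_extension_of_Qp p _ \<longleftrightarrow>
     absval (of_nat p :: 'k) = 1 / real p \<and>
     (\<exists>B :: 'k set. finite B \<and> (\<forall>x. \<exists>c. (\<forall>b\<in>B. c b \<in> Qp) \<and> x = (\<Sum>b\<in>B. c b * b)))"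

definition one_units :: "nat \<Rightarrow> 'k::complete_nonarch_field set" where
  "one_units p = {1 + of_nat p * y |y. y \<in> Zp}"

definition topological_generator :: "nat \<Rightarrow> 'k::complete_nonarch_field \<Rightarrow> bool" where
  "topological_generator p \<gamma> \<longleftrightarrow> closure (range (\<lambda>k::int. \<gamma> powi k)) = one_units p"

definition teichmueller :: "nat \<Rightarrow> 'k::complete_nonarch_field \<Rightarrow> 'k" where
  "teichmueller p x = (THE w. w ^ (p - 1) = 1 \<and> x / w \<in> one_units p)"

definition angle_part :: "nat \<Rightarrow> 'k::complete_nonarch_field \<Rightarrow> 'k" where
  "angle_part p x = x / teichmueller p x"

text \<open>
  The power of a one-unit \<open>u\<close> with exponent a p-adic integer \<open>s\<close>, as the (convergent) binomial series.
\<close>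

definition padic_power :: "'k::complete_nonarch_field \<Rightarrow> 'k \<Rightarrow> 'k" where
  "padic_power u s = (\<Sum>k. (s gchoose k) * (u - 1) ^ k)"


section \<open>Bounded measures\<close>

definition compact_opens :: "'k::complete_nonarch_field set \<Rightarrow> 'k set set" where
  "compact_opens X = {U. U \<subseteq> X \<and> compact U \<and> openin (top_of_set X) U}"

text \<open>
  A measure on a compact open subset \<open>X\<close> of the p-adic integers is a finitely additive function
  on the compact open subsets of \<open>X\<close>. Its values on other sets are fixed to \<open>undefined\<close>, so that
  two measures are equal as soon as they agree on compact opens.
\<close>

definition bounded_measure ::
    "'k::complete_nonarch_field set \<Rightarrow> ('k set \<Rightarrow> 'k) \<Rightarrow> bool" where
  "bounded_measure X \<mu> \<longleftrightarrow>
     \<mu> \<in> extensional (compact_opens X) \<and>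
     (\<forall>U\<in>compact_opens X. \<forall>V\<in>compact_opens X. U \<inter> V = {} \<longrightarrow> \<mu> (U \<union> V) = \<mu> U + \<mu> V) \<and>
     (\<exists>C. \<forall>U\<in>compact_opens X. absval (\<mu> U) \<le> C)"

definition Zp_coset :: "nat \<Rightarrow> nat \<Rightarrow> nat \<Rightarrow> 'k::complete_nonarch_field set" where
  "Zp_coset p m a = {of_nat a + of_nat p ^ m * y |y. y \<in> Zp}"

text \<open>
  The integral over \<open>X\<close> of a continuous function \<open>f\<close> against a bounded measure \<open>\<rho>\<close> on \<open>X\<close>, as a limit
  of Riemann sums over the cosets of \<open>p\<^sup>m\<close> with sample points the standard representatives.
\<close>

definition padic_integral ::
    "nat \<Rightarrow> 'k::complete_nonarch_field set \<Rightarrow> ('k set \<Rightarrow> 'k) \<Rightarrow> ('k \<Rightarrow> 'k) \<Rightarrow> 'k" where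
  "padic_integral p X \<rho> f =
     lim (\<lambda>m. \<Sum>a | a < p ^ m \<and> of_nat a \<in> X. f (of_nat a) * \<rho> (X \<inter> Zp_coset p m a))"

definition mu_measure :: "nat \<Rightarrow> 'k::complete_nonarch_field \<Rightarrow> 'k set \<Rightarrow> 'k" where
  "mu_measure p z = (THE \<mu>. bounded_measure Zp \<mu> \<and>
     (\<forall>m a. a < p ^ m \<longrightarrow> \<mu> (Zp_coset p m a) = z ^ a / (1 - z ^ (p ^ m))))"

definition nu_measure :: "nat \<Rightarrow> 'k::complete_nonarch_field \<Rightarrow> 'k set \<Rightarrow> 'k" where
  "nu_measure p z = (\<lambda>U\<in>compact_opens Zp_units.
     padic_integral p Zp (mu_measure p z) (\<lambda>x. if x \<in> U then inverse x else 0))"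

definition mellin ::
    "nat \<Rightarrow> ('k::complete_nonarch_field set \<Rightarrow> 'k) \<Rightarrow> int \<Rightarrow> 'k \<Rightarrow> 'k" where
  "mellin p \<rho> j s =
     padic_integral p Zp_units \<rho> (\<lambda>x. teichmueller p x powi j * padic_power (angle_part p x) s)"

text \<open>
  The open unit disc with coordinate \<open>X\<close>, in which \<open>s\<close> sits as \<open>X = \<gamma>\<^sup>s - 1\<close>. Analytic functions on it
  are the power series converging on every closed disc of radius less than 1. A function of
  \<open>s\<close> comes from at most one such power series, because these points accumulate inside the disc.
\<close>

definition rigid_analytic_on_weight_disc ::
    "'k::complete_nonarch_field \<Rightarrow> ('k \<Rightarrow> 'k) \<Rightarrow> bool" where
  "rigid_analytic_on_weight_disc \<gamma> f \<longleftrightarrow>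
     (\<exists>c. (\<forall>r::real. 0 \<le> r \<and> r < 1 \<longrightarrow> (\<lambda>k. absval (c k) * r ^ k) \<longlonglongrightarrow> 0) \<and>
          (\<forall>s\<in>Zp. (\<lambda>k. c k * (padic_power \<gamma> s - 1) ^ k) sums f s))"


section \<open>Dirichlet characters and L-functions\<close>

definition dirichlet_character :: "nat \<Rightarrow> (int \<Rightarrow> complex) \<Rightarrow> bool" where
  "dirichlet_character N chi \<longleftrightarrow>
     N > 0 \<and> chi 1 = 1 \<and>
     (\<forall>a b. chi (a * b) = chi a * chi b) \<and>
     (\<forall>a. chi (a + int N) = chi a) \<and>
     (\<forall>a. chi a = 0 \<longleftrightarrow> \<not> coprime a (int N))"

text \<open>Primitivity: the character does not factor through a proper divisor of the modulus.\<close>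

definition primitive_character :: "nat \<Rightarrow> (int \<Rightarrow> complex) \<Rightarrow> bool" where
  "primitive_character N chi \<longleftrightarrow>
     dirichlet_character N chi \<and>
     (\<forall>d. d dvd N \<and> d < N \<longrightarrow>
        (\<exists>a. coprime a (int N) \<and> [a = 1] (mod int d) \<and> chi a \<noteq> 1))"

text \<open>The inverse character; it is 0 on non-units because \<open>inverse 0 = 0\<close>.\<close>

definition inverse_character :: "(int \<Rightarrow> complex) \<Rightarrow> int \<Rightarrow> complex" where
  "inverse_character chi a = inverse (chi a)"

text \<open>
  The meromorphic continuation to the plane of the Dirichlet series; \<open>nicely_meromorphic_on\<close>
  fixes the values at removable singularities and poles, hence makes it unique.
\<close>

definition dirichlet_L :: "(int \<Rightarrow> complex) \<Rightarrow> complex \<Rightarrow> complex" where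
  "dirichlet_L \<theta> = (THE f. f nicely_meromorphic_on UNIV \<and>
     (\<forall>s. Re s > 1 \<longrightarrow> (\<lambda>n. \<theta> (int (Suc n)) / of_nat (Suc n) powr s) sums f s))"

definition primitive_root_of_unity :: "nat \<Rightarrow> complex \<Rightarrow> bool" where
  "primitive_root_of_unity N \<zeta> \<longleftrightarrow> \<zeta> ^ N = 1 \<and> (\<forall>k. 0 < k \<and> k < N \<longrightarrow> \<zeta> ^ k \<noteq> 1)"

definition gauss_sum :: "nat \<Rightarrow> (int \<Rightarrow> complex) \<Rightarrow> complex \<Rightarrow> complex" where
  "gauss_sum N chi \<zeta> = (\<Sum>a\<in>totatives N. chi (int a) * \<zeta> ^ a)"

text \<open>
  \<open>F\<close> is the field of those algebraic numbers in the complex plane that are regarded as elements of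
  the p-adic field, and \<open>\<iota>\<close> is the embedding; nothing is said about \<open>\<iota>\<close> outside \<open>F\<close>.
\<close>

definition algebraic_embedding ::
    "complex set \<Rightarrow> (complex \<Rightarrow> 'k::complete_nonarch_field) \<Rightarrow> bool" where
  "algebraic_embedding F \<iota> \<longleftrightarrow>
     (\<forall>x\<in>F. algebraic x) \<and> 0 \<in> F \<and> 1 \<in> F \<and>
     (\<forall>x\<in>F. - x \<in> F \<and> inverse x \<in> F) \<and>
     (\<forall>x\<in>F. \<forall>y\<in>F. x + y \<in> F \<and> x * y \<in> F) \<and>
     \<iota> 1 = 1 \<and>
     (\<forall>x\<in>F. \<forall>y\<in>F. \<iota> (x + y) = \<iota> x + \<iota> y \<and> \<iota> (x * y) = \<iota> x * \<iota> y)"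


section \<open>The p-adic L-functions\<close>

definition nu_character_measure ::
    "nat \<Rightarrow> nat \<Rightarrow> (complex \<Rightarrow> 'k::complete_nonarch_field) \<Rightarrow> (int \<Rightarrow> complex) \<Rightarrow> complex \<Rightarrow>
     'k set \<Rightarrow> 'k" where
  "nu_character_measure p N \<iota> chi \<zeta> = (\<lambda>U\<in>compact_opens Zp_units.
     \<Sum>a\<in>totatives N. \<iota> (chi (int a)) * nu_measure p (\<iota> (\<zeta> ^ a)) U)"

definition measure_padic_L ::
    "nat \<Rightarrow> nat \<Rightarrow> (complex \<Rightarrow> 'k::complete_nonarch_field) \<Rightarrow> (int \<Rightarrow> complex) \<Rightarrow> complex \<Rightarrow>
     int \<Rightarrow> 'k \<Rightarrow> 'k" where
  "measure_padic_L p N \<iota> chi \<zeta> j s =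
     inverse (\<iota> (gauss_sum N chi \<zeta>)) * mellin p (nu_character_measure p N \<iota> chi \<zeta>) j s"

text \<open>
  \<open>kubota_leopoldt p \<iota> \<gamma> \<theta> j\<close> is the function written \<open>t \<mapsto> L\<^sub>p(t, \<theta>\<omega>\<^sup>j)\<close>, for \<open>t\<close> a p-adic integer.
  Analyticity is required of the reflected function of \<open>s = 1 - t\<close>.
\<close>

definition kubota_leopoldt ::
    "nat \<Rightarrow> (complex \<Rightarrow> 'k::complete_nonarch_field) \<Rightarrow> 'k \<Rightarrow> (int \<Rightarrow> complex) \<Rightarrow> int \<Rightarrow> 'k \<Rightarrow> 'k" where
  "kubota_leopoldt p \<iota> \<gamma> \<theta> j = (THE f. f \<in> extensional Zp \<and>
     rigid_analytic_on_weight_disc \<gamma> (\<lambda>s. f (1 - s)) \<and>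
     (\<forall>n::nat. n \<ge> 1 \<and> [int n = j] (mod (int p - 1)) \<longrightarrow>
        f (1 - of_nat n) =
          \<iota> ((1 - \<theta> (int p) * of_nat p ^ (n - 1)) * dirichlet_L \<theta> (1 - of_nat n))))"

end

theory Submission
  imports Defs
begin

text \<open>
  For a root of unity \<open>z \<noteq> 1\<close> of order prime to \<open>p\<close>, integrating \<open>F\<close> against \<open>\<nu>\<^sub>z\<^sup>\<times>\<close> is the limit of the sums of
  \<open>F(a) a\<^sup>-\<^sup>1 z\<^sup>a / (1 - z\<^sup>q)\<close> over the \<open>a < q = p\<^sup>m\<close> prime to \<open>p\<close> (\<open>riemann_sums_nu_measure\<close>). At an integer \<open>n \<ge> 1\<close>
  with \<open>n \<equiv> j\<close> modulo \<open>p - 1\<close> the Mellin integrand is \<open>a\<^sup>n\<close>, so everything rests on the limits of the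
  sums of \<open>a\<^sup>k z\<^sup>a / (1 - z\<^sup>q)\<close>, with \<open>k = n - 1\<close>. These limits and the values \<open>Li\<^sub>-\<^sub>k(z)\<close> of the analytically
  continued polylogarithm at the complex root of unity are the same algebraic number: shifting the
  summation variable by one and expanding \<open>(a + 1)\<^sup>k\<close> gives both of them the same recursion in \<open>k\<close>,
  whose solution is the rational function \<open>polylog_quotient\<close>
  (\<open>moment_limit\<close>, \<open>lerch_neg_nat\<close>), and a field embedding carries one solution to the other.

  On the complex side the entire function \<open>\<Sigma> z\<^sup>n (n + 1)\<^sup>-\<^sup>s\<close> is obtained by repeated summation by parts:
  each step replaces the coefficients by their differences, which gains one power of \<open>n\<close>. Since
  \<open>chi\<close> is primitive, the twisted sums of \<open>chi(a) \<zeta>\<^sup>a\<^sup>n\<close> over \<open>a\<close> are \<open>G(chi) chi\<^sup>-\<^sup>1(n)\<close> for every \<open>n\<close>, and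
  \<open>G(chi) L(s, chi\<^sup>-\<^sup>1)\<close> is the combination of the polylogarithms at \<open>\<zeta>\<^sup>a\<close> with coefficients \<open>chi(a)\<close>.
  Restricting the \<open>p\<close>-adic sums to \<open>a\<close> prime to \<open>p\<close> subtracts \<open>p\<^sup>k\<close> times the same limit for \<open>z\<^sup>p\<close>, and as
  multiplication by \<open>p\<close> permutes the residues modulo \<open>N\<close> this produces the Euler factor
  (\<open>dirichlet_L_value_without_Euler_factor\<close>).

  For analyticity, every one-unit is \<open>u = \<gamma>\<^sup>l\<close> for some \<open>p\<close>-adic integer \<open>l\<close>, and
  \<open>u\<^sup>s = (\<gamma>\<^sup>s)\<^sup>l\<close> is the binomial series with exponent \<open>l\<close> in \<open>X = \<gamma>\<^sup>s - 1\<close>. Integrating it term by term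
  gives a power series in \<open>X\<close> with bounded coefficients (\<open>mellin_power_series\<close>); the coefficients
  are integrals because \<open>l\<close> depends continuously on \<open>u\<close>. Finally a power series on the weight disc
  is continuous in \<open>s\<close>, and the integers \<open>n \<ge> 1\<close> in a residue class modulo \<open>p - 1\<close> are dense in the
  \<open>p\<close>-adic integers, so the interpolation property has only one analytic solution, the
  Kubota-Leopoldt branch (\<open>kubota_leopoldt_eqI\<close>).
\<close>

section \<open>Ultrametric analysis\<close>

text \<open>
  This instance and the one for products make the general limit laws available.
\<close>

instance complete_nonarch_field \<subseteq> topological_ab_group_add
proof
  fix a b :: 'a
  have add: "dist (x + y) (a + b) \<le> max (dist x a) (dist y b)" for x y :: 'a
    using dist_ultrametric[of "x + y" "a + b" "a + y"] dist_add_right[of x y a] dist_add_right[of y a b]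
    by (simp add: add.commute)
  show "LIM x nhds a \<times>\<^sub>F nhds b. fst x + snd x :> nhds (a + b)"
    unfolding tendsto_iff
  proof (intro allI impI)
    fix e :: real assume "e > 0"
    then have "eventually (\<lambda>x. dist x a < e) (nhds a)" "eventually (\<lambda>x. dist x b < e) (nhds b)"
      by (auto simp: eventually_nhds_metric)
    then have "eventually (\<lambda>x. dist (fst x) a < e \<and> dist (snd x) b < e) (nhds a \<times>\<^sub>F nhds b)"
      unfolding eventually_prod_filter by (intro exI conjI allI impI) auto
    then show "eventually (\<lambda>x. dist (fst x + snd x) (a + b) < e) (nhds a \<times>\<^sub>F nhds b)"
      by eventually_elim (auto intro: le_less_trans[OF add])
  qed
  have "dist (- x) (- a) = dist x a" for x :: 'a
    using dist_add_right[of "- x" "x + a" "- a"] by (simp add: dist_commute)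
  then show "(uminus \<longlongrightarrow> - a) (nhds a)"
    unfolding tendsto_iff by (auto simp: eventually_nhds_metric)
qed

lemma dist_eq_absval: "dist x y = absval (x - y)"
  using dist_add_right[of "x - y" y 0] by (simp add: absval_def)

lemma absval_nonneg [simp]: "absval x \<ge> 0"
  by (simp add: absval_def)

lemma absval_zero [simp]: "absval 0 = 0"
  by (simp add: absval_def)

lemma absval_eq_0_iff [simp]: "absval x = 0 \<longleftrightarrow> x = 0"
  by (simp add: absval_def)

lemma absval_mult: "absval (x * y) = absval x * absval y"
  by (simp add: absval_def dist_mult_zero)

lemma absval_one [simp]: "absval 1 = 1"
  using absval_mult[of 1 1] absval_eq_0_iff[of 1] by simp

lemma absval_minus [simp]: "absval (- x) = absval x"
  using dist_commute[of x 0] by (simp add: dist_eq_absval)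

lemma absval_minus_commute: "absval (x - y) = absval (y - x)"
  using absval_minus[of "x - y"] by simp

lemma absval_add_le_max: "absval (x + y) \<le> max (absval x) (absval y)"
  using dist_ultrametric[of x "- y" 0] by (simp add: dist_eq_absval)

lemma absval_add_le: "absval x \<le> C \<Longrightarrow> absval y \<le> C \<Longrightarrow> absval (x + y) \<le> C"
  using absval_add_le_max[of x y] by simp

lemma absval_diff_le: "absval x \<le> C \<Longrightarrow> absval y \<le> C \<Longrightarrow> absval (x - y) \<le> C"
  using absval_add_le[of x C "- y"] by simp

lemma absval_diff_trans: "absval (x - y) \<le> C \<Longrightarrow> absval (y - z) \<le> C \<Longrightarrow> absval (x - z) \<le> C"
  using absval_add_le[of "x - y" C "y - z"] by simp

lemma absval_add_eq: "absval y < absval x \<Longrightarrow> absval (x + y) = absval x"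
  using absval_add_le_max[of x y] absval_add_le_max[of "x + y" "- y"] by auto

lemma absval_power: "absval (x ^ n) = absval x ^ n"
  by (induction n) (auto simp: absval_mult)

lemma absval_inverse: "absval (inverse x) = inverse (absval x)"
  using absval_mult[of x "inverse x"] by (cases "x = 0") (auto simp: field_simps)

lemma absval_divide: "absval (x / y) = absval x / absval y"
  by (simp add: divide_inverse absval_mult absval_inverse)

lemma absval_sum_le:
  assumes "\<And>a. a \<in> A \<Longrightarrow> absval (f a) \<le> C" and "C \<ge> 0"
  shows "absval (sum f A) \<le> C"
  using assms by (induction A rule: infinite_finite_induct) (auto intro: absval_add_le)

lemma absval_of_nat_le_1: "absval (of_nat n) \<le> 1"
  by (induction n) (auto intro: absval_add_le)

lemma absval_of_int_le_1: "absval (of_int n) \<le> 1"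
  by (cases n) (auto simp del: of_nat_Suc of_nat_add intro: absval_of_nat_le_1)

lemma absval_mult_le: "absval x \<le> B \<Longrightarrow> absval y \<le> C \<Longrightarrow> absval (x * y) \<le> B * C"
  unfolding absval_mult by (intro mult_mono) (auto intro: order_trans[OF absval_nonneg[of x]])

lemma absval_mult_diff_le:
  assumes "absval x \<le> 1" "absval y' \<le> 1" "absval (x - x') \<le> C" "absval (y - y') \<le> C"
  shows "absval (x * y - x' * y') \<le> C"
proof -
  have "x * y - x' * y' = x * (y - y') + (x - x') * y'"
    by (simp add: algebra_simps)
  then show ?thesis
    using assms absval_mult_le[of x 1 "y - y'" C] absval_mult_le[of "x - x'" C y' 1]
    by (auto intro!: absval_add_le)
qed

lemma absval_power_diff_le:
  assumes "absval x \<le> 1" "absval y \<le> 1"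
  shows "absval (x ^ n - y ^ n) \<le> absval (x - y)"
proof (induction n)
  case (Suc n)
  then show ?case
    using assms by (auto intro!: absval_mult_diff_le simp: absval_power power_le_one)
qed auto

instance complete_nonarch_field \<subseteq> topological_comm_monoid_mult
proof
  fix a b :: 'a
  define M where "M = 1 + absval a + absval b"
  have M: "M \<ge> 1" "absval a \<le> M" "absval b \<le> M" by (simp_all add: M_def)
  have mult: "absval (x * y - a * b) < e"
    if "e > 0" "absval (x - a) < min 1 (e / M)" "absval (y - b) < min 1 (e / M)" for x y and e
  proof -
    have *: "x * y - a * b = x * (y - b) + (x - a) * b"
      by (simp add: algebra_simps)
    have "absval x \<le> M"
      using absval_add_le[of a M "x - a"] that M by auto
    then have "absval (x * (y - b)) \<le> M * absval (y - b)" "absval ((x - a) * b) \<le> M * absval (x - a)"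
      using M by (auto simp: absval_mult mult.commute intro: mult_right_mono)
    moreover have "M * absval (y - b) < e" "M * absval (x - a) < e"
      using that M by (auto simp: field_simps)
    ultimately show ?thesis
      unfolding * using absval_add_le_max[of "x * (y - b)" "(x - a) * b"] by linarith
  qed
  show "LIM x nhds a \<times>\<^sub>F nhds b. fst x * snd x :> nhds (a * b)"
    unfolding tendsto_iff
  proof (intro allI impI)
    fix e :: real assume e: "e > 0"
    then have "eventually (\<lambda>x. dist x a < min 1 (e / M)) (nhds a)"
      "eventually (\<lambda>x. dist x b < min 1 (e / M)) (nhds b)"
      using M by (auto simp: eventually_nhds_metric intro!: exI[of _ "min 1 (e / M)"])
    then have "eventually (\<lambda>x. dist (fst x) a < min 1 (e / M) \<and> dist (snd x) b < min 1 (e / M))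
        (nhds a \<times>\<^sub>F nhds b)"
      unfolding eventually_prod_filter by (intro exI conjI allI impI) auto
    then show "eventually (\<lambda>x. dist (fst x * snd x) (a * b) < e) (nhds a \<times>\<^sub>F nhds b)"
      by eventually_elim (use mult e in \<open>auto simp: dist_eq_absval\<close>)
  qed
qed

lemma tendsto_iff_absval: "(f \<longlongrightarrow> l) F \<longleftrightarrow> ((\<lambda>x. absval (f x - l)) \<longlongrightarrow> 0) F"
  using tendsto_dist_iff[of f l F] by (simp add: dist_eq_absval)

lemma tendsto_absval: "(f \<longlongrightarrow> l) F \<Longrightarrow> ((\<lambda>x. absval (f x)) \<longlongrightarrow> absval l) F"
  unfolding absval_def by (intro tendsto_dist tendsto_const)

lemma tendsto_squeeze_absval:
  assumes "\<And>n. absval (f n - l) \<le> g n" "g \<longlonglongrightarrow> (0::real)"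
  shows "f \<longlonglongrightarrow> l"
  unfolding tendsto_iff_absval
  by (rule tendsto_sandwich[OF _ _ tendsto_const assms(2)]) (use assms in auto)

lemma absval_limit_le:
  assumes "f \<longlonglongrightarrow> l" "eventually (\<lambda>n. absval (f n) \<le> C) sequentially"
  shows "absval l \<le> C"
  using tendsto_upperbound[OF tendsto_absval[OF assms(1)] assms(2)] by simp

text \<open>
  The ultrametric inequality keeps small steps from accumulating, so vanishing consecutive
  differences already force convergence.
\<close>

lemma convergent_if_consecutive_diff:
  fixes f :: "nat \<Rightarrow> 'k::complete_nonarch_field"
  assumes "(\<lambda>n. absval (f (Suc n) - f n)) \<longlonglongrightarrow> 0"
  shows "convergent f"
proof -
  have "Cauchy f"
  proof (rule metric_CauchyI)
    fix e :: real assume "e > 0"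
    then have "eventually (\<lambda>n. absval (f (Suc n) - f n) < e) sequentially"
      using assms by (simp add: order_tendstoD(2))
    then obtain M where M: "absval (f (Suc n) - f n) < e" if "n \<ge> M" for n
      by (auto simp: eventually_sequentially)
    have far: "absval (f (M + n) - f M) < e" for n
    proof (induction n)
      case (Suc n)
      then show ?case
        using M[of "M + n"] absval_add_le_max[of "f (M + Suc n) - f (M + n)" "f (M + n) - f M"] by simp
    qed (use \<open>e > 0\<close> in auto)
    have "dist (f m) (f n) < e" if "m \<ge> M" "n \<ge> M" for m n
      using far[of "m - M"] far[of "n - M"] that dist_ultrametric[of "f m" "f n" "f M"]
      by (simp add: dist_eq_absval absval_minus_commute)
    then show "\<exists>M. \<forall>m\<ge>M. \<forall>n\<ge>M. dist (f m) (f n) < e" by blast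
  qed
  then show ?thesis
    by (rule Cauchy_convergent)
qed

lemma summable_if_terms_tend_0:
  fixes f :: "nat \<Rightarrow> 'k::complete_nonarch_field"
  assumes "(\<lambda>n. absval (f n)) \<longlonglongrightarrow> 0"
  shows "summable f"
  using convergent_if_consecutive_diff[of "\<lambda>n. sum f {..<n}"] assms
  by (simp add: summable_iff_convergent)

lemma absval_suminf_diff_partial_le:
  assumes "summable f" "\<And>n. n \<ge> K \<Longrightarrow> absval (f n) \<le> C" "C \<ge> 0"
  shows "absval (suminf f - sum f {..<K}) \<le> C"
proof (rule absval_limit_le)
  show "(\<lambda>n. sum f {..<n} - sum f {..<K}) \<longlonglongrightarrow> suminf f - sum f {..<K}"
    by (intro tendsto_diff tendsto_const summable_LIMSEQ assms)
  have "sum f {..<n} - sum f {..<K} = sum f {K..<n}" if "n \<ge> K" for n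
    using that sum_diff_nat_ivl[of 0 K n f] by (simp add: lessThan_atLeast0)
  then show "\<forall>\<^sub>F n in sequentially. absval (sum f {..<n} - sum f {..<K}) \<le> C"
    unfolding eventually_sequentially
    by (intro exI[of _ K]) (auto intro!: absval_sum_le assms)
qed

section \<open>The ring of p-adic integers\<close>

text \<open>
  The parameter \<open>K\<close> names the type of the field, which the second assumption mentions.
\<close>

locale padic_field =
  fixes p :: nat and K :: "'k::complete_nonarch_field itself"
  assumes prime_p: "prime p" and absval_p: "absval (of_nat p :: 'k) = 1 / real p"
begin

lemma p_gt_1: "p > 1"
  using prime_p prime_gt_1_nat by blast

lemma p_power_pos [simp]: "0 < p ^ m"
  using p_gt_1 by simp

lemma absval_p_power: "absval (of_nat p ^ m :: 'k) = 1 / real p ^ m"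
  by (simp add: absval_power absval_p power_divide)

lemma inverse_p_power_tendsto_0: "(\<lambda>m. C * (1 / real p ^ m)) \<longlonglongrightarrow> 0"
  using tendsto_mult_right_zero[OF LIMSEQ_inverse_realpow_zero[of "real p"], of C] p_gt_1
  by (simp add: divide_inverse)

lemma inverse_p_power_less:
  assumes "e > 0"
  obtains m where "1 / real p ^ m < e"
  using order_tendstoD(2)[OF inverse_p_power_tendsto_0[of 1] assms]
  by (auto simp: eventually_sequentially)

lemma inverse_p_power_antimono: "m \<le> n \<Longrightarrow> 1 / real p ^ n \<le> 1 / real p ^ m"
  using p_gt_1 by (simp add: frac_le power_increasing)

lemma real_p_gt_1: "real p > 1"
  using p_gt_1 by simp

lemma inverse_p_power_Suc_less_1: "1 / real p ^ Suc m < 1"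
  using one_less_power[OF real_p_gt_1, of "Suc m"] real_p_gt_1 by (simp add: divide_less_eq)

lemma inverse_p_power_le_1: "1 / real p ^ m \<le> 1"
  using inverse_p_power_antimono[of 0 m] by simp

text \<open>
  An integer prime to \<open>p\<close> has a Bezout combination with \<open>p\<close> equal to 1, and \<open>p\<close> contributes too little to it.
\<close>

lemma absval_of_int_eq_1:
  assumes "\<not> int p dvd n"
  shows "absval (of_int n :: 'k) = 1"
proof (rule ccontr)
  assume "absval (of_int n :: 'k) \<noteq> 1"
  then have small: "absval (of_int n :: 'k) < 1"
    using absval_of_int_le_1[of n] by (simp add: less_le)
  have "coprime n (int p)"
    using assms prime_p by (metis coprime_commute prime_imp_coprime prime_nat_int_transfer)
  then obtain u v where "u * n + v * int p = 1"
    using bezout_int[of n "int p"] by auto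
  then have eq: "1 = (of_int u * of_int n + of_int v * of_nat p :: 'k)"
    by (metis of_int_1 of_int_add of_int_mult of_int_of_nat_eq)
  have "absval (of_int u * of_int n :: 'k) < 1"
    using absval_of_int_le_1[of u] small
    by (auto simp: absval_mult intro: le_less_trans[OF mult_left_le_one_le])
  moreover have "absval (of_int v * of_nat p :: 'k) < 1"
    using le_less_trans[OF absval_of_int_le_1[of v, where 'a = 'k] real_p_gt_1] real_p_gt_1
    by (simp add: absval_mult absval_p)
  ultimately show False
    using absval_add_le_max[of "of_int u * of_int n" "of_int v * of_nat p :: 'k"]
    by (simp flip: eq)
qed

lemma absval_of_int_le_iff: "absval (of_int n :: 'k) \<le> 1 / real p ^ m \<longleftrightarrow> int p ^ m dvd n"
proof
  assume "int p ^ m dvd n"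
  then obtain l where "n = int p ^ m * l" ..
  then have "of_int n = (of_nat p ^ m * of_int l :: 'k)"
    by simp
  then show "absval (of_int n :: 'k) \<le> 1 / real p ^ m"
    using divide_right_mono[OF absval_of_int_le_1[of l], of "real p ^ m"]
    by (simp add: absval_mult absval_p_power)
next
  assume le: "absval (of_int n :: 'k) \<le> 1 / real p ^ m"
  show "int p ^ m dvd n"
  proof (cases "n = 0")
    case False
    have "\<not> is_unit (int p)"
      using p_gt_1 by simp
    then obtain q where q: "n = int p ^ multiplicity (int p) n * q" "\<not> int p dvd q"
      using multiplicity_decompose'[of n "int p"] False by blast
    have "absval (of_int n :: 'k) = 1 / real p ^ multiplicity (int p) n"
      using absval_of_int_eq_1[OF q(2)]
      by (subst q(1)) (simp add: absval_mult absval_p_power)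
    then have "real p ^ m \<le> real p ^ multiplicity (int p) n"
      using inverse_le_imp_le[of "real p ^ multiplicity (int p) n" "real p ^ m"] le real_p_gt_1
      by (simp add: inverse_eq_divide)
    then have "m \<le> multiplicity (int p) n"
      using power_le_imp_le_exp[OF real_p_gt_1] by blast
    then show ?thesis
      by (rule multiplicity_dvd')
  qed simp
qed

lemma absval_of_nat_diff_le_iff:
  "absval (of_nat a - of_nat b :: 'k) \<le> 1 / real p ^ m \<longleftrightarrow> [a = b] (mod p ^ m)"
proof -
  have "(of_nat a - of_nat b :: 'k) = of_int (int a - int b)"
    by simp
  then have "absval (of_nat a - of_nat b :: 'k) \<le> 1 / real p ^ m \<longleftrightarrow> int p ^ m dvd int a - int b"
    by (simp only: absval_of_int_le_iff)
  also have "\<dots> \<longleftrightarrow> [a = b] (mod p ^ m)"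
    using cong_iff_dvd_diff[of "int a" "int b" "int p ^ m"] cong_int_iff[of a b "p ^ m"] by simp
  finally show ?thesis .
qed

lemma absval_of_nat_le_iff: "absval (of_nat a :: 'k) \<le> 1 / real p ^ m \<longleftrightarrow> p ^ m dvd a"
  using absval_of_nat_diff_le_iff[of a 0 m] by (simp add: cong_0_iff)

lemma absval_of_nat_eq_1_iff: "absval (of_nat a :: 'k) = 1 \<longleftrightarrow> \<not> p dvd a"
proof
  assume "\<not> p dvd a"
  then show "absval (of_nat a :: 'k) = 1"
    using absval_of_int_eq_1[of "int a"] by simp
next
  assume "absval (of_nat a :: 'k) = 1"
  then show "\<not> p dvd a"
    using absval_of_nat_le_iff[of a 1] p_gt_1 by (auto simp: divide_le_eq)
qed

lemma of_nat_mem_Zp [simp]: "(of_nat a :: 'k) \<in> Zp"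
  unfolding Zp_def using closure_subset[of "\<int> :: 'k set"] by auto

lemma of_int_mem_Zp [simp]: "(of_int a :: 'k) \<in> Zp"
  unfolding Zp_def using closure_subset[of "\<int> :: 'k set"] by auto

lemma one_mem_Zp [simp]: "(1 :: 'k) \<in> Zp"
  using of_nat_mem_Zp[of 1] by simp

lemma closed_Zp: "closed (Zp :: 'k set)"
  by (simp add: Zp_def)

text \<open>
  The representatives below \<open>p\<^sup>m\<close> suffice, since reducing an integer modulo \<open>p\<^sup>m\<close> moves it by at most \<open>p\<^sup>-\<^sup>m\<close>.
\<close>

lemma Zp_approx:
  assumes "(x::'k) \<in> Zp"
  obtains n where "n < p ^ m" "absval (x - of_nat n) \<le> 1 / real p ^ m"
proof -
  have "1 / real p ^ m > 0"
    using p_gt_1 by simp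
  then obtain k where k: "absval (of_int k - x) < 1 / real p ^ m"
    using assms unfolding Zp_def closure_approachable dist_eq_absval by (metis Ints_cases)
  define n where "n = nat (k mod int p ^ m)"
  have "0 \<le> k mod int p ^ m" "k mod int p ^ m < int p ^ m"
    using p_gt_1 by auto
  then have n: "int n = k mod int p ^ m" "n < p ^ m"
    by (auto simp: n_def nat_less_iff)
  have "int p ^ m dvd k - int n"
    by (simp add: n(1))
  then have "absval (of_int k - of_nat n :: 'k) \<le> 1 / real p ^ m"
    using absval_of_int_le_iff[of "k - int n" m] by simp
  then have "absval (x - of_nat n) \<le> 1 / real p ^ m"
    using k absval_diff_trans[of x "of_int k" "1 / real p ^ m" "of_nat n"]
    by (simp add: absval_minus_commute)
  then show ?thesis
    using that n(2) by blast
qed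

lemma Zp_I:
  assumes "\<And>m. \<exists>n. absval ((x::'k) - of_nat n) \<le> 1 / real p ^ m"
  shows "x \<in> Zp"
proof -
  have "\<exists>y\<in>\<int>. dist y x < e" if e: "e > 0" for e
  proof -
    obtain m where "1 / real p ^ m < e"
      using e by (rule inverse_p_power_less)
    moreover obtain n where "absval (x - of_nat n) \<le> 1 / real p ^ m"
      using assms by blast
    ultimately show ?thesis
      by (intro bexI[of _ "of_nat n"]) (auto simp: dist_eq_absval absval_minus_commute)
  qed
  then show ?thesis
    by (simp add: Zp_def closure_approachable)
qed

lemma Zp_absval_le_1: "(x::'k) \<in> Zp \<Longrightarrow> absval x \<le> 1"
  using Zp_approx[of x 0] absval_add_le[of "x - of_nat n" 1 "of_nat n" for n] absval_of_nat_le_1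
  by (metis diff_add_cancel div_by_1 power_0)

lemma Zp_add [intro]:
  assumes "(x::'k) \<in> Zp" "y \<in> Zp"
  shows "x + y \<in> Zp"
proof (rule Zp_I)
  fix m
  obtain a b where "absval (x - of_nat a) \<le> 1 / real p ^ m" "absval (y - of_nat b) \<le> 1 / real p ^ m"
    using Zp_approx assms by metis
  then have "absval (x + y - of_nat (a + b)) \<le> 1 / real p ^ m"
    using absval_add_le[of "x - of_nat a" _ "y - of_nat b"] by (simp add: algebra_simps)
  then show "\<exists>n. absval (x + y - of_nat n) \<le> 1 / real p ^ m" ..
qed

lemma Zp_mult [intro]:
  assumes "(x::'k) \<in> Zp" "y \<in> Zp"
  shows "x * y \<in> Zp"
proof (rule Zp_I)
  fix m
  obtain a b where "absval (x - of_nat a) \<le> 1 / real p ^ m" "absval (y - of_nat b) \<le> 1 / real p ^ m"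
    using Zp_approx assms by metis
  then have "absval (x * y - of_nat (a * b)) \<le> 1 / real p ^ m"
    using Zp_absval_le_1[OF assms(1)] absval_of_nat_le_1 by (auto intro!: absval_mult_diff_le)
  then show "\<exists>n. absval (x * y - of_nat n) \<le> 1 / real p ^ m" ..
qed

lemma Zp_minus [intro]: "(x::'k) \<in> Zp \<Longrightarrow> - x \<in> Zp"
  using Zp_mult[OF of_int_mem_Zp[of "- 1"], of x] by simp

lemma Zp_diff [intro]: "(x::'k) \<in> Zp \<Longrightarrow> y \<in> Zp \<Longrightarrow> x - y \<in> Zp"
  using Zp_add[of x "- y"] by auto

lemma Zp_power [intro]: "(x::'k) \<in> Zp \<Longrightarrow> x ^ n \<in> Zp"
  by (induction n) auto

text \<open>
  Inverses modulo \<open>p\<^sup>m\<close> of approximating integers approximate the inverse.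
\<close>

lemma Zp_inverse:
  assumes "(x::'k) \<in> Zp" "absval x = 1"
  shows "inverse x \<in> Zp"
proof (rule Zp_I)
  fix m
  obtain n where n: "absval (x - of_nat n) \<le> 1 / real p ^ Suc m"
    using Zp_approx assms by metis
  then have "absval (x - of_nat n) < absval x"
    using assms inverse_p_power_Suc_less_1[of m] by linarith
  then have "absval (of_nat n :: 'k) = 1"
    using absval_add_eq[of "of_nat n - x" x] assms by (simp add: absval_minus_commute)
  then have "coprime n (p ^ Suc m)"
    using prime_imp_coprime[OF prime_p, of n]
    by (simp add: absval_of_nat_eq_1_iff coprime_commute[of n p])
  then obtain l where "[n * l = 1] (mod p ^ Suc m)"
    using cong_solve_coprime_nat by fastforce
  then have "absval (of_nat (n * l) - of_nat 1 :: 'k) \<le> 1 / real p ^ Suc m"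
    by (simp only: absval_of_nat_diff_le_iff)
  moreover have "absval (x * of_nat l - of_nat n * of_nat l) \<le> 1 / real p ^ Suc m"
    using n absval_mult_le[OF n absval_of_nat_le_1[of l]] by (simp add: left_diff_distrib)
  ultimately have "absval (1 - x * of_nat l) \<le> 1 / real p ^ Suc m"
    using absval_diff_trans[of "x * of_nat l" "of_nat n * of_nat l" _ 1]
    by (simp add: absval_minus_commute)
  moreover have "absval (inverse x - of_nat l) = absval (1 - x * of_nat l)"
  proof -
    have "1 - x * of_nat l = x * (inverse x - of_nat l)"
      using assms by (cases "x = 0") (auto simp: field_simps)
    then show ?thesis
      using assms by (simp add: absval_mult)
  qed
  ultimately show "\<exists>n. absval (inverse x - of_nat n) \<le> 1 / real p ^ m"
    using inverse_p_power_antimono[of m "Suc m"] by (intro exI[of _ l]) linarith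
qed

lemma Zp_divide_p_power:
  assumes "(x::'k) \<in> Zp" "absval x \<le> 1 / real p ^ m"
  obtains y where "y \<in> Zp" "x = of_nat p ^ m * y"
proof
  have p0: "(of_nat p :: 'k) \<noteq> 0"
    using p_gt_1 by simp
  show x: "x = of_nat p ^ m * (x / of_nat p ^ m)"
    using p0 by simp
  show "x / of_nat p ^ m \<in> Zp"
  proof (rule Zp_I)
    fix M
    obtain n where n: "absval (x - of_nat n) \<le> 1 / real p ^ (m + M)"
      using Zp_approx assms by metis
    then have "absval (x - of_nat n) \<le> 1 / real p ^ m"
      using inverse_p_power_antimono[of m "m + M"] by linarith
    then have "absval (of_nat n :: 'k) \<le> 1 / real p ^ m"
      using absval_diff_le[OF assms(2), of "x - of_nat n"] by simp
    then obtain l where l: "n = p ^ m * l"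
      by (auto simp: absval_of_nat_le_iff)
    have eq: "x / of_nat p ^ m - of_nat l = (x - of_nat n) / of_nat p ^ m"
      using p0 by (simp add: l field_simps)
    have "absval (x / of_nat p ^ m - of_nat l) = absval (x - of_nat n) * real p ^ m"
      unfolding eq by (simp add: absval_divide absval_p_power)
    also have "\<dots> \<le> 1 / real p ^ (m + M) * real p ^ m"
      using n by (intro mult_right_mono) auto
    also have "\<dots> = 1 / real p ^ M"
      using p_gt_1 by (simp add: power_add)
    finally have "absval (x / of_nat p ^ m - of_nat l) \<le> 1 / real p ^ M" .
    then show "\<exists>n. absval (x / of_nat p ^ m - of_nat n) \<le> 1 / real p ^ M"
      by blast
  qed
qed

lemma Zp_coset_eq: "Zp_coset p m a = {x::'k. x \<in> Zp \<and> absval (x - of_nat a) \<le> 1 / real p ^ m}"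
proof (intro equalityI subsetI)
  fix x :: 'k assume "x \<in> Zp_coset p m a"
  then obtain y where y: "y \<in> Zp" "x = of_nat a + of_nat p ^ m * y"
    by (auto simp: Zp_coset_def)
  then show "x \<in> {x. x \<in> Zp \<and> absval (x - of_nat a) \<le> 1 / real p ^ m}"
    using Zp_absval_le_1[OF y(1)] Zp_add[OF of_nat_mem_Zp Zp_mult[OF Zp_power[OF of_nat_mem_Zp] y(1)]]
    by (simp add: absval_mult absval_p_power divide_right_mono)
next
  fix x :: 'k assume "x \<in> {x. x \<in> Zp \<and> absval (x - of_nat a) \<le> 1 / real p ^ m}"
  then obtain y where "y \<in> Zp" "x - of_nat a = of_nat p ^ m * y"
    using Zp_divide_p_power[of "x - of_nat a" m] Zp_diff[OF _ of_nat_mem_Zp[of a]] by auto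
  then show "x \<in> Zp_coset p m a"
    by (auto simp: Zp_coset_def algebra_simps intro!: exI[of _ y])
qed

lemma of_nat_mem_Zp_coset_iff: "(of_nat b :: 'k) \<in> Zp_coset p m a \<longleftrightarrow> [b = a] (mod p ^ m)"
  by (simp add: Zp_coset_eq absval_of_nat_diff_le_iff)

lemma Zp_units_eq: "Zp_units = {x::'k. x \<in> Zp \<and> absval x = 1}"
proof (intro equalityI subsetI)
  fix x :: 'k assume "x \<in> Zp_units"
  then obtain y where y: "x \<in> Zp" "y \<in> Zp" "x * y = 1"
    by (auto simp: Zp_units_def)
  then have "absval x * absval y = 1"
    by (metis absval_mult absval_one)
  moreover have "absval x * absval y \<le> absval x * 1"
    using Zp_absval_le_1[OF y(2)] by (intro mult_left_mono) auto
  ultimately have "absval x = 1"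
    using Zp_absval_le_1[OF y(1)] by linarith
  then show "x \<in> {x. x \<in> Zp \<and> absval x = 1}"
    using y by simp
next
  fix x :: 'k assume "x \<in> {x. x \<in> Zp \<and> absval x = 1}"
  then show "x \<in> Zp_units"
    using Zp_inverse[of x] by (cases "x = 0") (auto simp: Zp_units_def intro!: bexI[of _ "inverse x"])
qed

lemma of_nat_mem_Zp_units_iff: "(of_nat a :: 'k) \<in> Zp_units \<longleftrightarrow> \<not> p dvd a"
  by (simp add: Zp_units_eq absval_of_nat_eq_1_iff)

lemma one_units_eq: "one_units p = {u::'k. u \<in> Zp \<and> absval (u - 1) \<le> 1 / real p}"
  using Zp_coset_eq[of 1 1] by (simp add: one_units_def Zp_coset_def)

lemma compact_Zp: "compact (Zp :: 'k set)"
  unfolding compact_eq_totally_bounded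
proof (intro conjI allI impI)
  show "complete (Zp :: 'k set)"
    using closed_Zp by (simp add: complete_eq_closed)
  fix e :: real assume "e > 0"
  then obtain m where m: "1 / real p ^ m < e"
    by (rule inverse_p_power_less)
  have "x \<in> (\<Union>x\<in>of_nat ` {..<p ^ m}. ball x e)" if x: "(x::'k) \<in> Zp" for x
  proof -
    obtain n where "n < p ^ m" "absval (x - of_nat n) \<le> 1 / real p ^ m"
      using x by (rule Zp_approx)
    then show ?thesis
      using m by (auto simp: dist_eq_absval absval_minus_commute intro!: bexI[of _ n])
  qed
  then show "\<exists>k. finite k \<and> (Zp :: 'k set) \<subseteq> (\<Union>x\<in>k. ball x e)"
    by (intro exI[of _ "of_nat ` {..<p ^ m}"]) auto
qed

lemma open_absval_ball: "r > 0 \<Longrightarrow> open {x::'k. absval (x - c) \<le> r}"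
  unfolding open_dist
proof (intro ballI)
  fix x :: 'k assume r: "r > 0" and "x \<in> {x. absval (x - c) \<le> r}"
  then have "absval (y - c) \<le> r" if "absval (y - x) < r" for y
    using absval_diff_trans[of y x r c] that by simp
  then show "\<exists>e>0. \<forall>y. dist y x < e \<longrightarrow> y \<in> {x. absval (x - c) \<le> r}"
    using r by (intro exI[of _ r]) (auto simp: dist_eq_absval)
qed

lemma closed_absval_ball: "closed {x::'k. absval (x - c) \<le> r}"
proof -
  have "{x::'k. absval (x - c) \<le> r} = cball c r"
    by (auto simp: dist_eq_absval absval_minus_commute)
  then show ?thesis
    by simp
qed

lemma Zp_coset_compact_open: "(Zp_coset p m a :: 'k set) \<in> compact_opens Zp"
proof -
  have eq: "Zp_coset p m a = (Zp :: 'k set) \<inter> {x. absval (x - of_nat a) \<le> 1 / real p ^ m}"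
    by (auto simp: Zp_coset_eq)
  then show ?thesis
    unfolding compact_opens_def eq using p_gt_1
    by (auto intro!: compact_Int_closed compact_Zp closed_absval_ball openin_open_Int open_absval_ball)
qed

lemma Zp_coset_subset_units: "\<not> p dvd a \<Longrightarrow> (Zp_coset p (Suc m) a :: 'k set) \<subseteq> Zp_units"
proof
  fix x :: 'k assume a: "\<not> p dvd a" and x: "x \<in> Zp_coset p (Suc m) a"
  then have "absval (x - of_nat a) < absval (of_nat a :: 'k)"
    using inverse_p_power_Suc_less_1[of m] absval_of_nat_eq_1_iff[of a]
    by (simp add: Zp_coset_eq del: power_Suc)
  then show "x \<in> Zp_units"
    using absval_add_eq[of "x - of_nat a" "of_nat a"] a x absval_of_nat_eq_1_iff[of a]
    by (simp add: Zp_units_eq Zp_coset_eq)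
qed

lemma unit_coset_compact_open:
  assumes "\<not> p dvd a"
  shows "(Zp_coset p (Suc m) a :: 'k set) \<in> compact_opens Zp_units"
proof -
  have "compact (Zp_coset p (Suc m) a :: 'k set)"
    "openin (top_of_set Zp) (Zp_coset p (Suc m) a :: 'k set)"
    using Zp_coset_compact_open[of "Suc m" a] by (auto simp: compact_opens_def)
  moreover have "(Zp_units :: 'k set) \<subseteq> Zp"
    by (auto simp: Zp_units_eq)
  ultimately show ?thesis
    using Zp_coset_subset_units[OF assms]
    by (auto simp: compact_opens_def intro: openin_subset_trans)
qed

text \<open>
  Compactness makes the radius uniform: a compact open set is a union of cosets of one level.
\<close>

lemma compact_open_stable:
  assumes "(U :: 'k set) \<in> compact_opens Zp"
  obtains m where "\<forall>x\<in>U. \<forall>y\<in>Zp. absval (x - y) \<le> 1 / real p ^ m \<longrightarrow> y \<in> U"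
proof -
  obtain T where T: "open T" "U = Zp \<inter> T"
    using assms by (auto simp: compact_opens_def openin_open)
  then obtain e where e: "e > 0" "(\<Union>x\<in>U. ball x e) \<subseteq> T"
    using compact_subset_open_imp_ball_epsilon_subset[of U T] assms by (auto simp: compact_opens_def)
  obtain m where "1 / real p ^ m < e"
    using e(1) by (rule inverse_p_power_less)
  then have "y \<in> U" if "x \<in> U" "y \<in> Zp" "absval (x - y) \<le> 1 / real p ^ m" for x y
    using that e(2) unfolding T(2) by (fastforce simp: dist_eq_absval subset_iff)
  then show ?thesis
    using that by blast
qed

lemma compact_opens_Un:
  "U \<in> compact_opens X \<Longrightarrow> V \<in> compact_opens X \<Longrightarrow> U \<union> V \<in> compact_opens (X :: 'k set)"
  by (auto simp: compact_opens_def)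

lemma compact_opens_empty: "{} \<in> compact_opens (X :: 'k set)"
  by (auto simp: compact_opens_def)

end

section \<open>Bounded distributions and their integrals\<close>

context padic_field
begin

text \<open>
  A measure is handled through its values \<open>w m a\<close> on the cosets \<open>a + p\<^sup>m \<int>\<^sub>p\<close>; the first condition is finite
  additivity, and \<open>C\<close> bounds the values.
\<close>

definition bounded_distribution :: "(nat \<Rightarrow> nat \<Rightarrow> 'k) \<Rightarrow> real \<Rightarrow> bool" where
  "bounded_distribution w C \<longleftrightarrow>
     (\<forall>m a. a < p ^ m \<longrightarrow> w m a = (\<Sum>c<p. w (Suc m) (a + p ^ m * c))) \<and>
     (\<forall>m a. a < p ^ m \<longrightarrow> absval (w m a) \<le> C)"

text \<open>
  Integrands are functions of the standard representatives, which form a dense set.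
\<close>

definition riemann_sum :: "(nat \<Rightarrow> nat \<Rightarrow> 'k) \<Rightarrow> (nat \<Rightarrow> 'k) \<Rightarrow> nat \<Rightarrow> 'k" where
  "riemann_sum w f m = (\<Sum>a<p ^ m. f a * w m a)"

definition riemann_integral :: "(nat \<Rightarrow> nat \<Rightarrow> 'k) \<Rightarrow> (nat \<Rightarrow> 'k) \<Rightarrow> 'k" where
  "riemann_integral w f = lim (riemann_sum w f)"

definition oscillation_le :: "(nat \<Rightarrow> 'k) \<Rightarrow> nat \<Rightarrow> real \<Rightarrow> bool" where
  "oscillation_le f m \<delta> \<longleftrightarrow> (\<forall>a b. [a = b] (mod p ^ m) \<longrightarrow> absval (f a - f b) \<le> \<delta>)"

definition padic_continuous :: "(nat \<Rightarrow> 'k) \<Rightarrow> bool" where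
  "padic_continuous f \<longleftrightarrow> (\<forall>e>0. \<exists>m. oscillation_le f m e)"

lemma bounded_distributionD:
  assumes "bounded_distribution w C" "a < p ^ m"
  shows "w m a = (\<Sum>c<p. w (Suc m) (a + p ^ m * c))" "absval (w m a) \<le> C"
  using assms unfolding bounded_distribution_def by blast+

lemma bounded_distribution_nonneg: "bounded_distribution w C \<Longrightarrow> C \<ge> 0"
  unfolding bounded_distribution_def
  by (meson absval_nonneg p_power_pos order_trans)

lemma sum_lessThan_power_Suc:
  "(\<Sum>b<p ^ Suc m. h b) = (\<Sum>a<p ^ m. \<Sum>c<p. h (a + p ^ m * c :: nat) :: 'b::comm_monoid_add)"
  unfolding sum.cartesian_product
proof (rule sum.reindex_bij_witness[where j = "\<lambda>b. (b mod p ^ m, b div p ^ m)"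
      and i = "\<lambda>(a, c). a + p ^ m * c"])
  fix b assume "b \<in> {..<p ^ Suc m}"
  then show "(b mod p ^ m, b div p ^ m) \<in> {..<p ^ m} \<times> {..<p}"
    using p_gt_1 by (auto simp: less_mult_imp_div_less mult.commute)
next
  fix x assume "x \<in> {..<p ^ m} \<times> {..<p}"
  then obtain a c where x: "x = (a, c)" "a < p ^ m" "c < p" by auto
  have "a + p ^ m * c < p ^ m * Suc c"
    using x by simp
  also have "\<dots> \<le> p ^ m * p"
    using x by (intro mult_left_mono) auto
  finally show "(case x of (a, c) \<Rightarrow> a + p ^ m * c) \<in> {..<p ^ Suc m}"
    by (simp add: x mult.commute)
qed (auto simp: less_mult_imp_div_less)

lemma oscillation_le_mono: "oscillation_le f m \<delta> \<Longrightarrow> m \<le> n \<Longrightarrow> oscillation_le f n \<delta>"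
  unfolding oscillation_le_def by (meson cong_dvd_modulus_nat le_imp_power_dvd)

lemma oscillation_le_nonneg: "oscillation_le f m \<delta> \<Longrightarrow> \<delta> \<ge> 0"
  unfolding oscillation_le_def by (metis absval_zero cong_refl diff_self)

text \<open>
  Passing to the next level replaces \<open>f a\<close> by the values of \<open>f\<close> at the points of the same coset, which
  costs at most the oscillation of \<open>f\<close> times the bound on the distribution.
\<close>

lemma riemann_sum_Suc_diff_le:
  assumes w: "bounded_distribution w C" and f: "oscillation_le f m \<delta>"
  shows "absval (riemann_sum w f (Suc m) - riemann_sum w f m) \<le> C * \<delta>"
proof -
  have "\<delta> \<ge> 0"
    using f by (rule oscillation_le_nonneg)
  then have C\<delta>: "C * \<delta> \<ge> 0"
    using bounded_distribution_nonneg[OF w] by simp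
  have "riemann_sum w f m = (\<Sum>a<p ^ m. \<Sum>c<p. f a * w (Suc m) (a + p ^ m * c))"
    unfolding riemann_sum_def using w
    by (intro sum.cong) (auto simp: bounded_distribution_def sum_distrib_left)
  then have eq: "riemann_sum w f (Suc m) - riemann_sum w f m =
      (\<Sum>a<p ^ m. \<Sum>c<p. (f (a + p ^ m * c) - f a) * w (Suc m) (a + p ^ m * c))"
    unfolding riemann_sum_def sum_lessThan_power_Suc
    by (simp add: sum_subtractf left_diff_distrib)
  have "absval ((f (a + p ^ m * c) - f a) * w (Suc m) (a + p ^ m * c)) \<le> C * \<delta>"
    if "a < p ^ m" "c < p" for a c
  proof -
    have "a + p ^ m * c < p ^ m * Suc c"
      using that by simp
    also have "\<dots> \<le> p ^ m * p"
      using that by (intro mult_left_mono) auto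
    finally have "absval (w (Suc m) (a + p ^ m * c)) \<le> C"
      by (intro bounded_distributionD[OF w]) (simp add: mult.commute)
    moreover have "absval (f (a + p ^ m * c) - f a) \<le> \<delta>"
      using f by (simp add: oscillation_le_def cong_def)
    ultimately show ?thesis
      using absval_mult_le by (subst mult.commute)
  qed
  then show ?thesis
    unfolding eq using C\<delta> by (intro absval_sum_le) auto
qed

lemma riemann_sum_diff_le:
  assumes w: "bounded_distribution w C" and f: "oscillation_le f m \<delta>" and "m \<le> n"
  shows "absval (riemann_sum w f n - riemann_sum w f m) \<le> C * \<delta>"
  using \<open>m \<le> n\<close>
proof (induction n rule: dec_induct)
  case base
  have "\<delta> \<ge> 0"
    using f by (rule oscillation_le_nonneg)
  then show ?case
    using bounded_distribution_nonneg[OF w] by simp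
next
  case (step n)
  then show ?case
    using riemann_sum_Suc_diff_le[OF w oscillation_le_mono[OF f step.hyps(1)]] absval_diff_trans
    by blast
qed

lemma riemann_integral:
  assumes w: "bounded_distribution w C" and f: "padic_continuous f"
  shows "riemann_sum w f \<longlonglongrightarrow> riemann_integral w f"
proof -
  have "(\<lambda>n. absval (riemann_sum w f (Suc n) - riemann_sum w f n)) \<longlonglongrightarrow> 0"
  proof (rule LIMSEQ_I)
    fix r :: real assume r: "r > 0"
    have C: "C \<ge> 0"
      using w by (rule bounded_distribution_nonneg)
    define e where "e = r / (C + 1)"
    have e: "e > 0" "C * e < r"
      using r C by (auto simp: e_def field_simps)
    obtain m where m: "oscillation_le f m e"
      using f e(1) by (auto simp: padic_continuous_def)
    have "absval (riemann_sum w f (Suc n) - riemann_sum w f n) < r" if "n \<ge> m" for n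
      using riemann_sum_Suc_diff_le[OF w oscillation_le_mono[OF m that]] e(2) by simp
    then show "\<exists>no. \<forall>n\<ge>no. norm (absval (riemann_sum w f (Suc n) - riemann_sum w f n) - 0) < r"
      by auto
  qed
  then show ?thesis
    unfolding riemann_integral_def
    using convergent_if_consecutive_diff convergent_LIMSEQ_iff by blast
qed

lemma riemann_integral_diff_le:
  assumes w: "bounded_distribution w C" and f: "padic_continuous f" and "oscillation_le f m \<delta>"
  shows "absval (riemann_integral w f - riemann_sum w f m) \<le> C * \<delta>"
proof (rule absval_limit_le)
  show "(\<lambda>n. riemann_sum w f n - riemann_sum w f m) \<longlonglongrightarrow> riemann_integral w f - riemann_sum w f m"
    by (intro tendsto_diff tendsto_const riemann_integral[OF w f])
  show "\<forall>\<^sub>F n in sequentially. absval (riemann_sum w f n - riemann_sum w f m) \<le> C * \<delta>"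
    using riemann_sum_diff_le[OF w assms(3)] by (auto simp: eventually_sequentially)
qed

lemma absval_riemann_sum_le:
  assumes w: "bounded_distribution w C" and "\<And>a. absval (f a) \<le> B"
  shows "absval (riemann_sum w f m) \<le> B * C"
proof -
  have "B \<ge> 0"
    using assms(2)[of 0] order_trans[OF absval_nonneg] by blast
  then show ?thesis
    unfolding riemann_sum_def
    using assms bounded_distribution_nonneg[OF w]
    by (intro absval_sum_le absval_mult_le) (auto simp: bounded_distribution_def)
qed

lemma absval_riemann_integral_le:
  assumes w: "bounded_distribution w C" and f: "padic_continuous f" and "\<And>a. absval (f a) \<le> B"
  shows "absval (riemann_integral w f) \<le> B * C"
  using absval_riemann_sum_le[OF w assms(3)]
  by (intro absval_limit_le[OF riemann_integral[OF w f]] always_eventually allI)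

lemma compact_open_indicator_oscillation:
  assumes "(U :: 'k set) \<in> compact_opens Zp"
  shows "\<exists>m. oscillation_le (\<lambda>a. if of_nat a \<in> U then 1 else 0 :: 'k) m 0"
proof -
  obtain m where "\<forall>x\<in>U. \<forall>y\<in>Zp. absval (x - y) \<le> 1 / real p ^ m \<longrightarrow> y \<in> U"
    by (rule compact_open_stable[OF assms])
  then have m: "\<And>x y. x \<in> U \<Longrightarrow> y \<in> Zp \<Longrightarrow> absval (x - y) \<le> 1 / real p ^ m \<Longrightarrow> y \<in> U"
    by blast
  have "oscillation_le (\<lambda>a. if of_nat a \<in> U then 1 else 0 :: 'k) m 0"
    unfolding oscillation_le_def
    using m[of "of_nat a" "of_nat b" for a b]
    by (auto simp: absval_of_nat_diff_le_iff cong_sym_eq)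
  then show ?thesis ..
qed

lemma oscillation_0_imp_continuous: "oscillation_le f m 0 \<Longrightarrow> padic_continuous f"
  unfolding padic_continuous_def oscillation_le_def by force

definition measure_of_distribution :: "(nat \<Rightarrow> nat \<Rightarrow> 'k) \<Rightarrow> 'k set \<Rightarrow> 'k" where
  "measure_of_distribution w =
     (\<lambda>U\<in>compact_opens Zp. riemann_integral w (\<lambda>a. if of_nat a \<in> U then 1 else 0))"

text \<open>
  Indicators of compact open sets oscillate by 0 from some level on, so their integrals exist and are
  additive.
\<close>

lemma measure_of_distribution:
  assumes w: "bounded_distribution w C"
  shows "bounded_measure Zp (measure_of_distribution w)"
proof -
  let ?i = "\<lambda>U a. if of_nat a \<in> (U :: 'k set) then 1 else 0 :: 'k"
  have cont: "padic_continuous (?i U)" if "U \<in> compact_opens Zp" for U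
    using compact_open_indicator_oscillation[OF that] oscillation_0_imp_continuous by blast
  have add: "riemann_integral w (?i (U \<union> V)) = riemann_integral w (?i U) + riemann_integral w (?i V)"
    if U: "U \<in> compact_opens Zp" and V: "V \<in> compact_opens Zp" and disj: "U \<inter> V = {}" for U V
  proof -
    have "riemann_sum w (?i (U \<union> V)) m = riemann_sum w (?i U) m + riemann_sum w (?i V) m" for m
      unfolding riemann_sum_def sum.distrib[symmetric] using disj by (intro sum.cong) auto
    then have "riemann_sum w (?i (U \<union> V)) = (\<lambda>m. riemann_sum w (?i U) m + riemann_sum w (?i V) m)"
      by auto
    then have "riemann_sum w (?i (U \<union> V)) \<longlonglongrightarrow> riemann_integral w (?i U) + riemann_integral w (?i V)"
      using tendsto_add[OF riemann_integral[OF w cont[OF U]] riemann_integral[OF w cont[OF V]]] by simp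
    then show ?thesis
      using LIMSEQ_unique riemann_integral[OF w cont[OF compact_opens_Un[OF U V]]] by blast
  qed
  have bound: "absval (riemann_integral w (?i U)) \<le> 1 * C" if "U \<in> compact_opens Zp" for U
    by (rule absval_riemann_integral_le[OF w cont[OF that]]) auto
  show ?thesis
    unfolding bounded_measure_def measure_of_distribution_def
    using add bound by (auto simp: compact_opens_Un intro!: exI[of _ "1 * C"])
qed

lemma measure_of_distribution_coset:
  assumes w: "bounded_distribution w C" and a: "a < p ^ m"
  shows "measure_of_distribution w (Zp_coset p m a) = w m a"
proof -
  let ?i = "\<lambda>b. if of_nat b \<in> (Zp_coset p m a :: 'k set) then 1 else 0 :: 'k"
  have osc: "oscillation_le ?i m 0"
    by (auto simp: oscillation_le_def of_nat_mem_Zp_coset_iff intro: cong_trans cong_sym)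
  have "?i b * w m b = (if b = a then w m a else 0)" if "b < p ^ m" for b
    using a that by (auto simp: of_nat_mem_Zp_coset_iff cong_def)
  then have "riemann_sum w ?i m = (\<Sum>b<p ^ m. if b = a then w m a else 0)"
    unfolding riemann_sum_def by (intro sum.cong) auto
  also have "\<dots> = w m a"
    using a by simp
  finally show ?thesis
    using riemann_integral_diff_le[OF w oscillation_0_imp_continuous[OF osc] osc]
      absval_nonneg[of "riemann_integral w ?i - w m a"] Zp_coset_compact_open[of m a]
    by (simp add: measure_of_distribution_def)
qed

text \<open>
  A compact open set is a finite disjoint union of cosets of one level, hence its measure is determined
  by finite additivity.
\<close>

lemma bounded_measure_eqI:
  assumes \<mu>: "bounded_measure Zp \<mu>" and \<mu>': "bounded_measure Zp \<mu>'"
    and eq: "\<And>m a. a < p ^ m \<Longrightarrow> \<mu> (Zp_coset p m a) = (\<mu>' (Zp_coset p m a) :: 'k)"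
  shows "\<mu> = \<mu>'"
proof (rule extensionalityI[of _ "compact_opens Zp"])
  fix U :: "'k set" assume U: "U \<in> compact_opens Zp"
  obtain m where "\<forall>x\<in>U. \<forall>y\<in>Zp. absval (x - y) \<le> 1 / real p ^ m \<longrightarrow> y \<in> U"
    by (rule compact_open_stable[OF U])
  then have m: "\<And>x y. x \<in> U \<Longrightarrow> y \<in> Zp \<Longrightarrow> absval (x - y) \<le> 1 / real p ^ m \<Longrightarrow> y \<in> U"
    by blast
  have add: "(\<Union>a\<in>A. Zp_coset p m a) \<in> compact_opens (Zp :: 'k set) \<and>
      \<rho> (\<Union>a\<in>A. Zp_coset p m a) = (\<Sum>a\<in>A. \<rho> (Zp_coset p m a))"
    if \<rho>: "bounded_measure Zp \<rho>" and "finite A" "A \<subseteq> {..<p ^ m}" for A and \<rho> :: "'k set \<Rightarrow> 'k"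
    using that(2,3)
  proof (induction A rule: finite_induct)
    case empty
    have "\<rho> ({} \<union> {}) = \<rho> {} + \<rho> {}"
      using \<rho> compact_opens_empty[of "Zp :: 'k set"] unfolding bounded_measure_def by blast
    then show ?case
      by (simp add: compact_opens_empty)
  next
    case (insert b A)
    have "Zp_coset p m b \<inter> (\<Union>a\<in>A. Zp_coset p m a) = ({} :: 'k set)"
    proof (rule ccontr)
      assume "Zp_coset p m b \<inter> (\<Union>a\<in>A. Zp_coset p m a) \<noteq> ({} :: 'k set)"
      then obtain x :: 'k and a where "a \<in> A" "x \<in> Zp_coset p m b" "x \<in> Zp_coset p m a"
        by auto
      then have "absval (of_nat a - of_nat b :: 'k) \<le> 1 / real p ^ m"
        using absval_diff_trans[of "of_nat a" x _ "of_nat b"]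
        by (simp add: Zp_coset_eq absval_minus_commute)
      then have "a = b"
        using \<open>a \<in> A\<close> insert.prems by (auto simp: absval_of_nat_diff_le_iff cong_less_modulus_unique_nat)
      then show False
        using \<open>a \<in> A\<close> insert.hyps by blast
    qed
    then show ?case
      using insert \<rho> Zp_coset_compact_open[of m b] by (auto simp: bounded_measure_def compact_opens_Un)
  qed
  define A where "A = {a. a < p ^ m \<and> of_nat a \<in> U}"
  have "U = (\<Union>a\<in>A. Zp_coset p m a)"
  proof (intro equalityI subsetI)
    fix x assume x: "x \<in> U"
    then have "x \<in> Zp"
      using U by (auto simp: compact_opens_def)
    then obtain n where "n < p ^ m" "absval (x - of_nat n) \<le> 1 / real p ^ m"
      by (rule Zp_approx)
    then show "x \<in> (\<Union>a\<in>A. Zp_coset p m a)"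
      using m[OF x, of "of_nat n"] \<open>x \<in> Zp\<close> by (auto simp: A_def Zp_coset_eq)
  next
    fix x :: 'k assume "x \<in> (\<Union>a\<in>A. Zp_coset p m a)"
    then show "x \<in> U"
      using m[of "of_nat a" x for a] by (auto simp: A_def Zp_coset_eq absval_minus_commute)
  qed
  then have "\<rho> U = (\<Sum>a\<in>A. \<rho> (Zp_coset p m a))" if "bounded_measure Zp \<rho>" for \<rho>
    using add[OF that, of A] by (auto simp: A_def)
  moreover have "(\<Sum>a\<in>A. \<mu> (Zp_coset p m a)) = (\<Sum>a\<in>A. \<mu>' (Zp_coset p m a))"
    using eq by (intro sum.cong) (auto simp: A_def)
  ultimately show "\<mu> U = \<mu>' U"
    using \<mu> \<mu>' by simp
qed (use \<mu> \<mu>' in \<open>auto simp: bounded_measure_def\<close>)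

section \<open>The measures attached to roots of unity\<close>

definition geometric_weight :: "'k \<Rightarrow> nat \<Rightarrow> nat \<Rightarrow> 'k" where
  "geometric_weight z m a = z ^ a / (1 - z ^ (p ^ m))"

text \<open>
  As \<open>p\<^sup>m\<close> is invertible modulo \<open>N\<close>, some power of \<open>z\<^sup>q\<close> with \<open>q = p\<^sup>m\<close> gives back \<open>z\<close>.
\<close>

lemma root_power_p_neq_1:
  fixes z :: 'k
  assumes "z ^ N = 1" "z \<noteq> 1" "coprime p N"
  shows "z ^ (p ^ m) \<noteq> 1"
proof
  assume eq: "z ^ (p ^ m) = 1"
  have "N \<noteq> 0"
    using assms(3) p_gt_1 by (intro notI) simp
  have power_mod_order: "z ^ n = z ^ (n mod N)" for n
    using power_add[of z "N * (n div N)" "n mod N"] assms(1) by (simp add: power_mult)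
  have "coprime (p ^ m) N"
    using assms(3) by simp
  then obtain u where "[p ^ m * u = 1] (mod N)"
    using cong_solve_coprime_nat by fastforce
  then have "z ^ (p ^ m * u) = z ^ 1"
    using power_mod_order[of "p ^ m * u"] power_mod_order[of 1] by (simp add: cong_def)
  then show False
    using assms(2) by (simp add: power_mult eq)
qed

text \<open>
  Additivity is the geometric sum. Boundedness holds because \<open>1 - z\<^sup>n\<close> takes only finitely many values
  and is nonzero at the exponents \<open>n = p\<^sup>m\<close>.
\<close>

lemma geometric_weight_bounded_distribution:
  fixes z :: 'k
  assumes z: "z ^ N = 1" "z \<noteq> 1" "coprime p N"
  obtains C where "bounded_distribution (geometric_weight z) C"
proof -
  note neq = root_power_p_neq_1[OF z]
  have N: "N > 0"
    using z(3) p_gt_1 by (intro Nat.gr0I) simp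
  have "absval z ^ N = 1"
    by (metis absval_one absval_power z(1))
  then have abs_z: "absval z = 1"
    using N power_eq_imp_eq_base[of "absval z" N 1] by simp
  define C where "C = Max (insert 0 ((\<lambda>i. absval (inverse (1 - z ^ i))) ` {..<N}))"
  have C: "absval (inverse (1 - z ^ n)) \<le> C" for n
  proof -
    have "z ^ n = z ^ (n mod N)"
      using power_add[of z "N * (n div N)" "n mod N"] z(1) by (simp add: power_mult)
    then show ?thesis
      unfolding C_def using N by (intro Max_ge) auto
  qed
  have "geometric_weight z m a = (\<Sum>c<p. geometric_weight z (Suc m) (a + p ^ m * c))" for m a
  proof -
    have "(\<Sum>c<p. geometric_weight z (Suc m) (a + p ^ m * c)) =
        z ^ a * (\<Sum>c<p. (z ^ (p ^ m)) ^ c) / (1 - (z ^ (p ^ m)) ^ p)"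
      by (simp add: geometric_weight_def sum_divide_distrib sum_distrib_left power_add
          power_mult[symmetric] mult_ac)
    also have "(\<Sum>c<p. (z ^ (p ^ m)) ^ c) = (1 - (z ^ (p ^ m)) ^ p) / (1 - z ^ (p ^ m))"
      using neq[of m] by (simp add: sum_gp_strict)
    also have "(z ^ (p ^ m)) ^ p = z ^ (p ^ Suc m)"
      by (simp add: power_mult[symmetric] mult_ac)
    finally show ?thesis
      using neq[of "Suc m"] by (simp add: geometric_weight_def)
  qed
  moreover have "absval (geometric_weight z m a) \<le> C" for m a
    using C[of "p ^ m"] by (simp add: geometric_weight_def divide_inverse absval_mult absval_power abs_z)
  ultimately have "bounded_distribution (geometric_weight z) C"
    unfolding bounded_distribution_def by blast
  then show ?thesis
    by (rule that)
qed

text \<open>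
  The defining description of \<open>\<mu>\<^sub>z\<close> has exactly one solution, so the described values may be used.
\<close>

lemma mu_measure_coset:
  fixes z :: 'k
  assumes w: "bounded_distribution (geometric_weight z) C" and a: "a < p ^ m"
  shows "mu_measure p z (Zp_coset p m a) = geometric_weight z m a"
proof -
  have "mu_measure p z = measure_of_distribution (geometric_weight z)"
    unfolding mu_measure_def
  proof (rule the_equality)
    show "bounded_measure Zp (measure_of_distribution (geometric_weight z)) \<and>
      (\<forall>m a. a < p ^ m \<longrightarrow> measure_of_distribution (geometric_weight z) (Zp_coset p m a) =
         z ^ a / (1 - z ^ p ^ m))"
      using measure_of_distribution[OF w] measure_of_distribution_coset[OF w]
      by (auto simp: geometric_weight_def)
  next
    fix \<mu> assume "bounded_measure Zp \<mu> \<and> (\<forall>m a. a < p ^ m \<longrightarrow> \<mu> (Zp_coset p m a) = z ^ a / (1 - z ^ p ^ m))"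
    then show "\<mu> = measure_of_distribution (geometric_weight z)"
      using measure_of_distribution[OF w] measure_of_distribution_coset[OF w]
      by (intro bounded_measure_eqI) (auto simp: geometric_weight_def)
  qed
  then show ?thesis
    using measure_of_distribution_coset[OF w a] by simp
qed

lemma padic_integral_mu:
  fixes z :: 'k
  assumes w: "bounded_distribution (geometric_weight z) C"
  shows "padic_integral p Zp (mu_measure p z) f =
    riemann_integral (geometric_weight z) (\<lambda>a. f (of_nat a))"
proof -
  have "(Zp :: 'k set) \<inter> Zp_coset p m a = Zp_coset p m a" for m a
    by (auto simp: Zp_coset_eq)
  then have "(\<Sum>a | a < p ^ m \<and> (of_nat a :: 'k) \<in> Zp. f (of_nat a) * mu_measure p z (Zp \<inter> Zp_coset p m a)) =
      riemann_sum (geometric_weight z) (\<lambda>a. f (of_nat a)) m" for m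
    unfolding riemann_sum_def by (intro sum.cong) (auto simp: mu_measure_coset[OF w])
  then show ?thesis
    by (simp add: padic_integral_def riemann_integral_def)
qed

lemma absval_inverse_diff:
  assumes "\<not> p dvd a" "\<not> p dvd b"
  shows "absval (inverse (of_nat a) - inverse (of_nat b) :: 'k) = absval (of_nat a - of_nat b :: 'k)"
proof -
  have a: "absval (of_nat a :: 'k) = 1" and b: "absval (of_nat b :: 'k) = 1"
    using assms by (simp_all add: absval_of_nat_eq_1_iff)
  then have "(of_nat a :: 'k) \<noteq> 0" "(of_nat b :: 'k) \<noteq> 0"
    by (metis absval_zero zero_neq_one)+
  then have "inverse (of_nat a) - inverse (of_nat b) =
      (of_nat b - of_nat a) * inverse (of_nat a) * (inverse (of_nat b) :: 'k)"
    by (simp add: field_simps)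
  then show ?thesis
    using a b by (simp add: absval_mult absval_inverse absval_minus_commute)
qed

lemma dvd_cong_p_power_Suc: "[a = b] (mod p ^ Suc m) \<Longrightarrow> p dvd a \<longleftrightarrow> p dvd b"
  by (metis cong_dvd_iff cong_dvd_modulus_nat dvd_triv_left power_Suc)

text \<open>
  On a coset of level \<open>m\<close> the density \<open>x\<^sup>-\<^sup>1\<close> varies by at most \<open>p\<^sup>-\<^sup>m\<close>, so it can be frozen.
\<close>

lemma nu_measure_coset_approx:
  fixes z :: 'k
  assumes w: "bounded_distribution (geometric_weight z) C" and a: "a < p ^ Suc m" "\<not> p dvd a"
  shows "absval (nu_measure p z (Zp_coset p (Suc m) a) -
    inverse (of_nat a) * geometric_weight z (Suc m) a) \<le> C * (1 / real p ^ Suc m)"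
proof -
  let ?U = "Zp_coset p (Suc m) a :: 'k set"
  define f where "f = (\<lambda>b. if of_nat b \<in> ?U then inverse (of_nat b) else 0 :: 'k)"
  have nu: "nu_measure p z ?U = riemann_integral (geometric_weight z) f"
    using unit_coset_compact_open[OF a(2), of m]
    by (simp add: nu_measure_def padic_integral_mu[OF w] f_def)
  have osc: "oscillation_le f M (1 / real p ^ M)" if "M \<ge> Suc m" for M
    unfolding oscillation_le_def
  proof (intro allI impI)
    fix b c assume bc: "[b = c] (mod p ^ M)"
    then have bc': "[b = c] (mod p ^ Suc m)"
      using that by (meson cong_dvd_modulus_nat le_imp_power_dvd)
    show "absval (f b - f c) \<le> 1 / real p ^ M"
    proof (cases "[b = a] (mod p ^ Suc m)")
      case True
      then have "[c = a] (mod p ^ Suc m)"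
        using bc' cong_sym cong_trans by blast
      with True bc show ?thesis
        using a(2) dvd_cong_p_power_Suc absval_inverse_diff[of b c]
        by (auto simp: f_def of_nat_mem_Zp_coset_iff absval_of_nat_diff_le_iff)
    next
      case False
      then have "\<not> [c = a] (mod p ^ Suc m)"
        using bc' cong_trans by blast
      with False show ?thesis
        by (simp add: f_def of_nat_mem_Zp_coset_iff)
    qed
  qed
  have cont: "padic_continuous f"
    unfolding padic_continuous_def
  proof (intro allI impI)
    fix e :: real assume "e > 0"
    then obtain M where "1 / real p ^ M < e"
      by (rule inverse_p_power_less)
    then have "1 / real p ^ max M (Suc m) \<le> e"
      using inverse_p_power_antimono[of M "max M (Suc m)"] by simp
    then show "\<exists>m. oscillation_le f m e"
      using osc[of "max M (Suc m)"] unfolding oscillation_le_def by (meson max.cobounded2 order_trans)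
  qed
  have "f b * geometric_weight z (Suc m) b =
      (if b = a then inverse (of_nat a) * geometric_weight z (Suc m) a else 0)"
    if "b < p ^ Suc m" for b
    using cong_less_modulus_unique_nat[of b a "p ^ Suc m"] that a(1)
    by (auto simp: f_def of_nat_mem_Zp_coset_iff)
  then have "riemann_sum (geometric_weight z) f (Suc m) =
      (\<Sum>b<p ^ Suc m. if b = a then inverse (of_nat a) * geometric_weight z (Suc m) a else 0)"
    unfolding riemann_sum_def by (intro sum.cong) auto
  also have "\<dots> = inverse (of_nat a) * geometric_weight z (Suc m) a"
    using a(1) by simp
  finally show ?thesis
    using riemann_integral_diff_le[OF w cont osc[of "Suc m"]] by (simp add: nu)
qed

text \<open>
  Freezing the density on each coset changes the Riemann sums of level \<open>m\<close> by \<open>O(p\<^sup>-\<^sup>m)\<close> only, so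
  integrals against \<open>\<nu>\<close> become integrals against \<open>\<mu>\<close>.
\<close>

lemma riemann_sums_nu_measure:
  fixes z :: 'k and F :: "'k \<Rightarrow> 'k"
  assumes w: "bounded_distribution (geometric_weight z) C"
    and bound: "\<And>a. \<not> p dvd a \<Longrightarrow> absval (F (of_nat a)) \<le> 1"
    and cont: "padic_continuous (\<lambda>a. if p dvd a then 0 else F (of_nat a) * inverse (of_nat a))"
  shows "(\<lambda>m. \<Sum>a | a < p ^ m \<and> (of_nat a :: 'k) \<in> Zp_units.
      F (of_nat a) * nu_measure p z (Zp_units \<inter> Zp_coset p m a)) \<longlonglongrightarrow>
    riemann_integral (geometric_weight z) (\<lambda>a. if p dvd a then 0 else F (of_nat a) * inverse (of_nat a))"
    (is "?S \<longlonglongrightarrow> riemann_integral _ ?f")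
proof -
  let ?R = "riemann_sum (geometric_weight z) ?f"
  have "absval (?S (Suc m) - ?R (Suc m)) \<le> C * (1 / real p ^ Suc m)" for m
  proof -
    let ?A = "{a. a < p ^ Suc m \<and> \<not> p dvd a}"
    have "Zp_units \<inter> Zp_coset p (Suc m) a = (Zp_coset p (Suc m) a :: 'k set)" if "a \<in> ?A" for a
      using Zp_coset_subset_units[of a m] that by auto
    then have S: "?S (Suc m) = (\<Sum>a\<in>?A. F (of_nat a) * nu_measure p z (Zp_coset p (Suc m) a))"
      by (intro sum.cong) (auto simp: of_nat_mem_Zp_units_iff)
    have R: "?R (Suc m) = (\<Sum>a\<in>?A. F (of_nat a) * (inverse (of_nat a) * geometric_weight z (Suc m) a))"
      unfolding riemann_sum_def by (intro sum.mono_neutral_cong_right) (auto simp: mult.assoc)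
    have "absval (F (of_nat a) * (nu_measure p z (Zp_coset p (Suc m) a) -
        inverse (of_nat a) * geometric_weight z (Suc m) a)) \<le> 1 * (C * (1 / real p ^ Suc m))"
      if "a \<in> ?A" for a
      using that by (intro absval_mult_le bound nu_measure_coset_approx[OF w]) auto
    then have "absval (\<Sum>a\<in>?A. F (of_nat a) * (nu_measure p z (Zp_coset p (Suc m) a) -
        inverse (of_nat a) * geometric_weight z (Suc m) a)) \<le> 1 * (C * (1 / real p ^ Suc m))"
      using bounded_distribution_nonneg[OF w] by (intro absval_sum_le) auto
    then show ?thesis
      unfolding S R by (simp add: sum_subtractf right_diff_distrib del: power_Suc)
  qed
  then have "(\<lambda>m. ?S (Suc m) - ?R (Suc m)) \<longlonglongrightarrow> 0"
    using LIMSEQ_Suc[OF inverse_p_power_tendsto_0[of C]]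
    by (intro tendsto_squeeze_absval[of _ 0 "\<lambda>m. C * (1 / real p ^ Suc m)"]) auto
  then have "(\<lambda>m. (?S (Suc m) - ?R (Suc m)) + ?R (Suc m)) \<longlonglongrightarrow> 0 + riemann_integral (geometric_weight z) ?f"
    by (rule tendsto_add) (rule LIMSEQ_Suc[OF riemann_integral[OF w cont]])
  then have "(\<lambda>m. ?S (Suc m)) \<longlonglongrightarrow> riemann_integral (geometric_weight z) ?f"
    by simp
  then show ?thesis
    by (rule LIMSEQ_imp_Suc)
qed

end

section \<open>The Teichmueller character\<close>

context padic_field
begin

text \<open>
  The sequence of iterated \<open>p\<close>-th powers of \<open>a\<close> converges: by Euler's theorem modulo \<open>p\<^sup>n\<^sup>+\<^sup>1\<close>
  its terms satisfy \<open>x\<^sub>n\<^sup>p\<^sup>-\<^sup>1 \<equiv> 1\<close>, so consecutive terms agree to that precision.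
\<close>

lemma teichmueller_lift_exists:
  assumes "\<not> p dvd a"
  obtains w :: 'k where "w \<in> Zp" "w ^ (p - 1) = 1" "absval (of_nat a - w) \<le> 1 / real p"
proof -
  define x where "x = (\<lambda>n. of_nat a ^ (p ^ n) :: 'k)"
  have "coprime a (p ^ Suc n)" for n
    using prime_imp_coprime[OF prime_p assms] by (simp add: coprime_commute[of a p])
  then have "[a ^ (p ^ n * (p - 1)) = 1] (mod p ^ Suc n)" for n
    using euler_theorem[of a "p ^ Suc n"] totient_prime_power_Suc[OF prime_p, of n] by simp
  then have "absval (of_nat (a ^ (p ^ n * (p - 1))) - of_nat 1 :: 'k) \<le> 1 / real p ^ Suc n" for n
    by (simp only: absval_of_nat_diff_le_iff)
  then have euler: "absval (x n ^ (p - 1) - 1) \<le> 1 / real p ^ Suc n" for n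
    by (simp add: x_def power_mult)
  have x1: "absval (x n) \<le> 1" for n
    unfolding x_def using absval_of_nat_le_1[of "a ^ p ^ n"] by simp
  have "x (Suc n) = x n * x n ^ (p - 1)" for n
  proof -
    have "p ^ Suc n = p ^ n * Suc (p - 1)"
      using p_gt_1 by simp
    then show ?thesis
      by (simp only: x_def power_mult power_Suc)
  qed
  then have "x (Suc n) - x n = x n * (x n ^ (p - 1) - 1)" for n
    by (simp add: algebra_simps)
  then have step: "absval (x (Suc n) - x n) \<le> 1 / real p ^ Suc n" for n
    using absval_mult_le[OF x1[of n] euler[of n]] by simp
  have "(\<lambda>n. x (Suc n) - x n) \<longlonglongrightarrow> 0"
    using LIMSEQ_Suc[OF inverse_p_power_tendsto_0[of 1]] step
    by (intro tendsto_squeeze_absval[of _ 0 "\<lambda>n. 1 / real p ^ Suc n"]) (simp_all del: power_Suc)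
  then have "(\<lambda>n. absval (x (Suc n) - x n)) \<longlonglongrightarrow> 0"
    using tendsto_absval by fastforce
  then obtain w where w: "x \<longlonglongrightarrow> w"
    using convergent_if_consecutive_diff convergentD by blast
  have "absval (x n - of_nat a) \<le> 1 / real p" for n
  proof (induction n)
    case (Suc n)
    then show ?case
      using absval_diff_trans[OF _ Suc.IH, of "x (Suc n)"] step[of n]
        inverse_p_power_antimono[of 1 "Suc n"] by simp
  qed (simp add: x_def)
  then have wa: "absval (w - of_nat a) \<le> 1 / real p"
    by (intro absval_limit_le[OF tendsto_diff[OF w tendsto_const]] always_eventually allI)
  have "x n \<in> Zp" for n
    by (auto simp: x_def intro: Zp_power)
  then have wZ: "w \<in> Zp"
    using closed_sequentially[OF closed_Zp _ w] by blast
  have "(\<lambda>n. x n ^ (p - 1)) \<longlonglongrightarrow> w ^ (p - 1)"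
    by (intro tendsto_power_strong w tendsto_const)
  moreover have "(\<lambda>n. x n ^ (p - 1)) \<longlonglongrightarrow> 1"
    using LIMSEQ_Suc[OF inverse_p_power_tendsto_0[of 1]] euler
    by (intro tendsto_squeeze_absval[of _ 1 "\<lambda>n. 1 / real p ^ Suc n"]) auto
  ultimately have "w ^ (p - 1) = 1"
    by (rule LIMSEQ_unique)
  then show ?thesis
    using that wZ wa by (simp add: absval_minus_commute)
qed

lemma root_of_unity_absval:
  assumes "(w::'k) ^ n = 1" "n > 0"
  shows "absval w = 1"
  using power_eq_imp_eq_base[of "absval w" n 1] assms by (simp flip: absval_power)

text \<open>
  The factor \<open>1 + v + ... + v\<^sup>p\<^sup>-\<^sup>2\<close> of \<open>v\<^sup>p\<^sup>-\<^sup>1 - 1\<close> is congruent to \<open>p - 1\<close>, hence nonzero.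
\<close>

lemma one_unit_root_of_unity_trivial:
  assumes "(v::'k) ^ (p - 1) = 1" "absval (v - 1) \<le> 1 / real p"
  shows "v = 1"
proof -
  have v: "absval v = 1"
    using root_of_unity_absval[OF assms(1)] p_gt_1 by simp
  have "absval (v ^ i - 1) \<le> 1 / real p" for i
    using absval_power_diff_le[of v 1 i] v assms(2) by simp
  then have "absval (\<Sum>i<p - 1. v ^ i - 1) \<le> 1 / real p"
    by (intro absval_sum_le) auto
  moreover have "(\<Sum>i<p - 1. v ^ i - 1) = (\<Sum>i<p - 1. v ^ i) - of_nat (p - 1)"
    by (simp add: sum_subtractf)
  moreover have "absval (of_nat (p - 1) :: 'k) = 1"
    unfolding absval_of_nat_eq_1_iff using p_gt_1 by (auto dest: dvd_imp_le)
  moreover have "1 / real p < 1"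
    using real_p_gt_1 by simp
  ultimately have "(\<Sum>i<p - 1. v ^ i) \<noteq> 0"
    by auto
  moreover have "(v - 1) * (\<Sum>i<p - 1. v ^ i) = 0"
    using power_diff_1_eq[of v "p - 1"] assms(1) by simp
  ultimately show ?thesis
    by simp
qed

text \<open>
  Two roots of unity of order dividing \<open>p - 1\<close> that are congruent to \<open>a\<close> differ by a factor that is a
  one-unit, hence by the factor 1.
\<close>

lemma teichmueller_eqI:
  assumes a: "\<not> p dvd a" and w: "w ^ (p - 1) = (1::'k)" "absval (of_nat a - w) \<le> 1 / real p" "w \<in> Zp"
  shows "teichmueller p (of_nat a) = w"
  unfolding teichmueller_def
proof (rule the_equality)
  have "p - 1 > 0"
    using p_gt_1 by simp
  then have abs_w: "absval w = 1"
    using w(1) by (rule root_of_unity_absval[rotated])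
  then have "w \<noteq> 0"
    by auto
  then have "of_nat a / w - 1 = (of_nat a - w) * inverse w"
    by (simp add: field_simps)
  then have "absval (of_nat a / w - 1) \<le> 1 / real p"
    using w(2) abs_w by (simp add: absval_mult absval_inverse)
  moreover have "of_nat a / w \<in> Zp"
    unfolding divide_inverse using Zp_inverse[OF w(3) abs_w] by auto
  ultimately show "w ^ (p - 1) = 1 \<and> of_nat a / w \<in> one_units p"
    using w(1) by (simp add: one_units_eq)
  fix w' :: 'k assume "w' ^ (p - 1) = 1 \<and> of_nat a / w' \<in> one_units p"
  then have w': "w' ^ (p - 1) = 1" "absval (of_nat a / w' - 1) \<le> 1 / real p"
    by (auto simp: one_units_eq)
  have abs_w': "absval w' = 1"
    using w'(1) \<open>p - 1 > 0\<close> by (rule root_of_unity_absval)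
  then have "w' \<noteq> 0"
    by auto
  then have "of_nat a / w' - 1 = (of_nat a - w') * inverse w'"
    by (simp add: field_simps)
  then have "absval (of_nat a - w') \<le> 1 / real p"
    using w'(2) abs_w' by (simp add: absval_mult absval_inverse)
  then have "absval (w' - w) \<le> 1 / real p"
    using absval_diff_trans[of w' "of_nat a" _ w] w(2) by (simp add: absval_minus_commute)
  moreover have "w' / w - 1 = (w' - w) * inverse w"
    using \<open>w \<noteq> 0\<close> by (simp add: field_simps)
  ultimately have "absval (w' / w - 1) \<le> 1 / real p"
    using abs_w by (simp add: absval_mult absval_inverse)
  moreover have "(w' / w) ^ (p - 1) = 1"
    using w(1) w'(1) by (simp add: power_divide)
  ultimately have "w' / w = 1"
    by (rule one_unit_root_of_unity_trivial[rotated])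
  then show "w' = w"
    using \<open>w \<noteq> 0\<close> by simp
qed

lemma teichmueller:
  assumes "\<not> p dvd a"
  shows "teichmueller p (of_nat a :: 'k) \<in> Zp"
    and "teichmueller p (of_nat a :: 'k) ^ (p - 1) = 1"
    and "absval (of_nat a - teichmueller p (of_nat a :: 'k)) \<le> 1 / real p"
    and "absval (teichmueller p (of_nat a :: 'k)) = 1"
proof -
  obtain w :: 'k where w: "w \<in> Zp" "w ^ (p - 1) = 1" "absval (of_nat a - w) \<le> 1 / real p"
    using assms by (rule teichmueller_lift_exists)
  then have eq: "teichmueller p (of_nat a) = w"
    using assms by (intro teichmueller_eqI)
  from w show "teichmueller p (of_nat a :: 'k) \<in> Zp"
    "teichmueller p (of_nat a :: 'k) ^ (p - 1) = 1"
    "absval (of_nat a - teichmueller p (of_nat a :: 'k)) \<le> 1 / real p"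
    unfolding eq by auto
  show "absval (teichmueller p (of_nat a :: 'k)) = 1"
    unfolding eq using root_of_unity_absval[OF w(2)] p_gt_1 by simp
qed

lemma teichmueller_cong:
  assumes "\<not> p dvd a" "[a = b] (mod p)"
  shows "teichmueller p (of_nat b :: 'k) = teichmueller p (of_nat a)"
proof (rule teichmueller_eqI)
  show "\<not> p dvd b"
    using assms(1) cong_dvd_iff[OF assms(2)] by simp
  have "absval (of_nat b - of_nat a :: 'k) \<le> 1 / real p"
    using cong_sym[OF assms(2)] absval_of_nat_diff_le_iff[of b a 1] by simp
  then show "absval (of_nat b - teichmueller p (of_nat a :: 'k)) \<le> 1 / real p"
    using absval_diff_trans[OF _ teichmueller(3)[OF assms(1)]] by blast
qed (use teichmueller[OF assms(1)] in auto)

lemma angle_part_mem_one_units: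
  assumes "\<not> p dvd a"
  shows "angle_part p (of_nat a :: 'k) \<in> one_units p"
proof -
  let ?w = "teichmueller p (of_nat a :: 'k)"
  note w = teichmueller[OF assms]
  have "?w \<noteq> 0"
    using w(4) by auto
  then have "of_nat a / ?w - 1 = (of_nat a - ?w) * inverse ?w"
    by (simp add: field_simps)
  then have "absval (of_nat a / ?w - 1) \<le> 1 / real p"
    using w(3,4) by (simp add: absval_mult absval_inverse)
  moreover have "of_nat a / ?w \<in> Zp"
    unfolding divide_inverse using Zp_inverse[OF w(1,4)] by auto
  ultimately show ?thesis
    by (simp add: one_units_eq angle_part_def)
qed

lemma absval_angle_part_diff:
  assumes "\<not> p dvd a" "[a = b] (mod p)"
  shows "absval (angle_part p (of_nat a) - angle_part p (of_nat b) :: 'k) = absval (of_nat a - of_nat b :: 'k)"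
proof -
  have "angle_part p (of_nat a) - angle_part p (of_nat b) =
      (of_nat a - of_nat b) * inverse (teichmueller p (of_nat a :: 'k))"
    by (simp add: angle_part_def teichmueller_cong[OF assms] divide_inverse left_diff_distrib)
  then show ?thesis
    using teichmueller(4)[OF assms(1)] by (simp add: absval_mult absval_inverse)
qed

section \<open>Powers of one-units\<close>

lemma Zp_sequence_nat:
  assumes "(s::'k) \<in> Zp"
  obtains x :: "nat \<Rightarrow> nat" where "(\<lambda>m. of_nat (x m)) \<longlonglongrightarrow> s"
proof -
  have "\<forall>m. \<exists>n. absval (of_nat n - s) \<le> 1 / real p ^ m"
    using Zp_approx[OF assms] by (metis absval_minus_commute)
  then obtain x :: "nat \<Rightarrow> nat" where "\<And>m. absval (of_nat (x m) - s) \<le> 1 / real p ^ m"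
    by metis
  then have "(\<lambda>m. of_nat (x m)) \<longlonglongrightarrow> s"
    using inverse_p_power_tendsto_0[of 1] by (intro tendsto_squeeze_absval) auto
  then show ?thesis
    by (rule that)
qed

text \<open>
  Since \<open>p\<^sup>m \<equiv> 1\<close> modulo \<open>p - 1\<close>, adding a multiple of \<open>p\<^sup>m\<close> reaches any residue class modulo \<open>p - 1\<close>
  without moving the number \<open>p\<close>-adically.
\<close>

lemma Zp_sequence_nat_residue_class:
  assumes "(s::'k) \<in> Zp"
  obtains x :: "nat \<Rightarrow> nat" where "(\<lambda>m. of_nat (x m)) \<longlonglongrightarrow> s"
    "\<And>m. x m \<ge> 1" "\<And>m. [int (x m) = j] (mod (int p - 1))"
proof -
  have "\<exists>n. absval (of_nat n - s) \<le> 1 / real p ^ m \<and> n \<ge> 1 \<and> [int n = j] (mod (int p - 1))" for m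
  proof -
    obtain k where k: "k < p ^ m" "absval (s - of_nat k) \<le> 1 / real p ^ m"
      using assms by (rule Zp_approx)
    define t where "t = nat ((j - int k) mod (int p - 1)) + (p - 1)"
    define n where "n = k + p ^ m * t"
    have "t \<ge> 1"
      using p_gt_1 by (simp add: t_def)
    then have "n \<ge> 1"
      using p_gt_1 by (simp add: n_def Suc_le_eq)
    have pm: "[int p ^ m = 1] (mod (int p - 1))"
      using cong_pow[of "int p" 1 "int p - 1" m] by (simp add: cong_iff_dvd_diff)
    have "int t = (j - int k) mod (int p - 1) + (int p - 1)"
      using p_gt_1 by (simp add: t_def of_nat_diff)
    then have "[int t = j - int k] (mod (int p - 1))"
      by (simp add: cong_def)
    then have "[int k + int p ^ m * int t = int k + 1 * (j - int k)] (mod (int p - 1))"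
      using pm by (intro cong_add cong_mult) auto
    then have "[int n = j] (mod (int p - 1))"
      by (simp add: n_def)
    moreover have "absval (of_nat n - of_nat k :: 'k) \<le> 1 / real p ^ m"
      unfolding absval_of_nat_diff_le_iff by (simp add: n_def cong_def)
    then have "absval (of_nat n - s) \<le> 1 / real p ^ m"
      using k(2) absval_diff_trans[of "of_nat n" "of_nat k" _ s] by (simp add: absval_minus_commute)
    ultimately show ?thesis
      using \<open>n \<ge> 1\<close> by blast
  qed
  then obtain x where x: "\<And>m. absval (of_nat (x m) - s) \<le> 1 / real p ^ m" "\<And>m. x m \<ge> 1"
      "\<And>m. [int (x m) = j] (mod (int p - 1))"
    by metis
  have "(\<lambda>m. of_nat (x m)) \<longlonglongrightarrow> s"
    using inverse_p_power_tendsto_0[of 1] x(1) by (intro tendsto_squeeze_absval) auto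
  then show ?thesis
    using x(2,3) that by blast
qed

text \<open>
  The natural numbers are dense in the \<open>p\<close>-adic integers.
\<close>

lemma continuous_eq_on_Zp:
  fixes f g :: "'k \<Rightarrow> 'k"
  assumes "continuous_on Zp f" "continuous_on Zp g" "\<And>n. f (of_nat n) = g (of_nat n)" "s \<in> Zp"
  shows "f s = g s"
proof -
  obtain x :: "nat \<Rightarrow> nat" where x: "(\<lambda>m. of_nat (x m)) \<longlonglongrightarrow> s"
    using assms(4) by (rule Zp_sequence_nat)
  have "(\<lambda>m. f (of_nat (x m))) \<longlonglongrightarrow> f s"
    by (rule continuous_on_tendsto_compose[OF assms(1) x assms(4)]) simp
  moreover have "(\<lambda>m. g (of_nat (x m))) \<longlonglongrightarrow> g s"
    by (rule continuous_on_tendsto_compose[OF assms(2) x assms(4)]) simp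
  ultimately show ?thesis
    using assms(3) LIMSEQ_unique by simp
qed

lemma continuous_on_gbinomial: "continuous_on S (\<lambda>s::'k. s gchoose k)"
  unfolding continuous_on_def gbinomial_prod_rev divide_inverse
  by (intro ballI tendsto_mult tendsto_prod' tendsto_diff tendsto_const tendsto_ident_at)

text \<open>
  Binomial coefficients of natural numbers are integers, and the bound passes to limits.
\<close>

lemma absval_gbinomial_le_1:
  assumes "(s::'k) \<in> Zp"
  shows "absval (s gchoose k) \<le> 1"
proof -
  obtain x :: "nat \<Rightarrow> nat" where x: "(\<lambda>m. of_nat (x m)) \<longlonglongrightarrow> s"
    using assms by (rule Zp_sequence_nat)
  have "(\<lambda>m. (of_nat (x m) :: 'k) gchoose k) \<longlonglongrightarrow> s gchoose k"
    using continuous_on_tendsto_compose[OF continuous_on_gbinomial x, of UNIV] by simp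
  moreover have "absval ((of_nat n :: 'k) gchoose k) \<le> 1" for n
    using absval_of_nat_le_1[of "n choose k"] by (simp add: binomial_gbinomial)
  ultimately show ?thesis
    by (intro absval_limit_le[of _ "s gchoose k"] always_eventually allI)
qed

lemma one_unitsD:
  assumes "(u::'k) \<in> one_units p"
  shows "u \<in> Zp" "absval (u - 1) \<le> 1 / real p" "absval u = 1"
proof -
  show *: "u \<in> Zp" "absval (u - 1) \<le> 1 / real p"
    using assms by (auto simp: one_units_eq)
  have "1 / real p < 1"
    using real_p_gt_1 by simp
  then have "absval (u - 1) < absval (1::'k)"
    using *(2) by simp
  then show "absval u = 1"
    using absval_add_eq[of "u - 1" 1] by simp
qed

lemma absval_binomial_term_le:
  assumes "(u::'k) \<in> one_units p" "s \<in> Zp"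
  shows "absval ((s gchoose k) * (u - 1) ^ k) \<le> 1 / real p ^ k"
proof -
  have "absval ((u - 1) ^ k) \<le> (1 / real p) ^ k"
    unfolding absval_power using one_unitsD[OF assms(1)] by (intro power_mono) auto
  then show ?thesis
    using absval_mult_le[OF absval_gbinomial_le_1[OF assms(2)]] by (simp add: power_divide)
qed

lemma summable_binomial_series:
  assumes "(u::'k) \<in> one_units p" "s \<in> Zp"
  shows "summable (\<lambda>k. (s gchoose k) * (u - 1) ^ k)"
proof (rule summable_if_terms_tend_0)
  have "(\<lambda>k. (s gchoose k) * (u - 1) ^ k) \<longlonglongrightarrow> 0"
    using absval_binomial_term_le[OF assms] inverse_p_power_tendsto_0[of 1]
    by (intro tendsto_squeeze_absval) auto
  then show "(\<lambda>k. absval ((s gchoose k) * (u - 1) ^ k)) \<longlonglongrightarrow> 0"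
    using tendsto_absval by fastforce
qed

lemma padic_power_partial_sum:
  assumes "(u::'k) \<in> one_units p" "s \<in> Zp"
  shows "absval (padic_power u s - (\<Sum>k<n. (s gchoose k) * (u - 1) ^ k)) \<le> 1 / real p ^ n"
  unfolding padic_power_def
  using absval_binomial_term_le[OF assms] inverse_p_power_antimono
  by (intro absval_suminf_diff_partial_le summable_binomial_series assms) (auto intro: order_trans)

lemma padic_power_of_nat: "padic_power (u::'k) (of_nat n) = u ^ n"
proof -
  have "padic_power u (of_nat n) = (\<Sum>k\<le>n. (of_nat n gchoose k) * (u - 1) ^ k)"
    unfolding padic_power_def
    by (intro suminf_finite) (auto simp: binomial_gbinomial[symmetric] binomial_eq_0)
  also have "\<dots> = (u - 1 + 1) ^ n"
    by (subst binomial_ring) (simp add: binomial_gbinomial)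
  finally show ?thesis by simp
qed

text \<open>
  The binomial series converges uniformly in the exponent.
\<close>

lemma continuous_on_padic_power:
  assumes u: "(u::'k) \<in> one_units p"
  shows "continuous_on Zp (padic_power u)"
proof (rule uniform_limit_theorem)
  show "\<forall>\<^sub>F n in sequentially. continuous_on Zp (\<lambda>s. \<Sum>k<n. (s gchoose k) * (u - 1) ^ k)"
    by (intro always_eventually allI continuous_on_sum continuous_on_mult' continuous_on_gbinomial
        continuous_on_const)
  show "uniform_limit Zp (\<lambda>n s. \<Sum>k<n. (s gchoose k) * (u - 1) ^ k) (padic_power u) sequentially"
    unfolding uniform_limit_iff
  proof (intro allI impI)
    fix e :: real assume "e > 0"
    then have "\<forall>\<^sub>F n in sequentially. 1 * (1 / real p ^ n) < e"
      using order_tendstoD(2)[OF inverse_p_power_tendsto_0] by blast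
    then show "\<forall>\<^sub>F n in sequentially. \<forall>s\<in>Zp.
        dist (\<Sum>k<n. (s gchoose k) * (u - 1) ^ k) (padic_power u s) < e"
    proof eventually_elim
      case (elim n)
      then show ?case
        using padic_power_partial_sum[OF u, of _ n]
        by (auto simp: dist_eq_absval absval_minus_commute intro: le_less_trans)
    qed
  qed
qed simp

lemma closed_one_units: "closed (one_units p :: 'k set)"
proof -
  have "one_units p = (Zp :: 'k set) \<inter> {u. absval (u - 1) \<le> 1 / real p}"
    by (auto simp: one_units_eq)
  then show ?thesis
    by (simp add: closed_Int closed_Zp closed_absval_ball)
qed

lemma one_mem_one_units [simp]: "(1::'k) \<in> one_units p"
  by (simp add: one_units_eq)

lemma one_units_mult:
  assumes "(u::'k) \<in> one_units p" "v \<in> one_units p"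
  shows "u * v \<in> one_units p"
proof -
  note u = one_unitsD[OF assms(1)] and v = one_unitsD[OF assms(2)]
  have "absval (u * v - 1 * 1) \<le> 1 / real p"
    using u v by (intro absval_mult_diff_le) auto
  then show ?thesis
    using u v by (auto simp: one_units_eq)
qed

lemma one_units_power: "(u::'k) \<in> one_units p \<Longrightarrow> u ^ n \<in> one_units p"
  by (induction n) (auto intro: one_units_mult)

lemma padic_power_mem_one_units:
  assumes u: "(u::'k) \<in> one_units p" and s: "s \<in> Zp"
  shows "padic_power u s \<in> one_units p"
proof -
  obtain x :: "nat \<Rightarrow> nat" where x: "(\<lambda>m. of_nat (x m)) \<longlonglongrightarrow> s"
    using s by (rule Zp_sequence_nat)
  then have "(\<lambda>m. padic_power u (of_nat (x m))) \<longlonglongrightarrow> padic_power u s"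
    by (rule continuous_on_tendsto_compose[OF continuous_on_padic_power[OF u] _ s]) auto
  then have "(\<lambda>m. u ^ x m) \<longlonglongrightarrow> padic_power u s"
    by (simp add: padic_power_of_nat)
  then show ?thesis
    using closed_sequentially[OF closed_one_units, of "\<lambda>m. u ^ x m"] one_units_power[OF u] by blast
qed

lemma absval_padic_power_base_diff_le:
  assumes u: "(u::'k) \<in> one_units p" and v: "v \<in> one_units p" and s: "s \<in> Zp"
  shows "absval (padic_power u s - padic_power v s) \<le> absval (u - v)"
proof -
  have "absval (u - 1) \<le> 1" "absval (v - 1) \<le> 1"
    using one_unitsD(2)[OF u] one_unitsD(2)[OF v] inverse_p_power_le_1[of 1] by auto
  then have "absval ((u - 1) ^ k - (v - 1) ^ k) \<le> absval (u - v)" for k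
    using absval_power_diff_le[of "u - 1" "v - 1" k] by simp
  then have "absval ((s gchoose k) * (u - 1) ^ k - (s gchoose k) * (v - 1) ^ k) \<le> absval (u - v)" for k
    using absval_mult_le[OF absval_gbinomial_le_1[OF s]] by (simp flip: right_diff_distrib)
  then have "absval ((\<Sum>k<n. (s gchoose k) * (u - 1) ^ k) - (\<Sum>k<n. (s gchoose k) * (v - 1) ^ k))
      \<le> absval (u - v)" for n
    unfolding sum_subtractf[symmetric] by (intro absval_sum_le) auto
  then show ?thesis
    unfolding padic_power_def
    by (intro absval_limit_le[OF tendsto_diff[OF summable_LIMSEQ summable_LIMSEQ]]
        summable_binomial_series u v s always_eventually) auto
qed

lemma continuous_on_padic_power_base:
  assumes "s \<in> Zp"
  shows "continuous_on (one_units p) (\<lambda>u::'k. padic_power u s)"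
  unfolding continuous_on_iff dist_eq_absval
proof (intro ballI allI impI)
  fix u :: 'k and e :: real assume "u \<in> one_units p" "e > 0"
  then show "\<exists>d>0. \<forall>v\<in>one_units p. absval (v - u) < d \<longrightarrow> absval (padic_power v s - padic_power u s) < e"
    using absval_padic_power_base_diff_le[OF _ _ assms] by (meson le_less_trans)
qed

text \<open>
  The functional equation for natural exponents extends by density, one exponent at a time.
\<close>

lemma padic_power_add:
  assumes u: "(u::'k) \<in> one_units p" and "s \<in> Zp" "t \<in> Zp"
  shows "padic_power u (s + t) = padic_power u s * padic_power u t"
proof -
  note cont = continuous_on_padic_power[OF u]
  have shift: "continuous_on Zp (\<lambda>x. padic_power u (x + c))" if "c \<in> Zp" for c
    by (rule continuous_on_compose2[OF cont continuous_on_add[OF continuous_on_id continuous_on_const]])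
      (use that in auto)
  have nat: "padic_power u (x + of_nat n) = padic_power u x * padic_power u (of_nat n)"
    if "x \<in> Zp" for x n
  proof (rule continuous_eq_on_Zp[OF _ _ _ that])
    show "continuous_on Zp (\<lambda>x. padic_power u (x + of_nat n))"
      by (intro shift) simp
    show "continuous_on Zp (\<lambda>x. padic_power u x * padic_power u (of_nat n))"
      by (rule continuous_on_mult'[OF cont continuous_on_const])
    show "padic_power u (of_nat k + of_nat n) = padic_power u (of_nat k) * padic_power u (of_nat n)" for k
      using padic_power_of_nat[of u "k + n"] by (simp add: padic_power_of_nat power_add)
  qed
  show ?thesis
  proof (rule continuous_eq_on_Zp[OF _ _ _ \<open>t \<in> Zp\<close>])
    show "continuous_on Zp (\<lambda>t. padic_power u (s + t))"
      using shift[OF \<open>s \<in> Zp\<close>] by (simp add: add.commute)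
    show "continuous_on Zp (\<lambda>t. padic_power u s * padic_power u t)"
      by (rule continuous_on_mult'[OF continuous_on_const cont])
  qed (use nat \<open>s \<in> Zp\<close> in auto)
qed

text \<open>
  Both sides are \<open>u\<^sup>s\<^sup>t\<close> for natural exponents; density is applied first to \<open>t\<close>, then to \<open>s\<close>.
\<close>

lemma padic_power_padic_power_commute:
  assumes u: "(u::'k) \<in> one_units p" and s: "s \<in> Zp" and t: "t \<in> Zp"
  shows "padic_power (padic_power u s) t = padic_power (padic_power u t) s"
proof -
  note cont = continuous_on_padic_power
  have nat: "padic_power (padic_power u (of_nat n)) x = padic_power (padic_power u x) (of_nat n)"
    if "x \<in> Zp" for x n
    unfolding padic_power_of_nat
  proof (rule continuous_eq_on_Zp[OF _ _ _ that])
    show "continuous_on Zp (padic_power (u ^ n))"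
      by (intro cont one_units_power u)
    show "continuous_on Zp (\<lambda>x. padic_power u x ^ n)"
      by (rule continuous_on_power'[OF cont[OF u] continuous_on_const])
    show "padic_power (u ^ n) (of_nat k) = padic_power u (of_nat k) ^ n" for k
      by (simp add: padic_power_of_nat mult.commute flip: power_mult)
  qed
  show ?thesis
  proof (rule continuous_eq_on_Zp[OF _ _ _ s])
    show "continuous_on Zp (\<lambda>s. padic_power (padic_power u s) t)"
      by (rule continuous_on_compose2[OF continuous_on_padic_power_base[OF t] cont[OF u]])
        (auto intro: padic_power_mem_one_units u)
    show "continuous_on Zp (padic_power (padic_power u t))"
      by (intro cont padic_power_mem_one_units u t)
  qed (use nat t in auto)
qed

lemma inverse_absval_of_nat_le:
  assumes "n > 0"
  shows "inverse (absval (of_nat n :: 'k)) \<le> real n"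
proof -
  have "\<not> is_unit p"
    using p_gt_1 by simp
  then obtain q where q: "n = p ^ multiplicity p n * q" "\<not> p dvd q"
    using multiplicity_decompose'[of n p] assms by blast
  have "absval (of_nat n :: 'k) = 1 / real p ^ multiplicity p n"
    using q(2) by (subst q(1)) (simp add: absval_mult absval_p_power absval_of_nat_eq_1_iff)
  moreover have "p ^ multiplicity p n \<le> n"
    using assms by (intro dvd_imp_le multiplicity_dvd) auto
  ultimately show ?thesis
    by (simp add: of_nat_le_iff flip: of_nat_power)
qed

lemma three_mult_le_two_mult_power:
  assumes "3 \<le> (x::real)"
  shows "3 * real (i + 2) \<le> 2 * x ^ Suc i"
proof (induction i)
  case (Suc i)
  have "3 * real (Suc i + 2) \<le> 3 * (3 * real (i + 2))"
    by simp
  also have "\<dots> \<le> x * (2 * x ^ Suc i)"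
    using mult_mono[OF assms Suc] assms by simp
  finally show ?case
    by (simp add: mult_ac)
qed (use assms in auto)

text \<open>
  The quadratic and higher terms of the binomial series for \<open>u\<^sup>d - 1\<close> are strictly smaller than the
  linear term \<open>d (u - 1)\<close>; this is where \<open>p\<close> odd matters.
\<close>

lemma absval_padic_power_minus_1:
  assumes u: "(u::'k) \<in> one_units p" and d: "d \<in> Zp" and "odd p"
  shows "absval (padic_power u d - 1) = absval d * absval (u - 1)"
proof -
  define y where "y = u - 1"
  have y: "absval y \<le> 1 / real p"
    using one_unitsD[OF u] by (simp add: y_def)
  have p3: "real p \<ge> 3"
    using \<open>odd p\<close> p_gt_1 by (cases "p = 2") auto
  \<comment> \<open>The factor 2/3 is the worst case: the quadratic term for \<open>p = 3\<close>, by the crude bound on \<open>1/2\<close>.\<close>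
  define M where "M = 2 / 3 * (absval d * absval y)"
  have "absval ((d gchoose k) * y ^ k) \<le> M" if k: "k \<ge> 2" for k
  proof -
    obtain i where i: "k = i + 2"
      using k le_Suc_ex by (metis add.commute)
    have "of_nat (i + 2) * (d gchoose k) = d * ((d - 1) gchoose (i + 1))"
      using gbinomial_absorption[of "i + 1" d] by (simp add: i)
    then have "absval (of_nat (i + 2) :: 'k) * absval (d gchoose k) = absval d * absval ((d - 1) gchoose (i + 1))"
      by (simp only: absval_mult[symmetric])
    also have "\<dots> \<le> absval d * 1"
      using d by (intro mult_left_mono absval_gbinomial_le_1) auto
    finally have "absval (d gchoose k) \<le> absval d * inverse (absval (of_nat (i + 2) :: 'k))"
      using absval_eq_0_iff[of "of_nat (i + 2) :: 'k"] absval_nonneg[of "of_nat (i + 2) :: 'k"]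
      by (simp add: divide_inverse[symmetric] pos_le_divide_eq less_le mult.commute
          del: of_nat_add of_nat_Suc absval_eq_0_iff absval_nonneg)
    also have "\<dots> \<le> absval d * real (i + 2)"
      by (intro mult_left_mono inverse_absval_of_nat_le) auto
    finally have 1: "absval (d gchoose k) \<le> absval d * real (i + 2)" .
    have "absval (y ^ Suc i) \<le> (1 / real p) ^ Suc i"
      unfolding absval_power by (intro power_mono y) auto
    then have "absval y * absval (y ^ Suc i) \<le> absval y * (1 / real p ^ Suc i)"
      by (intro mult_left_mono) (simp_all add: power_divide)
    then have "absval (y ^ k) \<le> absval y * (1 / real p ^ Suc i)"
      by (simp add: i absval_mult)
    then have "absval ((d gchoose k) * y ^ k) \<le> (absval d * real (i + 2)) * (absval y * (1 / real p ^ Suc i))"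
      by (intro absval_mult_le 1)
    also have "\<dots> = absval d * absval y * (real (i + 2) * (1 / real p ^ Suc i))"
      by (simp add: mult_ac)
    also have "\<dots> \<le> absval d * absval y * (2 / 3)"
      using three_mult_le_two_mult_power[OF p3, of i] p3
      by (intro mult_left_mono) (auto simp: field_simps simp del: of_nat_add of_nat_Suc power_Suc)
    finally show ?thesis
      by (simp add: M_def mult_ac)
  qed
  then have "absval (padic_power u d - (\<Sum>k<2. (d gchoose k) * y ^ k)) \<le> M"
    unfolding padic_power_def y_def
    by (intro absval_suminf_diff_partial_le summable_binomial_series u d) (auto simp: M_def)
  then have le: "absval ((padic_power u d - 1) - d * y) \<le> M"
    by (simp add: numeral_2_eq_2 diff_diff_eq)
  show ?thesis
  proof (cases "absval d * absval y = 0")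
    case True
    then have *: "M = 0" "d * y = 0"
      by (auto simp: M_def)
    have "absval (padic_power u d - 1 - 0) \<le> 0"
      using le unfolding * .
    then have "absval (padic_power u d - 1) \<le> 0"
      unfolding diff_zero .
    then have "absval (padic_power u d - 1) = 0"
      using absval_nonneg[of "padic_power u d - 1"] by linarith
    then show ?thesis
      using True unfolding y_def by simp
  next
    case False
    then have "absval d * absval y > 0"
      by (simp add: less_le)
    then have "M < absval (d * y)"
      by (simp add: M_def absval_mult)
    then show ?thesis
      using absval_add_eq[of "(padic_power u d - 1) - d * y" "d * y"] le
      by (simp add: absval_mult y_def)
  qed
qed

end

section \<open>Expansion of integrals on the weight disc\<close>

context padic_field
begin

lemma padic_power_of_int:
  assumes u: "(u::'k) \<in> one_units p"
  shows "padic_power u (of_int k) = u powi k"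
proof (cases "k \<ge> 0")
  case True
  then show ?thesis
    using padic_power_of_nat[of u "nat k"] by (simp add: power_int_def)
next
  case False
  have "padic_power u (of_int k + of_nat (nat (- k))) = padic_power u (of_int k) * u ^ nat (- k)"
    using padic_power_add[OF u, of "of_int k" "of_nat (nat (- k))"] by (simp add: padic_power_of_nat)
  moreover have "of_int k + of_nat (nat (- k)) = (of_nat 0 :: 'k)"
    using False by simp
  ultimately have "padic_power u (of_int k) * u ^ nat (- k) = 1"
    by (simp only: padic_power_of_nat power_0)
  moreover have "u \<noteq> 0"
    using one_unitsD(3)[OF u] by auto
  ultimately show ?thesis
    using False by (simp add: power_int_def field_simps)
qed

lemma topological_generator_mem_one_units:
  assumes "topological_generator p (\<gamma>::'k)"
  shows "\<gamma> \<in> one_units p"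
proof -
  have "\<gamma> powi 1 \<in> closure (range (\<lambda>k. \<gamma> powi k))"
    by (rule subsetD[OF closure_subset]) blast
  then show ?thesis
    using assms by (simp add: topological_generator_def)
qed

lemma topological_generator_neq_1:
  assumes "topological_generator p (\<gamma>::'k)"
  shows "\<gamma> \<noteq> 1"
proof
  assume "\<gamma> = 1"
  then have "one_units p = {1::'k}"
    using assms by (simp add: topological_generator_def)
  moreover have "1 + of_nat p \<in> (one_units p :: 'k set)"
    by (auto simp: one_units_def intro!: exI[of _ 1])
  ultimately show False
    using p_gt_1 by simp
qed

text \<open>
  The powers with \<open>p\<close>-adic exponent form a compact, hence closed, set that contains the integral powers of \<open>\<gamma>\<close>.
\<close>

lemma padic_power_generator_surj:
  assumes \<gamma>: "topological_generator p (\<gamma>::'k)" and u: "u \<in> one_units p"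
  obtains l where "l \<in> Zp" "padic_power \<gamma> l = u"
proof -
  note \<gamma>1 = topological_generator_mem_one_units[OF \<gamma>]
  have "compact (padic_power \<gamma> ` Zp)"
    by (intro compact_continuous_image continuous_on_padic_power \<gamma>1 compact_Zp)
  moreover have "range (\<lambda>k. \<gamma> powi k) \<subseteq> padic_power \<gamma> ` Zp"
  proof (rule image_subsetI)
    fix k :: int
    show "\<gamma> powi k \<in> padic_power \<gamma> ` Zp"
      using padic_power_of_int[OF \<gamma>1, of k] by (intro image_eqI[of _ _ "of_int k"]) auto
  qed
  ultimately have "one_units p \<subseteq> padic_power \<gamma> ` Zp"
    using \<gamma> closure_minimal compact_imp_closed unfolding topological_generator_def by blast
  then show ?thesis
    using u that by auto
qed

text \<open>
  The logarithm to the base \<open>\<gamma>\<close>.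
\<close>

definition padic_log :: "'k \<Rightarrow> 'k \<Rightarrow> 'k" where
  "padic_log \<gamma> u = (SOME l. l \<in> Zp \<and> padic_power \<gamma> l = u)"

lemma padic_log:
  assumes "topological_generator p (\<gamma>::'k)" "u \<in> one_units p"
  shows "padic_log \<gamma> u \<in> Zp" "padic_power \<gamma> (padic_log \<gamma> u) = u"
  using someI_ex[of "\<lambda>l. l \<in> Zp \<and> padic_power \<gamma> l = u"] padic_power_generator_surj[OF assms]
  unfolding padic_log_def by blast+

text \<open>
  The logarithm is a similarity, since \<open>\<gamma>\<^sup>a - \<gamma>\<^sup>b\<close> has the absolute value of \<open>(a - b) (\<gamma> - 1)\<close>. In particular it
  is continuous, as the integrals below require.
\<close>

lemma absval_padic_log_diff:
  assumes \<gamma>: "topological_generator p (\<gamma>::'k)" and "odd p" and u: "u \<in> one_units p" and v: "v \<in> one_units p"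
  shows "absval (padic_log \<gamma> u - padic_log \<gamma> v) * absval (\<gamma> - 1) = absval (u - v)"
proof -
  let ?a = "padic_log \<gamma> u" and ?b = "padic_log \<gamma> v"
  note \<gamma>1 = topological_generator_mem_one_units[OF \<gamma>]
  have ab: "?a \<in> Zp" "?b \<in> Zp" "?a - ?b \<in> Zp"
    using padic_log[OF \<gamma> u] padic_log[OF \<gamma> v] by auto
  have "padic_power \<gamma> ((?a - ?b) + ?b) = padic_power \<gamma> (?a - ?b) * padic_power \<gamma> ?b"
    by (intro padic_power_add \<gamma>1 ab)
  then have "u - v = (padic_power \<gamma> (?a - ?b) - 1) * v"
    using padic_log[OF \<gamma> u] padic_log[OF \<gamma> v] by (simp add: algebra_simps)
  then show ?thesis
    using absval_padic_power_minus_1[OF \<gamma>1 ab(3) \<open>odd p\<close>] one_unitsD(3)[OF v] by (simp add: absval_mult)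
qed

lemma padic_continuous_on_units:
  fixes h :: "nat \<Rightarrow> 'k"
  assumes "\<And>e. e > 0 \<Longrightarrow> \<exists>m. \<forall>a b. \<not> p dvd a \<longrightarrow> \<not> p dvd b \<longrightarrow> [a = b] (mod p ^ Suc m) \<longrightarrow>
    absval (h a - h b) \<le> e"
  shows "padic_continuous (\<lambda>a. if p dvd a then 0 else h a)"
  unfolding padic_continuous_def
proof (intro allI impI)
  fix e :: real assume e: "e > 0"
  then obtain m where m: "\<And>a b. \<not> p dvd a \<Longrightarrow> \<not> p dvd b \<Longrightarrow> [a = b] (mod p ^ Suc m) \<Longrightarrow>
      absval (h a - h b) \<le> e"
    using assms by meson
  have "oscillation_le (\<lambda>a. if p dvd a then 0 else h a) (Suc m) e"
    unfolding oscillation_le_def using e m dvd_cong_p_power_Suc by auto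
  then show "\<exists>m. oscillation_le (\<lambda>a. if p dvd a then 0 else h a) m e" ..
qed

lemma cong_p_power_Suc_imp_cong_p: "[a = b] (mod p ^ Suc m) \<Longrightarrow> [a = b] (mod p)"
  by (rule cong_dvd_modulus_nat) auto

lemma absval_power_int_eq_1: "absval (x::'k) = 1 \<Longrightarrow> absval (x powi n) = 1"
  by (cases "n \<ge> 0") (auto simp: power_int_def absval_power absval_inverse)

text \<open>
  Every integrand below is a function of the angle part, weighted by a power of the Teichmueller
  character and by the density \<open>x\<^sup>-\<^sup>1\<close>.
\<close>

definition unit_integrand :: "int \<Rightarrow> ('k \<Rightarrow> 'k) \<Rightarrow> nat \<Rightarrow> 'k" where
  "unit_integrand j g a = (if p dvd a then 0 else
     teichmueller p (of_nat a) powi j * g (angle_part p (of_nat a)) * inverse (of_nat a))"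

lemma unit_integrand:
  fixes g :: "'k \<Rightarrow> 'k"
  assumes bound: "\<And>u. u \<in> one_units p \<Longrightarrow> absval (g u) \<le> 1"
    and cont: "uniformly_continuous_on (one_units p) g"
  shows "padic_continuous (unit_integrand j g)" and "absval (unit_integrand j g a) \<le> 1"
proof -
  have unit: "absval (inverse (of_nat a :: 'k)) = 1" if "\<not> p dvd a" for a
    using that absval_of_nat_eq_1_iff[of a] by (simp add: absval_inverse)
  have teich: "absval (teichmueller p (of_nat a :: 'k) powi j) = 1" if "\<not> p dvd a" for a
    by (intro absval_power_int_eq_1 teichmueller(4) that)
  have bound': "absval (teichmueller p (of_nat a) powi j * g (angle_part p (of_nat a))) \<le> 1"
    if "\<not> p dvd a" for a
    using teich[OF that] bound[OF angle_part_mem_one_units[OF that]] by (simp add: absval_mult)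
  then show "absval (unit_integrand j g a) \<le> 1"
    using unit[of a] by (simp add: unit_integrand_def absval_mult)
  show "padic_continuous (unit_integrand j g)"
    unfolding unit_integrand_def
  proof (rule padic_continuous_on_units)
    fix e :: real assume e: "e > 0"
    obtain d where d: "d > 0" "\<And>u v. u \<in> one_units p \<Longrightarrow> v \<in> one_units p \<Longrightarrow> absval (u - v) < d \<Longrightarrow>
        absval (g u - g v) < e"
      using cont e unfolding uniformly_continuous_on_def dist_eq_absval by metis
    obtain m where m: "1 / real p ^ m < min d e"
      using d(1) e by (metis inverse_p_power_less min_less_iff_conj)
    have "absval (teichmueller p (of_nat a) powi j * g (angle_part p (of_nat a)) * inverse (of_nat a) -
        teichmueller p (of_nat b) powi j * g (angle_part p (of_nat b)) * inverse (of_nat b)) \<le> e"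
      if a: "\<not> p dvd a" and b: "\<not> p dvd b" and ab: "[a = b] (mod p ^ Suc m)" for a b
    proof -
      note abp = cong_p_power_Suc_imp_cong_p[OF ab]
      have "absval (of_nat a - of_nat b :: 'k) \<le> 1 / real p ^ Suc m"
        using ab by (simp only: absval_of_nat_diff_le_iff)
      then have small: "absval (of_nat a - of_nat b :: 'k) < min d e"
        using m inverse_p_power_antimono[of m "Suc m"] by linarith
      have "absval (g (angle_part p (of_nat a)) - g (angle_part p (of_nat b))) < e"
        using small by (intro d(2) angle_part_mem_one_units a b) (simp add: absval_angle_part_diff[OF a abp])
      then show ?thesis
        using small unit bound' teich bound angle_part_mem_one_units a b teichmueller_cong[OF a abp] e
        by (intro absval_mult_diff_le) (auto simp: absval_inverse_diff less_imp_le)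
    qed
    then show "\<exists>m. \<forall>a b. \<not> p dvd a \<longrightarrow> \<not> p dvd b \<longrightarrow> [a = b] (mod p ^ Suc m) \<longrightarrow>
        absval (teichmueller p (of_nat a) powi j * g (angle_part p (of_nat a)) * inverse (of_nat a) -
        teichmueller p (of_nat b) powi j * g (angle_part p (of_nat b)) * inverse (of_nat b)) \<le> e"
      by blast
  qed
qed

lemma compact_one_units: "compact (one_units p :: 'k set)"
  using compact_Int_closed[OF compact_Zp closed_one_units] one_unitsD(1)
  by (metis Int_absorb1 subsetI)

lemma unit_integrand_padic_power:
  assumes s: "(s::'k) \<in> Zp"
  shows "padic_continuous (unit_integrand j (\<lambda>u. padic_power u s))"
    and "absval (unit_integrand j (\<lambda>u. padic_power u s) a) \<le> 1"
proof -
  have cont: "uniformly_continuous_on (one_units p) (\<lambda>u. padic_power u s)"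
    by (intro compact_uniformly_continuous continuous_on_padic_power_base s compact_one_units)
  have bound: "absval (padic_power u s) \<le> 1" if "u \<in> one_units p" for u
    using one_unitsD(3)[OF padic_power_mem_one_units[OF that s]] by simp
  show "padic_continuous (unit_integrand j (\<lambda>u. padic_power u s))"
    and "absval (unit_integrand j (\<lambda>u. padic_power u s) a) \<le> 1"
    by (rule unit_integrand[OF bound cont]; assumption)+
qed

lemma unit_integrand_gbinomial_log:
  assumes \<gamma>: "topological_generator p (\<gamma>::'k)" and "odd p"
  shows "padic_continuous (unit_integrand j (\<lambda>u. padic_log \<gamma> u gchoose k))"
    and "absval (unit_integrand j (\<lambda>u. padic_log \<gamma> u gchoose k) a) \<le> 1"
proof -
  have pos: "absval (\<gamma> - 1) > 0"
    using topological_generator_neq_1[OF \<gamma>] by (simp add: less_le)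
  have "continuous_on (one_units p) (padic_log \<gamma>)"
    unfolding continuous_on_iff dist_eq_absval
  proof (intro ballI allI impI)
    fix u :: 'k and e :: real assume u: "u \<in> one_units p" and e: "e > 0"
    have "absval (padic_log \<gamma> v - padic_log \<gamma> u) < e"
      if "v \<in> one_units p" "absval (v - u) < e * absval (\<gamma> - 1)" for v
    proof -
      have "absval (padic_log \<gamma> v - padic_log \<gamma> u) * absval (\<gamma> - 1) < e * absval (\<gamma> - 1)"
        using absval_padic_log_diff[OF \<gamma> \<open>odd p\<close> that(1) u] that(2) by simp
      then show ?thesis
        using pos by simp
    qed
    then show "\<exists>d>0. \<forall>v\<in>one_units p. absval (v - u) < d \<longrightarrow> absval (padic_log \<gamma> v - padic_log \<gamma> u) < e"
      using e pos by (intro exI[of _ "e * absval (\<gamma> - 1)"]) auto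
  qed
  then have "continuous_on (one_units p) (\<lambda>u. padic_log \<gamma> u gchoose k)"
    by (rule continuous_on_compose2[OF continuous_on_gbinomial[of UNIV]]) simp
  then have cont: "uniformly_continuous_on (one_units p) (\<lambda>u. padic_log \<gamma> u gchoose k)"
    using compact_uniformly_continuous compact_one_units by blast
  have bound: "absval (padic_log \<gamma> u gchoose k) \<le> 1" if "u \<in> one_units p" for u
    by (intro absval_gbinomial_le_1 padic_log \<gamma> that)
  show "padic_continuous (unit_integrand j (\<lambda>u. padic_log \<gamma> u gchoose k))"
    and "absval (unit_integrand j (\<lambda>u. padic_log \<gamma> u gchoose k) a) \<le> 1"
    by (rule unit_integrand[OF bound cont]; assumption)+
qed

text \<open>
  Writing \<open>u = \<gamma>\<^sup>l\<close>, the function \<open>s \<mapsto> u\<^sup>s = (\<gamma>\<^sup>s)\<^sup>l\<close> is the binomial series in \<open>\<gamma>\<^sup>s - 1\<close> with exponent \<open>l\<close>.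
  Integrating it term by term gives the expansion on the weight disc.
\<close>

lemma mellin_power_series:
  assumes \<gamma>: "topological_generator p (\<gamma>::'k)" and "odd p"
    and w: "bounded_distribution w C" and s: "s \<in> Zp"
  shows "(\<lambda>k. riemann_integral w (unit_integrand j (\<lambda>u. padic_log \<gamma> u gchoose k)) *
      (padic_power \<gamma> s - 1) ^ k) sums riemann_integral w (unit_integrand j (\<lambda>u. padic_power u s))"
    (is "(\<lambda>k. riemann_integral w (?c k) * ?X ^ k) sums riemann_integral w ?f")
  unfolding sums_def
proof (rule tendsto_squeeze_absval[OF absval_limit_le])
  \<comment> \<open>The partial sums of level \<open>n\<close> are compared before passing to the limit in the Riemann sums.\<close>
  note \<gamma>1 = topological_generator_mem_one_units[OF \<gamma>]
  note Xs = padic_power_mem_one_units[OF \<gamma>1 s]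
  fix n
  show "(\<lambda>m. (\<Sum>k<n. riemann_sum w (?c k) m * ?X ^ k) - riemann_sum w ?f m) \<longlonglongrightarrow>
      (\<Sum>k<n. riemann_integral w (?c k) * ?X ^ k) - riemann_integral w ?f"
    by (intro tendsto_diff tendsto_sum tendsto_mult tendsto_const
        riemann_integral[OF w] unit_integrand_padic_power s unit_integrand_gbinomial_log \<gamma> \<open>odd p\<close>)
  have pointwise: "absval ((\<Sum>k<n. ?c k a * ?X ^ k) - ?f a) \<le> 1 / real p ^ n" for a
  proof (cases "p dvd a")
    case False
    define u where "u = angle_part p (of_nat a :: 'k)"
    define h where "h = teichmueller p (of_nat a :: 'k) powi j * inverse (of_nat a)"
    have u: "u \<in> one_units p"
      unfolding u_def by (rule angle_part_mem_one_units[OF False])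
    note l = padic_log[OF \<gamma> u]
    have "padic_power u s = padic_power (padic_power \<gamma> s) (padic_log \<gamma> u)"
      using padic_power_padic_power_commute[OF \<gamma>1 l(1) s] by (simp add: l(2))
    then have "absval ((\<Sum>k<n. (padic_log \<gamma> u gchoose k) * ?X ^ k) - padic_power u s) \<le> 1 / real p ^ n"
      using padic_power_partial_sum[OF Xs l(1), of n] by (simp add: absval_minus_commute)
    moreover have "absval h = 1"
      using absval_power_int_eq_1[OF teichmueller(4)[OF False]] False absval_of_nat_eq_1_iff[of a]
      by (simp add: h_def absval_mult absval_inverse)
    moreover have "(\<Sum>k<n. ?c k a * ?X ^ k) - ?f a =
        h * ((\<Sum>k<n. (padic_log \<gamma> u gchoose k) * ?X ^ k) - padic_power u s)"
      using False by (simp add: unit_integrand_def h_def u_def sum_distrib_left right_diff_distrib mult_ac)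
    ultimately show ?thesis
      by (simp add: absval_mult)
  qed (simp add: unit_integrand_def)
  have "absval ((\<Sum>k<n. riemann_sum w (?c k) m * ?X ^ k) - riemann_sum w ?f m) \<le> 1 / real p ^ n * C" for m
  proof -
    have "(\<Sum>k<n. riemann_sum w (?c k) m * ?X ^ k) =
        (\<Sum>a<p ^ m. \<Sum>k<n. ?c k a * w m a * ?X ^ k)"
      unfolding riemann_sum_def sum_distrib_right by (rule sum.swap)
    then have "(\<Sum>k<n. riemann_sum w (?c k) m * ?X ^ k) - riemann_sum w ?f m =
        riemann_sum w (\<lambda>a. (\<Sum>k<n. ?c k a * ?X ^ k) - ?f a) m"
      unfolding riemann_sum_def
      by (simp only: sum_subtractf[symmetric])
        (auto simp: sum_distrib_left right_diff_distrib mult_ac intro!: sum.cong)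
    then show ?thesis
      using absval_riemann_sum_le[OF w pointwise] by simp
  qed
  then show "\<forall>\<^sub>F m in sequentially.
      absval ((\<Sum>k<n. riemann_sum w (?c k) m * ?X ^ k) - riemann_sum w ?f m) \<le> C * (1 / real p ^ n)"
    by (intro always_eventually allI) (simp add: mult.commute)
qed (rule inverse_p_power_tendsto_0)

text \<open>
  All values \<open>u\<^sup>s - 1\<close> lie in the closed disc of radius \<open>1/p\<close>, where the power series converges uniformly.
\<close>

lemma continuous_on_power_series:
  assumes u: "(u::'k) \<in> one_units p"
    and c: "(\<lambda>k. absval (c k) * (1 / real p) ^ k) \<longlonglongrightarrow> 0"
    and sums: "\<And>s. s \<in> Zp \<Longrightarrow> (\<lambda>k. c k * (padic_power u s - 1) ^ k) sums f s"
  shows "continuous_on Zp f"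
proof (rule uniform_limit_theorem)
  show "\<forall>\<^sub>F n in sequentially. continuous_on Zp (\<lambda>s. \<Sum>k<n. c k * (padic_power u s - 1) ^ k)"
    by (intro always_eventually allI continuous_on_sum continuous_on_mult' continuous_on_power'
        continuous_on_diff continuous_on_padic_power u continuous_on_const)
  have term_le: "absval (c k * (padic_power u s - 1) ^ k) \<le> absval (c k) * (1 / real p) ^ k"
    if "s \<in> Zp" for s k
    unfolding absval_mult absval_power
    using one_unitsD(2)[OF padic_power_mem_one_units[OF u that]]
    by (intro mult_left_mono power_mono) auto
  show "uniform_limit Zp (\<lambda>n s. \<Sum>k<n. c k * (padic_power u s - 1) ^ k) f sequentially"
    unfolding uniform_limit_iff
  proof (intro allI impI)
    fix e :: real assume e: "e > 0"
    then have "\<forall>\<^sub>F k in sequentially. absval (c k) * (1 / real p) ^ k < e / 2"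
      by (intro order_tendstoD(2)[OF c]) simp
    then obtain M where M: "\<And>k. k \<ge> M \<Longrightarrow> absval (c k) * (1 / real p) ^ k < e / 2"
      by (auto simp: eventually_sequentially)
    have "absval (f s - (\<Sum>k<n. c k * (padic_power u s - 1) ^ k)) \<le> e / 2"
      if s: "s \<in> Zp" and "n \<ge> M" for s n
      unfolding sums_unique[OF sums[OF s]]
    proof (rule absval_suminf_diff_partial_le[OF sums_summable[OF sums[OF s]]])
      show "absval (c k * (padic_power u s - 1) ^ k) \<le> e / 2" if "k \<ge> n" for k
        using term_le[OF s, of k] M[of k] that \<open>n \<ge> M\<close> by simp
    qed (use e in simp)
    then have "\<forall>s\<in>Zp. dist (\<Sum>k<n. c k * (padic_power u s - 1) ^ k) (f s) < e" if "n \<ge> M" for n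
      using that e by (fastforce simp: dist_eq_absval absval_minus_commute)
    then show "\<forall>\<^sub>F n in sequentially. \<forall>s\<in>Zp. dist (\<Sum>k<n. c k * (padic_power u s - 1) ^ k) (f s) < e"
      unfolding eventually_sequentially by blast
  qed
qed simp

end

section \<open>Moments of the geometric distribution\<close>

text \<open>
  The rational function \<open>Li\<^sub>-\<^sub>k(z) / z\<close>, that is the regularized sum of \<open>(n + 1)\<^sup>k z\<^sup>n\<close> over \<open>n \<ge> 0\<close>,
  described by the recursion that comes from expanding \<open>(n + 2)\<^sup>k\<close> in powers of \<open>n + 1\<close>.
\<close>

fun polylog_quotient :: "nat \<Rightarrow> 'a::field \<Rightarrow> 'a" where
  "polylog_quotient k z = (1 + z * (\<Sum>i<k. of_nat (k choose i) * polylog_quotient i z)) / (1 - z)"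

declare polylog_quotient.simps [simp del]

text \<open>
  This criterion is applied both to \<open>p\<close>-adic limits and to values of an analytic continuation, and it is
  what identifies the two.
\<close>

lemma polylog_quotient_eqI:
  assumes "z \<noteq> (1::'a::field)" and rec: "\<And>k. \<Phi> k = 1 + z * (\<Sum>i\<le>k. of_nat (k choose i) * \<Phi> i)"
  shows "\<Phi> k = polylog_quotient k z"
proof (induction k rule: less_induct)
  case (less k)
  have "\<Phi> k = 1 + z * ((\<Sum>i<k. of_nat (k choose i) * \<Phi> i) + \<Phi> k)"
    using rec[of k] by (simp flip: lessThan_Suc_atMost)
  then have "\<Phi> k = (1 + z * (\<Sum>i<k. of_nat (k choose i) * \<Phi> i)) / (1 - z)"
    using \<open>z \<noteq> 1\<close> by (simp add: field_simps)
  then show ?case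
    using less by (subst polylog_quotient.simps) simp
qed

definition moment_sum :: "nat \<Rightarrow> nat \<Rightarrow> 'a::field \<Rightarrow> 'a" where
  "moment_sum k q z = (\<Sum>a<q. of_nat (Suc a) ^ k * z ^ a)"

text \<open>
  Both sides are the sum over one term more, split off at either end.
\<close>

lemma moment_sum_recursion:
  "moment_sum k q z + of_nat (Suc q) ^ k * z ^ q =
     1 + z * (\<Sum>i\<le>k. of_nat (k choose i) * moment_sum i q (z::'a::field))"
proof -
  have "(of_nat (Suc (Suc a)) :: 'a) ^ k = (\<Sum>i\<le>k. of_nat (k choose i) * of_nat (Suc a) ^ i)" for a
    using binomial_ring[of "of_nat (Suc a) :: 'a" 1 k] by (simp add: add.commute)
  then have "(\<Sum>a<q. of_nat (Suc (Suc a)) ^ k * z ^ Suc a) =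
      (\<Sum>a<q. \<Sum>i\<le>k. z * (of_nat (k choose i) * (of_nat (Suc a) ^ i * z ^ a)))"
    by (intro sum.cong) (simp_all add: sum_distrib_left sum_distrib_right mult_ac del: of_nat_Suc)
  also have "\<dots> = z * (\<Sum>i\<le>k. of_nat (k choose i) * moment_sum i q z)"
    unfolding moment_sum_def sum_distrib_left by (rule sum.swap)
  finally have "(\<Sum>a<Suc q. of_nat (Suc a) ^ k * z ^ a) =
      1 + z * (\<Sum>i\<le>k. of_nat (k choose i) * moment_sum i q z)"
    by (subst sum.lessThan_Suc_shift) simp
  then show ?thesis
    by (simp add: moment_sum_def)
qed

context padic_field
begin

text \<open>
  The moments of the geometric distribution satisfy the recursion in the limit, because the boundary
  term involves \<open>(p\<^sup>m + 1)\<^sup>k \<rightarrow> 1\<close>.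
\<close>

lemma moment_limit:
  fixes z :: 'k
  assumes z: "z ^ N = 1" "z \<noteq> 1" "coprime p N"
  shows "(\<lambda>m. moment_sum k (p ^ m) z / (1 - z ^ (p ^ m))) \<longlonglongrightarrow> polylog_quotient k z"
proof (induction k rule: less_induct)
  case (less k)
  obtain C where w: "bounded_distribution (geometric_weight z) C"
    using z by (rule geometric_weight_bounded_distribution)
  let ?J = "\<lambda>k m. moment_sum k (p ^ m) z / (1 - z ^ (p ^ m))"
  let ?r = "\<lambda>m. (1 - of_nat (Suc (p ^ m)) ^ k * z ^ (p ^ m)) / (1 - z ^ (p ^ m))"
  have neq: "z ^ (p ^ m) \<noteq> 1" for m
    using root_power_p_neq_1[OF z] .
  have "N \<noteq> 0"
    using z(3) p_gt_1 by (intro notI) simp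
  then have abs_z: "absval z = 1"
    using root_of_unity_absval[OF z(1)] by simp
  have "?J k = (\<lambda>m. (?r m + z * (\<Sum>i<k. of_nat (k choose i) * ?J i m)) / (1 - z))"
  proof
    fix m
    have "moment_sum k (p ^ m) z + of_nat (Suc (p ^ m)) ^ k * z ^ (p ^ m) =
        1 + z * ((\<Sum>i<k. of_nat (k choose i) * moment_sum i (p ^ m) z) + moment_sum k (p ^ m) z)"
      using moment_sum_recursion[of k "p ^ m" z] by (simp flip: lessThan_Suc_atMost)
    then have "moment_sum k (p ^ m) z * (1 - z) =
        (1 - of_nat (Suc (p ^ m)) ^ k * z ^ (p ^ m)) + z * (\<Sum>i<k. of_nat (k choose i) * moment_sum i (p ^ m) z)"
      by (simp add: algebra_simps del: of_nat_Suc)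
    then have "moment_sum k (p ^ m) z = ((1 - of_nat (Suc (p ^ m)) ^ k * z ^ (p ^ m)) +
        z * (\<Sum>i<k. of_nat (k choose i) * moment_sum i (p ^ m) z)) / (1 - z)"
      using z(2) by (simp add: eq_divide_eq del: of_nat_Suc)
    moreover have "(\<Sum>i<k. of_nat (k choose i) * ?J i m) =
        (\<Sum>i<k. of_nat (k choose i) * moment_sum i (p ^ m) z) / (1 - z ^ (p ^ m))"
      by (simp add: sum_divide_distrib)
    ultimately show "?J k m = (?r m + z * (\<Sum>i<k. of_nat (k choose i) * ?J i m)) / (1 - z)"
      by (simp add: add_divide_distrib mult.commute del: of_nat_Suc)
  qed
  moreover have "?r \<longlonglongrightarrow> 1"
  proof (rule tendsto_squeeze_absval)
    fix m
    have "absval (of_nat (Suc (p ^ m)) ^ k - 1 ^ k :: 'k) \<le> absval (of_nat (Suc (p ^ m)) - 1 :: 'k)"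
      by (intro absval_power_diff_le absval_of_nat_le_1) simp
    also have "\<dots> = 1 / real p ^ m"
      by (simp add: absval_p_power)
    finally have 1: "absval (of_nat (Suc (p ^ m)) ^ k - 1 :: 'k) \<le> 1 / real p ^ m"
      by simp
    have "absval (z ^ (p ^ m) / (1 - z ^ (p ^ m))) = absval (geometric_weight z m 0)"
      by (simp add: geometric_weight_def absval_divide absval_power abs_z)
    also have "\<dots> \<le> C"
      by (rule bounded_distributionD[OF w p_power_pos])
    finally have 2: "absval (z ^ (p ^ m) / (1 - z ^ (p ^ m))) \<le> C" .
    have "?r m - 1 = - ((z ^ (p ^ m) / (1 - z ^ (p ^ m))) * (of_nat (Suc (p ^ m)) ^ k - 1))"
      using neq[of m] by (simp add: divide_simps algebra_simps del: of_nat_Suc)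
    then show "absval (?r m - 1) \<le> C * (1 / real p ^ m)"
      using absval_mult_le[OF 2 1] by (simp del: of_nat_Suc)
  qed (rule inverse_p_power_tendsto_0)
  then have "(\<lambda>m. (?r m + z * (\<Sum>i<k. of_nat (k choose i) * ?J i m)) * inverse (1 - z))
      \<longlonglongrightarrow> (1 + z * (\<Sum>i<k. of_nat (k choose i) * polylog_quotient i z)) * inverse (1 - z)"
    by (intro tendsto_mult tendsto_add tendsto_sum tendsto_const less) auto
  ultimately have "?J k \<longlonglongrightarrow> (1 + z * (\<Sum>i<k. of_nat (k choose i) * polylog_quotient i z)) * inverse (1 - z)"
    by (simp only: divide_inverse[of _ "1 - z"])
  then show ?case
    by (subst polylog_quotient.simps) (simp add: divide_inverse)
qed

text \<open>
  The multiples of \<open>p\<close> contribute the same moment for the root of unity \<open>z\<^sup>p\<close>; this is the origin of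
  the Euler factor.
\<close>

lemma riemann_integral_unit_moment:
  fixes z :: 'k
  assumes z: "z ^ N = 1" "z \<noteq> 1" "coprime p N"
  shows "riemann_integral (geometric_weight z) (\<lambda>a. if p dvd a then 0 else of_nat a ^ k) =
    z * polylog_quotient k z - of_nat p ^ k * (z ^ p * polylog_quotient k (z ^ p))"
proof -
  let ?R = "riemann_sum (geometric_weight z) (\<lambda>a. if p dvd a then 0 else of_nat a ^ k)"
  have zp: "(z ^ p) ^ N = 1" "z ^ p \<noteq> 1"
    using z(1) root_power_p_neq_1[OF z, of 1] by (simp_all add: power_mult[symmetric] mult.commute power_mult)
  have eq: "?R (Suc m) = z * (moment_sum k (p ^ Suc m) z / (1 - z ^ (p ^ Suc m))) -
      of_nat p ^ k * (z ^ p * (moment_sum k (p ^ m) (z ^ p) / (1 - (z ^ p) ^ (p ^ m))))" for m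
  proof -
    let ?q = "p ^ Suc m"
    let ?h = "\<lambda>a. of_nat a ^ k * z ^ a"
    have multiples: "{a\<in>{1..?q}. p dvd a} = (\<lambda>b. p * Suc b) ` {..<p ^ m}"
    proof (intro equalityI subsetI)
      fix a assume a: "a \<in> {a\<in>{1..?q}. p dvd a}"
      then obtain l where l: "a = p * l"
        by blast
      then obtain b where "l = Suc b"
        using a by (cases l) auto
      then show "a \<in> (\<lambda>b. p * Suc b) ` {..<p ^ m}"
        using a l p_gt_1 by (intro image_eqI[of _ _ b]) (auto simp del: mult_Suc_right)
    next
      fix a assume "a \<in> (\<lambda>b. p * Suc b) ` {..<p ^ m}"
      then obtain b where "b < p ^ m" "a = p * Suc b"
        by blast
      then show "a \<in> {a\<in>{1..?q}. p dvd a}"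
        using mult_le_mono2[of "Suc b" "p ^ m" p] p_gt_1 by simp
    qed
    have "z * moment_sum k ?q z = (\<Sum>a<?q. ?h (Suc a))"
      by (simp add: moment_sum_def sum_distrib_left mult_ac)
    also have "\<dots> = (\<Sum>a\<in>{1..?q}. ?h a)"
      by (rule sum.reindex_bij_witness[of _ "\<lambda>a. a - 1" Suc]) auto
    also have "\<dots> = (\<Sum>a\<in>{a\<in>{1..?q}. p dvd a}. ?h a) + (\<Sum>a\<in>{a\<in>{1..?q}. \<not> p dvd a}. ?h a)"
      by (subst sum.union_disjoint[symmetric]) (auto intro: sum.cong)
    also have "{a\<in>{1..?q}. \<not> p dvd a} = {a\<in>{..<?q}. \<not> p dvd a}"
    proof (intro equalityI subsetI)
      fix a assume "a \<in> {a\<in>{1..?q}. \<not> p dvd a}"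
      then show "a \<in> {a\<in>{..<?q}. \<not> p dvd a}"
        by (cases "a = ?q") auto
    next
      fix a assume "a \<in> {a\<in>{..<?q}. \<not> p dvd a}"
      then show "a \<in> {a\<in>{1..?q}. \<not> p dvd a}"
        by (cases "a = 0") auto
    qed
    also have "(\<Sum>a\<in>{a\<in>{..<?q}. \<not> p dvd a}. ?h a) = (\<Sum>a<?q. (if p dvd a then 0 else of_nat a ^ k) * z ^ a)"
      by (intro sum.mono_neutral_cong_left) auto
    also have "(\<Sum>a\<in>{a\<in>{1..?q}. p dvd a}. ?h a) = (\<Sum>b<p ^ m. ?h (p * Suc b))"
      unfolding multiples using p_gt_1 by (subst sum.reindex) (auto simp: inj_on_def)
    also have "\<dots> = of_nat p ^ k * (z ^ p * moment_sum k (p ^ m) (z ^ p))"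
    proof -
      have "?h (p * Suc b) = of_nat p ^ k * (z ^ p * (of_nat (Suc b) ^ k * (z ^ p) ^ b))" for b
        by (simp only: power_mult power_Suc of_nat_mult power_mult_distrib mult_ac)
      then show ?thesis
        by (simp only: moment_sum_def sum_distrib_left)
    qed
    finally have *: "(\<Sum>a<?q. (if p dvd a then 0 else of_nat a ^ k) * z ^ a) =
        z * moment_sum k ?q z - of_nat p ^ k * (z ^ p * moment_sum k (p ^ m) (z ^ p))"
      by simp
    have "?R (Suc m) = (\<Sum>a<?q. (if p dvd a then 0 else of_nat a ^ k) * z ^ a) / (1 - z ^ ?q)"
      unfolding riemann_sum_def geometric_weight_def sum_divide_distrib by (intro sum.cong) auto
    moreover have "z ^ ?q = (z ^ p) ^ (p ^ m)"
      by (simp add: power_mult)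
    ultimately show ?thesis
      unfolding * by (simp add: diff_divide_distrib)
  qed
  have "(\<lambda>m. ?R (Suc m)) \<longlonglongrightarrow> z * polylog_quotient k z - of_nat p ^ k * (z ^ p * polylog_quotient k (z ^ p))"
    unfolding eq
    by (intro tendsto_diff tendsto_mult tendsto_const LIMSEQ_Suc[OF moment_limit[OF z]]
        moment_limit[OF zp z(3)])
  then have "?R \<longlonglongrightarrow> z * polylog_quotient k z - of_nat p ^ k * (z ^ p * polylog_quotient k (z ^ p))"
    by (rule LIMSEQ_imp_Suc)
  then show ?thesis
    unfolding riemann_integral_def by (rule limI)
qed

text \<open>
  The \<open>n\<close>-th power of the Teichmueller part is its \<open>j\<close>-th power, and recombines with the angle part to \<open>a\<^sup>n\<close>.
\<close>

lemma unit_integrand_of_nat: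
  assumes n: "n \<ge> 1" "[int n = j] (mod (int p - 1))"
  shows "unit_integrand j (\<lambda>u. padic_power u (of_nat n)) =
    (\<lambda>a. if p dvd a then 0 else of_nat a ^ (n - 1) :: 'k)"
proof
  fix a
  show "unit_integrand j (\<lambda>u. padic_power u (of_nat n)) a =
      (if p dvd a then 0 else of_nat a ^ (n - 1) :: 'k)"
  proof (cases "p dvd a")
    case False
    let ?w = "teichmueller p (of_nat a :: 'k)"
    have a0: "(of_nat a :: 'k) \<noteq> 0"
      using False by (intro notI) (use of_nat_eq_0_iff in auto)
    have w0: "?w \<noteq> 0"
      using teichmueller(4)[OF False] by auto
    obtain t where t: "j - int n = (int p - 1) * t"
      using n(2) by (metis cong_iff_dvd_diff cong_sym dvdE)
    have "?w powi (int p - 1) = ?w ^ (p - 1)"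
      using p_gt_1 power_int_of_nat[of ?w "p - 1"] by (simp add: of_nat_diff)
    then have "?w powi (j - int n) = 1"
      unfolding t power_int_mult using teichmueller(2)[OF False] by simp
    then have "?w powi j = ?w ^ n"
      using w0 power_int_diff[of ?w j "int n"] by (simp add: divide_eq_eq)
    then have "?w powi j * (of_nat a / ?w) ^ n = of_nat a ^ n"
      using w0 by (simp add: power_divide)
    moreover have "(of_nat a :: 'k) ^ n * inverse (of_nat a) = of_nat a ^ (n - 1)"
      using n(1) a0 by (cases n) auto
    ultimately show ?thesis
      using False by (simp add: unit_integrand_def padic_power_of_nat angle_part_def)
  qed (simp add: unit_integrand_def)
qed

text \<open>
  The character measure is a finite linear combination of the \<open>\<nu>\<close>, and its Riemann sums converge termwise.
\<close>

lemma mellin_nu_character_measure: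
  fixes \<iota> :: "complex \<Rightarrow> 'k"
  assumes z: "\<And>a. a \<in> totatives N \<Longrightarrow> \<exists>C. bounded_distribution (geometric_weight (\<iota> (\<zeta> ^ a))) C"
    and s: "s \<in> Zp"
  shows "mellin p (nu_character_measure p N \<iota> chi \<zeta>) j s =
    (\<Sum>a\<in>totatives N. \<iota> (chi (int a)) *
       riemann_integral (geometric_weight (\<iota> (\<zeta> ^ a))) (unit_integrand j (\<lambda>u. padic_power u s)))"
proof -
  define F where "F = (\<lambda>x::'k. teichmueller p x powi j * padic_power (angle_part p x) s)"
  have F: "unit_integrand j (\<lambda>u. padic_power u s) =
      (\<lambda>b. if p dvd b then 0 else F (of_nat b) * inverse (of_nat b))"
    by (auto simp: unit_integrand_def F_def)
  have F_le: "absval (F (of_nat b)) \<le> 1" if "\<not> p dvd b" for b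
    using absval_power_int_eq_1[OF teichmueller(4)[OF that]]
      one_unitsD(3)[OF padic_power_mem_one_units[OF angle_part_mem_one_units[OF that] s]]
    by (simp add: F_def absval_mult)
  let ?S = "\<lambda>a m. \<Sum>b | b < p ^ m \<and> (of_nat b :: 'k) \<in> Zp_units.
      F (of_nat b) * nu_measure p (\<iota> (\<zeta> ^ a)) (Zp_units \<inter> Zp_coset p m b)"
  have lim: "?S a \<longlonglongrightarrow> riemann_integral (geometric_weight (\<iota> (\<zeta> ^ a))) (unit_integrand j (\<lambda>u. padic_power u s))"
    if a: "a \<in> totatives N" for a
  proof -
    obtain C where "bounded_distribution (geometric_weight (\<iota> (\<zeta> ^ a))) C"
      using z[OF a] by blast
    from riemann_sums_nu_measure[OF this, of F] F_le unit_integrand_padic_power(1)[OF s, of j]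
    show ?thesis
      unfolding F by blast
  qed
  have "nu_character_measure p N \<iota> chi \<zeta> (Zp_units \<inter> Zp_coset p m b) =
      (\<Sum>a\<in>totatives N. \<iota> (chi (int a)) * nu_measure p (\<iota> (\<zeta> ^ a)) (Zp_units \<inter> Zp_coset p m b))"
    if b: "b < p ^ m" "\<not> p dvd b" for m b
  proof -
    obtain m' where m: "m = Suc m'"
      using b by (cases m) auto
    have "Zp_units \<inter> Zp_coset p m b = (Zp_coset p m b :: 'k set)"
      using Zp_coset_subset_units[OF b(2), of m'] by (auto simp: m)
    then show ?thesis
      using unit_coset_compact_open[OF b(2), of m'] by (simp add: nu_character_measure_def m)
  qed
  then have "(\<Sum>b | b < p ^ m \<and> (of_nat b :: 'k) \<in> Zp_units.
      F (of_nat b) * nu_character_measure p N \<iota> chi \<zeta> (Zp_units \<inter> Zp_coset p m b)) =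
      (\<Sum>a\<in>totatives N. \<iota> (chi (int a)) * ?S a m)" for m
    unfolding sum_distrib_left
    by (subst sum.swap) (intro sum.cong, auto simp: of_nat_mem_Zp_units_iff sum_distrib_left mult_ac)
  then have "mellin p (nu_character_measure p N \<iota> chi \<zeta>) j s =
      lim (\<lambda>m. \<Sum>a\<in>totatives N. \<iota> (chi (int a)) * ?S a m)"
    by (simp add: mellin_def padic_integral_def F_def)
  also have "\<dots> = (\<Sum>a\<in>totatives N. \<iota> (chi (int a)) *
       riemann_integral (geometric_weight (\<iota> (\<zeta> ^ a))) (unit_integrand j (\<lambda>u. padic_power u s)))"
    by (intro limI tendsto_sum tendsto_mult tendsto_const lim)
  finally show ?thesis .
qed

end

section \<open>Continuation of the Lerch series\<close>

definition forward_diff :: "(nat \<Rightarrow> 'a::ab_group_add) \<Rightarrow> nat \<Rightarrow> 'a" where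
  "forward_diff g n = g (Suc n) - g n"

text \<open>
  Summation by parts, \<open>(1 - z) \<Sigma> z\<^sup>n g\<^sub>n = g\<^sub>0 + z \<Sigma> z\<^sup>n (g\<^sub>n\<^sub>+\<^sub>1 - g\<^sub>n)\<close>, iterated \<open>K\<close> times. The right-hand side makes
  sense as soon as the \<open>K\<close>-th differences of \<open>g\<close> are summable.
\<close>

fun abel_sum :: "complex \<Rightarrow> nat \<Rightarrow> (nat \<Rightarrow> complex) \<Rightarrow> complex" where
  "abel_sum z 0 g = (\<Sum>n. z ^ n * g n)"
| "abel_sum z (Suc K) g = (g 0 + z * abel_sum z K (forward_diff g)) / (1 - z)"

definition diff_summable :: "nat \<Rightarrow> (nat \<Rightarrow> complex) \<Rightarrow> bool" where
  "diff_summable K g \<longleftrightarrow> summable (\<lambda>n. norm ((forward_diff ^^ K) g n))"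

lemma diff_summable_0: "diff_summable 0 g \<longleftrightarrow> summable (\<lambda>n. norm (g n))"
  by (simp add: diff_summable_def)

lemma diff_summable_Suc: "diff_summable (Suc K) g \<longleftrightarrow> diff_summable K (forward_diff g)"
  by (simp add: diff_summable_def funpow_Suc_right del: funpow.simps)

lemma diff_summable_imp_Suc: "diff_summable K g \<Longrightarrow> diff_summable (Suc K) g"
proof (induction K arbitrary: g)
  case 0
  have "norm (norm (forward_diff g n)) \<le> norm (g (Suc n)) + norm (g n)" for n
    unfolding forward_diff_def by (simp add: norm_triangle_ineq4)
  moreover have "summable (\<lambda>n. norm (g (Suc n)) + norm (g n))"
    using 0 by (intro summable_add) (simp_all add: diff_summable_0 summable_Suc_iff[of "\<lambda>n. norm (g n)"])
  ultimately show ?case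
    unfolding diff_summable_Suc diff_summable_0 by (rule summable_comparison_test'[of _ 0, rotated])
qed (simp add: diff_summable_Suc)

lemma summable_power_times:
  assumes "norm z \<le> 1" "summable (\<lambda>n. norm (g n))"
  shows "summable (\<lambda>n. z ^ n * (g n :: complex))"
proof (rule summable_comparison_test'[OF assms(2), of 0])
  show "norm (z ^ n * g n) \<le> norm (g n)" for n
    using assms(1) by (simp add: norm_mult norm_power mult_left_le_one_le power_le_one)
qed

lemma suminf_power_split:
  assumes "norm z \<le> 1" "summable (\<lambda>n. norm (g n))"
  shows "(\<Sum>n. z ^ n * (g n :: complex)) = g 0 + z * (\<Sum>n. z ^ n * g (Suc n))"
proof -
  have "summable (\<lambda>n. norm (g (Suc n)))"
    using assms(2) by (simp add: summable_Suc_iff[of "\<lambda>n. norm (g n)"])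
  then have "(\<Sum>n. z * (z ^ n * g (Suc n))) = z * (\<Sum>n. z ^ n * g (Suc n))"
    using assms(1) by (intro suminf_mult summable_power_times)
  then show ?thesis
    using suminf_split_head[OF summable_power_times[OF assms]] by (simp add: mult.assoc)
qed

text \<open>
  The regularized sums obey the shift rule of convergent sums. Together with linearity this gives the
  recursion for their values on powers.
\<close>

lemma abel_sum_shift:
  assumes z: "norm z \<le> 1" "z \<noteq> 1" and g: "diff_summable K g"
  shows "abel_sum z K g = g 0 + z * abel_sum z K (\<lambda>n. g (Suc n))"
  using g
proof (induction K arbitrary: g)
  case 0
  then show ?case
    using suminf_power_split[OF z(1)] by (simp add: diff_summable_0)
next
  case (Suc K)
  have "(\<lambda>n. forward_diff g (Suc n)) = forward_diff (\<lambda>n. g (Suc n))"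
    by (auto simp: forward_diff_def)
  then have "abel_sum z K (forward_diff g) =
      forward_diff g 0 + z * abel_sum z K (forward_diff (\<lambda>n. g (Suc n)))"
    using Suc.IH[of "forward_diff g"] Suc.prems by (simp add: diff_summable_Suc)
  then have "g 0 + z * abel_sum z K (forward_diff g) =
      (1 - z) * g 0 + z * (g 1 + z * abel_sum z K (forward_diff (\<lambda>n. g (Suc n))))"
    by (simp only:) (simp add: forward_diff_def[of g] algebra_simps)
  then show ?case
    using z(2) by (simp add: add_divide_distrib distrib_left)
qed

text \<open>
  A further summation by parts does not change a sum that already converges, so the regularized sum
  does not depend on the number of steps.
\<close>

lemma abel_sum_Suc:
  assumes z: "norm z \<le> 1" "z \<noteq> 1" and g: "diff_summable K g"
  shows "abel_sum z (Suc K) g = abel_sum z K g"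
  using g
proof (induction K arbitrary: g)
  case 0
  then have sg: "summable (\<lambda>n. norm (g n))" "summable (\<lambda>n. norm (g (Suc n)))"
    by (simp_all add: diff_summable_0 summable_Suc_iff[of "\<lambda>n. norm (g n)"])
  have "(\<Sum>n. z ^ n * forward_diff g n) = (\<Sum>n. z ^ n * g (Suc n)) - (\<Sum>n. z ^ n * g n)"
    by (subst suminf_diff) (use sg z(1) in \<open>auto intro: summable_power_times simp: forward_diff_def right_diff_distrib\<close>)
  moreover note suminf_power_split[OF z(1) sg(1)]
  ultimately have "g 0 + z * (\<Sum>n. z ^ n * forward_diff g n) = (1 - z) * (\<Sum>n. z ^ n * g n)"
    by (simp only:) (simp add: algebra_simps)
  then show ?case
    using z(2) by (simp add: divide_eq_eq mult.commute)
next
  case (Suc K)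
  then show ?case
    by (simp add: diff_summable_Suc)
qed

lemma abel_sum_mono:
  assumes z: "norm z \<le> 1" "z \<noteq> 1" and g: "diff_summable K g" and "K \<le> L"
  shows "abel_sum z L g = abel_sum z K g"
proof -
  have "diff_summable L g \<and> abel_sum z L g = abel_sum z K g"
    using \<open>K \<le> L\<close>
  proof (induction L rule: dec_induct)
    case (step n)
    then show ?case
      using diff_summable_imp_Suc abel_sum_Suc[OF z] by metis
  qed (use g in simp)
  then show ?thesis ..
qed

lemma forward_diff_sum:
  "forward_diff (\<lambda>n. \<Sum>i\<in>A. c i * g i n) = (\<lambda>n. \<Sum>i\<in>A. (c i :: complex) * forward_diff (g i) n)"
  by (auto simp: forward_diff_def right_diff_distrib sum_subtractf)

lemma abel_sum_linear:
  assumes z: "norm z \<le> 1" and g: "\<And>i. i \<in> A \<Longrightarrow> diff_summable K (g i)"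
  shows "abel_sum z K (\<lambda>n. \<Sum>i\<in>A. c i * g i n) = (\<Sum>i\<in>A. c i * abel_sum z K (g i))"
  using g
proof (induction K arbitrary: g)
  case 0
  have sm: "summable (\<lambda>n. z ^ n * g i n)" if "i \<in> A" for i
    using 0 that z by (intro summable_power_times) (simp_all add: diff_summable_0)
  have "(\<Sum>n. z ^ n * (\<Sum>i\<in>A. c i * g i n)) = (\<Sum>n. \<Sum>i\<in>A. c i * (z ^ n * g i n))"
    by (simp add: sum_distrib_left mult_ac)
  also have "\<dots> = (\<Sum>i\<in>A. \<Sum>n. c i * (z ^ n * g i n))"
    by (intro suminf_sum summable_mult sm)
  also have "\<dots> = (\<Sum>i\<in>A. c i * (\<Sum>n. z ^ n * g i n))"
    by (intro sum.cong suminf_mult sm) auto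
  finally show ?case by simp
next
  case (Suc K)
  then have "abel_sum z K (\<lambda>n. \<Sum>i\<in>A. c i * forward_diff (g i) n) =
      (\<Sum>i\<in>A. c i * abel_sum z K (forward_diff (g i)))"
    by (intro Suc.IH) (simp add: diff_summable_Suc)
  then show ?case
    by (simp add: forward_diff_sum sum_distrib_left sum.distrib sum_divide_distrib distrib_left
        add_divide_distrib mult_ac)
qed

lemma abel_sum_holomorphic:
  fixes h :: "complex \<Rightarrow> nat \<Rightarrow> complex"
  assumes z: "norm z \<le> 1" and A: "open A" and hol: "\<And>n. (\<lambda>s. h s n) holomorphic_on A"
    and M: "summable M" and bound: "\<And>s n. s \<in> A \<Longrightarrow> norm ((forward_diff ^^ K) (h s) n) \<le> M n"
  shows "(\<lambda>s. abel_sum z K (h s)) holomorphic_on A"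
  using hol bound
proof (induction K arbitrary: h)
  case 0
  have le: "norm (z ^ n * h s n) \<le> M n" if "s \<in> A" for s n
  proof -
    have "norm (z ^ n * h s n) \<le> norm (h s n)"
      using z by (simp add: norm_mult norm_power mult_left_le_one_le power_le_one)
    then show ?thesis
      using 0(2)[OF that, of n] by simp
  qed
  have "(\<lambda>s. \<Sum>n. z ^ n * h s n) holomorphic_on A"
  proof (rule holomorphic_uniform_sequence[OF A])
    show "(\<lambda>s. \<Sum>i<n. z ^ i * h s i) holomorphic_on A" for n
      by (intro holomorphic_on_sum holomorphic_on_mult holomorphic_on_const 0)
    show "\<exists>d>0. cball s d \<subseteq> A \<and>
        uniform_limit (cball s d) (\<lambda>n s. \<Sum>i<n. z ^ i * h s i) (\<lambda>s. \<Sum>n. z ^ n * h s n) sequentially"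
      if s: "s \<in> A" for s
    proof -
      obtain d where d: "d > 0" "cball s d \<subseteq> A"
        using A s by (auto simp: open_contains_cball)
      then show ?thesis
        using le by (intro exI[of _ d] conjI Weierstrass_m_test[OF _ M]) auto
    qed
  qed
  then show ?case by simp
next
  case (Suc K)
  have "(\<lambda>s. abel_sum z K (forward_diff (h s))) holomorphic_on A"
  proof (rule Suc.IH)
    show "(\<lambda>s. forward_diff (h s) n) holomorphic_on A" for n
      unfolding forward_diff_def by (intro holomorphic_on_diff Suc.prems)
    show "norm ((forward_diff ^^ K) (forward_diff (h s)) n) \<le> M n" if "s \<in> A" for s n
      using Suc.prems(2)[OF that, of n] by (simp add: funpow_Suc_right del: funpow.simps)
  qed
  then show ?case
    unfolding abel_sum.simps divide_inverse
    by (intro holomorphic_on_mult holomorphic_on_add holomorphic_on_const Suc.prems)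
qed

text \<open>The \<open>K\<close>-th difference is controlled by the \<open>K\<close>-th derivative, by iterating the mean value inequality.\<close>

lemma norm_forward_diff_le_derivative:
  fixes f :: "nat \<Rightarrow> real \<Rightarrow> complex"
  assumes "x > 0" and "\<And>i t. t > 0 \<Longrightarrow> (f i has_vector_derivative f (Suc i) t) (at t)"
    and "\<And>t. t \<ge> x \<Longrightarrow> norm (f K t) \<le> B"
  shows "norm ((forward_diff ^^ K) (\<lambda>n. f 0 (x + real n)) 0) \<le> B"
  using assms(2,3)
proof (induction K arbitrary: f)
  case 0
  then show ?case by simp
next
  case (Suc K)
  define h where "h = (\<lambda>i t. f i (t + 1) - f i t)"
  have "norm ((forward_diff ^^ K) (\<lambda>n. h 0 (x + real n)) 0) \<le> B"
  proof (rule Suc.IH)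
    fix i and t :: real assume t: "t > 0"
    have "((\<lambda>t. t + 1) has_vector_derivative 1) (at t)"
      by (auto intro!: derivative_eq_intros)
    from vector_diff_chain_at[OF this, of "f i" "f (Suc i) (t + 1)"] Suc.prems(1)[of "t + 1" i] t
    have "((\<lambda>t. f i (t + 1)) has_vector_derivative f (Suc i) (t + 1)) (at t)"
      by (simp add: o_def)
    then show "(h i has_vector_derivative h (Suc i) t) (at t)"
      unfolding h_def by (intro has_vector_derivative_diff Suc.prems t)
  next
    fix t assume t: "t \<ge> x"
    have "\<exists>y\<in>{t<..<t + 1}. norm (f K (t + 1) - f K t) \<le> norm ((\<lambda>v. v *\<^sub>R f (Suc K) y) (t + 1 - t))"
    proof (rule mvt_general)
      show "continuous_on {t..t + 1} (f K)"
      proof (intro continuous_at_imp_continuous_on ballI)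
        fix y assume "y \<in> {t..t + 1}"
        then have "y > 0"
          using t \<open>x > 0\<close> by simp
        then show "isCont (f K) y"
          using has_vector_derivative_continuous Suc.prems(1) by blast
      qed
      show "(f K has_derivative (\<lambda>v. v *\<^sub>R f (Suc K) y)) (at y)" if "t < y" "y < t + 1" for y
        using Suc.prems(1)[of y K] t \<open>x > 0\<close> that by (simp add: has_vector_derivative_def)
    qed simp
    then show "norm (h K t) \<le> B"
      using Suc.prems(2) t by (auto simp: h_def intro: order_trans)
  qed
  moreover have "forward_diff (\<lambda>n. f 0 (x + real n)) = (\<lambda>n. h 0 (x + real n))"
    by (auto simp: forward_diff_def h_def add_ac)
  ultimately show ?case
    by (simp add: funpow_Suc_right del: funpow.simps)
qed

lemma forward_diff_funpow_shift:
  "(forward_diff ^^ K) (\<lambda>m. g (n + m)) m = (forward_diff ^^ K) g (n + m)"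
  by (induction K arbitrary: m) (auto simp: forward_diff_def)

definition dirichlet_powers :: "complex \<Rightarrow> nat \<Rightarrow> complex" where
  "dirichlet_powers s n = of_nat (Suc n) powr (- s)"

text \<open>
  The \<open>K\<close>-th derivative of \<open>t\<^sup>-\<^sup>s\<close> is a constant times \<open>t\<^sup>-\<^sup>s\<^sup>-\<^sup>K\<close>.
\<close>

lemma norm_forward_diff_dirichlet_powers_le:
  assumes K: "Re s + real K \<ge> 2"
  shows "norm ((forward_diff ^^ K) (dirichlet_powers s) n) \<le> (\<Prod>i<K. norm (s + of_nat i)) * real (Suc n) powr (-2)"
proof -
  define f where "f = (\<lambda>i (t::real). (\<Prod>l<i. - s - of_nat l) * of_real t powr (- s - of_nat i))"
  have deriv: "(f i has_vector_derivative f (Suc i) t) (at t)" if "t > 0" for i t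
  proof -
    have "((\<lambda>z. (\<Prod>l<i. - s - of_nat l) * z powr (- s - of_nat i)) has_field_derivative
        (\<Prod>l<i. - s - of_nat l) * ((- s - of_nat i) * of_real t powr (- s - of_nat i - 1))) (at (of_real t))"
      using that by (intro DERIV_cmult has_field_derivative_powr) auto
    then have "(f i has_vector_derivative
        (\<Prod>l<i. - s - of_nat l) * ((- s - of_nat i) * of_real t powr (- s - of_nat i - 1))) (at t)"
      unfolding f_def by (rule has_vector_derivative_real_field)
    moreover have "- s - of_nat i - 1 = - s - of_nat (Suc i)"
      by simp
    ultimately show ?thesis
      by (simp add: f_def mult.assoc)
  qed
  have bound: "norm (f K t) \<le> (\<Prod>i<K. norm (s + of_nat i)) * real (Suc n) powr (-2)"
    if t: "t \<ge> real (Suc n)" for t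
  proof -
    have "t > 0"
      using t by simp
    have neg: "norm (- s - of_nat i) = norm (s + of_nat i)" for i
      using norm_minus_cancel[of "s + of_nat i"] by simp
    have "norm (of_real t powr (- s - of_nat K)) = t powr (- (Re s + real K))"
      using \<open>t > 0\<close> by (simp add: norm_powr_real_powr)
    also have "\<dots> \<le> t powr (-2)"
      using t K by (intro powr_mono) auto
    also have "\<dots> \<le> real (Suc n) powr (-2)"
      using t by (intro powr_mono2') auto
    finally show ?thesis
      unfolding f_def norm_mult prod_norm[symmetric] neg[symmetric] by (intro mult_left_mono prod_nonneg) auto
  qed
  have "norm ((forward_diff ^^ K) (\<lambda>m. f 0 (real (Suc n) + real m)) 0) \<le>
      (\<Prod>i<K. norm (s + of_nat i)) * real (Suc n) powr (-2)"
    by (rule norm_forward_diff_le_derivative) (use deriv bound in auto)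
  moreover have "(\<lambda>m. f 0 (real (Suc n) + real m)) = (\<lambda>m. dirichlet_powers s (n + m))"
    by (auto simp: f_def dirichlet_powers_def add_ac)
  ultimately show ?thesis
    using forward_diff_funpow_shift[where g = "dirichlet_powers s" and n = n and m = 0] by simp
qed

lemma summable_Suc_powr: "r < -1 \<Longrightarrow> summable (\<lambda>n. real (Suc n) powr r)"
  using summable_Suc_iff[of "\<lambda>n. real n powr r"] by (simp add: summable_real_powr_iff)

lemma diff_summable_dirichlet_powers:
  assumes "Re s + real K \<ge> 2"
  shows "diff_summable K (dirichlet_powers s)"
  unfolding diff_summable_def
  by (rule summable_comparison_test'[where N = 0, OF summable_mult[OF summable_Suc_powr[of "-2"]]])
    (use norm_forward_diff_dirichlet_powers_le[OF assms] in auto)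

text \<open>
  The entire function \<open>\<Sigma> z\<^sup>n (n + 1)\<^sup>-\<^sup>s\<close>, that is \<open>Li\<^sub>s(z) / z\<close>, for \<open>z \<noteq> 1\<close> in the closed unit disc. The number of
  steps is large enough to make the \<open>K\<close>-th differences \<open>O(n\<^sup>-\<^sup>2)\<close>.
\<close>

definition lerch :: "complex \<Rightarrow> complex \<Rightarrow> complex" where
  "lerch z s = abel_sum z (nat \<lceil>norm s\<rceil> + 2) (dirichlet_powers s)"

lemma lerch_eq_abel_sum:
  assumes z: "norm z \<le> 1" "z \<noteq> 1" and K: "norm s + 2 \<le> real K"
  shows "lerch z s = abel_sum z K (dirichlet_powers s)"
proof -
  have "\<lceil>norm s\<rceil> + 2 \<le> int K"
    using ceiling_le_iff[of "norm s" "int K - 2"] K by simp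
  moreover have "0 \<le> \<lceil>norm s\<rceil>"
    using ceiling_mono[OF norm_ge_zero[of s]] by (simp only: ceiling_zero)
  ultimately have "nat \<lceil>norm s\<rceil> + 2 \<le> K"
    by arith
  moreover have "Re s + real (nat \<lceil>norm s\<rceil> + 2) \<ge> 2"
    using abs_Re_le_cmod[of s] by (simp add: abs_le_iff) linarith
  ultimately show ?thesis
    unfolding lerch_def by (intro abel_sum_mono[OF z diff_summable_dirichlet_powers, symmetric])
qed

text \<open>
  On the disc of radius \<open>R\<close> the number of steps may be taken to be \<open>R + 2\<close> throughout, and the resulting
  series is dominated by a multiple of \<open>\<Sigma> n\<^sup>-\<^sup>2\<close>.
\<close>

lemma holomorphic_lerch:
  assumes z: "norm z \<le> 1" "z \<noteq> 1"
  shows "lerch z holomorphic_on UNIV"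
  unfolding holomorphic_on_def
proof
  fix s0 :: complex
  define R where "R = nat \<lceil>norm s0\<rceil> + 1"
  define A where "A = ball (0::complex) (real R)"
  have s0: "s0 \<in> A"
  proof -
    have "norm s0 < real R"
      using real_nat_ceiling_ge[of "norm s0"] unfolding R_def by linarith
    then show ?thesis
      by (simp add: A_def)
  qed
  define M where "M = (\<lambda>n. (\<Prod>i<R + 2. real R + real i) * real (Suc n) powr (-2))"
  have "(\<lambda>s. abel_sum z (R + 2) (dirichlet_powers s)) holomorphic_on A"
  proof (rule abel_sum_holomorphic[OF z(1)])
    show "open A" by (simp add: A_def)
    show "(\<lambda>s. dirichlet_powers s n) holomorphic_on A" for n
      unfolding dirichlet_powers_def by (intro holomorphic_intros)
    show "summable M"
      unfolding M_def by (intro summable_mult summable_Suc_powr) simp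
    fix s n assume "s \<in> A"
    then have s: "norm s < real R"
      by (simp add: A_def)
    then have "Re s + real (R + 2) \<ge> 2"
      using abs_Re_le_cmod[of s] by (simp add: abs_le_iff)
    from norm_forward_diff_dirichlet_powers_le[OF this, of n]
    have "norm ((forward_diff ^^ (R + 2)) (dirichlet_powers s) n) \<le>
        (\<Prod>i<R + 2. norm (s + of_nat i)) * real (Suc n) powr (-2)" .
    also have "\<dots> \<le> M n"
      unfolding M_def
    proof (intro mult_right_mono prod_mono conjI)
      show "norm (s + of_nat i) \<le> real R + real i" for i
        using norm_triangle_ineq[of s "of_nat i"] s by simp
    qed auto
    finally show "norm ((forward_diff ^^ (R + 2)) (dirichlet_powers s) n) \<le> M n" .
  qed
  also have "?this \<longleftrightarrow> lerch z holomorphic_on A"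
  proof (intro holomorphic_cong refl)
    fix s assume "s \<in> A"
    then show "abel_sum z (R + 2) (dirichlet_powers s) = lerch z s"
      by (intro lerch_eq_abel_sum[OF z, symmetric]) (simp add: A_def)
  qed
  finally have "lerch z holomorphic_on A" .
  then have "lerch z field_differentiable (at s0)"
    using s0 by (intro holomorphic_on_imp_differentiable_at[of _ A]) (auto simp: A_def)
  then show "lerch z field_differentiable (at s0 within UNIV)"
    by simp
qed

lemma lerch_sums:
  assumes z: "norm z \<le> 1" "z \<noteq> 1" and s: "Re s > 1"
  shows "(\<lambda>n. z ^ n * dirichlet_powers s n) sums lerch z s"
proof -
  have "norm (dirichlet_powers s n) = real (Suc n) powr (- Re s)" for n
    using norm_powr_real_powr[of "of_nat (Suc n)" "- s"] by (simp add: dirichlet_powers_def del: of_nat_Suc)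
  then have sm: "summable (\<lambda>n. norm (dirichlet_powers s n))"
    using summable_Suc_powr[of "- Re s"] s by simp
  then have "lerch z s = abel_sum z 0 (dirichlet_powers s)"
    unfolding lerch_def by (intro abel_sum_mono z) (simp_all add: diff_summable_0)
  then show ?thesis
    using summable_sums[OF summable_power_times[OF z(1) sm]] by simp
qed

text \<open>
  For the exponents \<open>0, ..., -k\<close> the same number of steps works, so the shift rule and the binomial
  theorem apply to the regularized sums of \<open>(n + 1)\<^sup>i\<close>.
\<close>

lemma lerch_neg_nat:
  assumes z: "norm z \<le> 1" "z \<noteq> 1"
  shows "lerch z (- of_nat k) = polylog_quotient k z"
proof (rule polylog_quotient_eqI[OF z(2)])
  fix k
  have powers: "dirichlet_powers (- of_nat i) = (\<lambda>n. of_nat (Suc n) ^ i)" for i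
    unfolding dirichlet_powers_def by (simp add: powr_nat del: of_nat_Suc)
  let ?A = "\<lambda>i. abel_sum z (k + 2) (dirichlet_powers (- of_nat i))"
  have eq: "lerch z (- of_nat i) = ?A i" if "i \<le> k" for i
    using that by (intro lerch_eq_abel_sum z) simp
  have sm: "diff_summable (k + 2) (dirichlet_powers (- of_nat i))" if "i \<le> k" for i
    using that by (intro diff_summable_dirichlet_powers) simp
  have "(\<lambda>n. dirichlet_powers (- of_nat k) (Suc n)) =
      (\<lambda>n. \<Sum>i\<le>k. of_nat (k choose i) * dirichlet_powers (- of_nat i) n)"
    using binomial_ring[of "of_nat (Suc n) :: complex" 1 k for n] by (auto simp: powers add.commute)
  then have "?A k = 1 + z * (\<Sum>i\<le>k. of_nat (k choose i) * ?A i)"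
    using abel_sum_shift[OF z sm[of k]] abel_sum_linear[OF z(1), of "{..k}" "k + 2"
        "\<lambda>i. dirichlet_powers (- of_nat i)" "\<lambda>i. of_nat (k choose i)"] sm
    by (simp add: powers[of k] del: abel_sum.simps)
  then show "lerch z (- of_nat k) = 1 + z * (\<Sum>i\<le>k. of_nat (k choose i) * lerch z (- of_nat i))"
    using eq by simp
qed

text \<open>
  A meromorphic continuation with normalized values at its singularities is unique, so it may be
  computed from any entire function with the right Dirichlet series.
\<close>

lemma dirichlet_L_eqI:
  assumes f: "f holomorphic_on UNIV"
    and sums: "\<And>s. Re s > 1 \<Longrightarrow> (\<lambda>n. \<theta> (int (Suc n)) / of_nat (Suc n) powr s) sums f s"
  shows "dirichlet_L \<theta> = f"
  unfolding dirichlet_L_def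
proof (rule the_equality)
  have ana: "f analytic_on UNIV"
    using f by (simp add: analytic_on_open)
  then show "f nicely_meromorphic_on UNIV \<and>
      (\<forall>s. Re s > 1 \<longrightarrow> (\<lambda>n. \<theta> (int (Suc n)) / of_nat (Suc n) powr s) sums f s)"
    using sums analytic_on_imp_nicely_meromorphic_on by blast
  fix g assume g: "g nicely_meromorphic_on UNIV \<and>
      (\<forall>s. Re s > 1 \<longrightarrow> (\<lambda>n. \<theta> (int (Suc n)) / of_nat (Suc n) powr s) sums g s)"
  have half_plane: "g s - f s = 0" if "Re s > 1" for s
    using g sums[OF that] that sums_unique2 by fastforce
  have "(\<lambda>s. g s - f s) meromorphic_on UNIV"
    using g by (intro meromorphic_on_diff analytic_on_imp_meromorphic_on[OF ana])
      (auto simp: nicely_meromorphic_on_def)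
  then have "eventually (\<lambda>s. g s - f s = 0) (cosparse UNIV) \<or> eventually (\<lambda>s. g s - f s \<noteq> 0) (cosparse UNIV)"
    by (rule meromorphic_imp_constant_or_avoid) auto
  moreover have "\<not> eventually (\<lambda>s. g s - f s \<noteq> 0) (cosparse UNIV)"
  proof
    assume "eventually (\<lambda>s. g s - f s \<noteq> 0) (cosparse UNIV)"
    then have "eventually (\<lambda>s. g s - f s \<noteq> 0) (at 2)"
      using eventually_cosparse_imp_eventually_at by blast
    moreover have "eventually (\<lambda>s. s \<in> {s::complex. Re s > 1}) (at 2)"
      by (intro eventually_at_in_open') (auto simp: open_halfspace_Re_gt)
    ultimately have "eventually (\<lambda>s. False) (at (2::complex))"
      by eventually_elim (use half_plane in auto)
    then show False by simp
  qed
  ultimately have cosparse: "eventually (\<lambda>s. g s - f s = 0) (cosparse UNIV)"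
    by blast
  show "g = f"
  proof
    fix s
    have "eventually (\<lambda>s. g s - f s = 0) (at s)"
      using cosparse eventually_cosparse_imp_eventually_at by blast
    then have "eventually (\<lambda>s. f s = g s) (at s)"
      by eventually_elim simp
    moreover have "f \<midarrow>s\<rightarrow> f s"
      using ana analytic_at_imp_isCont analytic_on_subset isContD by (metis subset_UNIV)
    ultimately have lim: "g \<midarrow>s\<rightarrow> f s"
      using tendsto_cong by blast
    then have "\<not> is_pole g s"
      unfolding is_pole_def using not_tendsto_and_filterlim_at_infinity[of "at s" g] by auto
    then have "g \<midarrow>s\<rightarrow> g s"
      using g by (auto simp: nicely_meromorphic_on_def)
    then show "g s = f s"
      using lim LIM_unique by blast
  qed
qed

section \<open>Gauss sums and Dirichlet L-values\<close>

text \<open>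
  Multiplication by a unit permutes the units modulo \<open>N\<close>.
\<close>

lemma sum_totatives_mult:
  fixes h :: "nat \<Rightarrow> 'b::comm_monoid_add"
  assumes "N > 1" "coprime b N" and h: "\<And>a. h (a mod N) = h a"
  shows "(\<Sum>a\<in>totatives N. h (a * b)) = (\<Sum>a\<in>totatives N. h a)"
proof -
  have tot: "totatives N = {a. a < N \<and> coprime a N}"
    using assms(1) by (auto simp: totatives_def order_le_less intro!: Nat.gr0I)
  have inj: "inj_on (\<lambda>a. a * b mod N) (totatives N)"
  proof (rule inj_onI)
    fix x y assume "x \<in> totatives N" "y \<in> totatives N" "x * b mod N = y * b mod N"
    then show "x = y"
      using assms(2) cong_mult_rcancel_nat[of b N x y] cong_less_modulus_unique_nat[of x y N]
      by (auto simp: tot cong_def)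
  qed
  have "(\<lambda>a. a * b mod N) ` totatives N \<subseteq> totatives N"
    using assms by (auto simp: tot coprime_mod_left_iff)
  then have "(\<lambda>a. a * b mod N) ` totatives N = totatives N"
    using inj by (intro endo_inj_surj) auto
  then have "(\<Sum>a\<in>totatives N. h a) = (\<Sum>a\<in>totatives N. h (a * b mod N))"
    using sum.reindex[OF inj, of h] by (simp add: o_def)
  then show ?thesis
    using h by simp
qed

locale primitive_dirichlet =
  fixes N :: nat and chi :: "int \<Rightarrow> complex" and \<zeta> :: complex
  assumes primitive: "primitive_character N chi" and N_gt_1: "N > 1"
    and root: "primitive_root_of_unity N \<zeta>"
begin

lemma chi_mult: "chi (a * b) = chi a * chi b"
  and chi_1: "chi 1 = 1"
  and chi_eq_0_iff: "chi a = 0 \<longleftrightarrow> \<not> coprime a (int N)"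
  and chi_add_N: "chi (a + int N) = chi a"
  using primitive by (auto simp: primitive_character_def dirichlet_character_def)

lemma chi_mod: "chi (a mod int N) = chi a"
proof -
  have nat: "chi (a + int N * int n) = chi a" for a n
  proof (induction n)
    case (Suc n)
    then show ?case
      using chi_add_N[of "a + int N * int n"] by (simp add: algebra_simps)
  qed simp
  have "chi (a + int N * k) = chi a" for a k
  proof (cases "k \<ge> 0")
    case True
    then show ?thesis using nat[of a "nat k"] by simp
  next
    case False
    then show ?thesis using nat[of "a + int N * k" "nat (- k)"] by simp
  qed
  from this[of "a mod int N" "a div int N"] show ?thesis
    by simp
qed

lemma chi_of_nat_mod: "chi (int (a mod N)) = chi (int a)"
  using chi_mod[of "int a"] by (simp add: zmod_int)

lemma zeta_pow_N: "\<zeta> ^ N = 1"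
  using root by (simp add: primitive_root_of_unity_def)

lemma zeta_pow_mod: "\<zeta> ^ (a mod N) = \<zeta> ^ a"
  using power_add[of \<zeta> "N * (a div N)" "a mod N"] by (simp add: power_mult zeta_pow_N)

lemma norm_zeta_pow: "norm (\<zeta> ^ a) = 1"
proof -
  have "norm \<zeta> ^ N = 1"
    by (simp add: zeta_pow_N flip: norm_power)
  then have "norm \<zeta> = 1"
    using power_eq_imp_eq_base[of "norm \<zeta>" N 1] N_gt_1 by simp
  then show ?thesis
    by (simp add: norm_power)
qed

lemma zeta_nonzero: "\<zeta> \<noteq> 0"
  using zeta_pow_N N_gt_1 by (auto simp: power_0_left)

lemma zeta_pow_eq_1_iff: "\<zeta> ^ a = 1 \<longleftrightarrow> N dvd a"
proof
  assume "\<zeta> ^ a = 1"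
  then have "\<zeta> ^ (a mod N) = 1"
    by (simp add: zeta_pow_mod)
  moreover have "a mod N < N"
    using N_gt_1 by simp
  ultimately have "a mod N = 0"
    using root by (metis gr0I primitive_root_of_unity_def)
  then show "N dvd a" by auto
qed (auto simp: power_mult zeta_pow_N)

lemma zeta_pow_totative_neq_1: "a \<in> totatives N \<Longrightarrow> \<zeta> ^ a \<noteq> 1"
  using N_gt_1 by (auto simp: zeta_pow_eq_1_iff in_totatives_iff)

lemma sum_chi_dilate:
  assumes "coprime b N"
  shows "chi (int b) * (\<Sum>a\<in>totatives N. chi (int a) * f (\<zeta> ^ (a * b))) =
    (\<Sum>a\<in>totatives N. chi (int a) * f (\<zeta> ^ a))"
proof -
  have "(\<Sum>a\<in>totatives N. chi (int (a * b)) * f (\<zeta> ^ (a * b))) =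
      (\<Sum>a\<in>totatives N. chi (int a) * f (\<zeta> ^ a))"
    by (rule sum_totatives_mult[OF N_gt_1 assms, of "\<lambda>a. chi (int a) * f (\<zeta> ^ a)"])
      (simp add: chi_of_nat_mod zeta_pow_mod)
  then show ?thesis
    by (simp add: chi_mult sum_distrib_left mult_ac)
qed

text \<open>
  If \<open>n\<close> has a common factor with \<open>N\<close>, a residue \<open>b\<close> with \<open>b n \<equiv> n\<close> and \<open>chi b \<noteq> 1\<close>, provided by primitivity,
  shows that the twisted sum equals \<open>chi b\<close> times itself.
\<close>

lemma twisted_gauss_sum:
  "(\<Sum>a\<in>totatives N. chi (int a) * \<zeta> ^ (a * n)) = inverse_character chi (int n) * gauss_sum N chi \<zeta>"
proof (cases "coprime n N")
  case True
  then have "chi (int n) \<noteq> 0"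
    by (simp add: chi_eq_0_iff)
  then show ?thesis
    using sum_chi_dilate[OF True, of "\<lambda>x. x"]
    by (simp add: gauss_sum_def inverse_character_def field_simps)
next
  case False
  define d where "d = gcd n N"
  define M where "M = N div d"
  have "d \<noteq> 1"
    using False unfolding d_def coprime_iff_gcd_eq_1 .
  moreover have "d \<noteq> 0"
    using N_gt_1 by (simp add: d_def)
  ultimately have "d > 1"
    by linarith
  then have d: "d dvd n" "d > 1" "N = M * d"
    by (simp_all add: d_def M_def)
  have "M \<noteq> 0"
    using d(3) N_gt_1 by (intro notI) simp
  then have M: "M dvd N" "M < N"
    using d by simp_all
  then obtain b where b: "coprime b (int N)" "[b = 1] (mod int M)" "chi b \<noteq> 1"
    using primitive by (auto simp: primitive_character_def)
  define b' where "b' = nat (b mod int N)"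
  have b': "int b' = b mod int N"
    using N_gt_1 by (simp add: b'_def)
  then have chi_b': "chi (int b') \<noteq> 1" and "coprime (int b') (int N)"
    using b N_gt_1 by (simp_all add: chi_mod coprime_mod_left_iff)
  then have cop: "coprime b' N"
    by simp
  have "[int b' = b] (mod int M)"
    using M(1) by (simp add: b' cong_def mod_mod_cancel)
  then have "[int b' = int 1] (mod int M)"
    using b(2) cong_trans by fastforce
  then have "[b' = 1] (mod M)"
    by (simp only: cong_int_iff)
  then have "[b' * d = 1 * d] (mod N)"
    unfolding d(3) by (simp add: cong_def mod_mult_mult2)
  then have "[a * b' * n = a * n] (mod N)" for a
  proof -
    obtain t where "n = d * t"
      using d(1) ..
    then show ?thesis
      using cong_scalar_left[OF \<open>[b' * d = 1 * d] (mod N)\<close>, of "a * t"] by (simp add: mult_ac)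
  qed
  then have pow: "\<zeta> ^ (a * b' * n) = \<zeta> ^ (a * n)" for a
    by (metis cong_def zeta_pow_mod)
  define \<tau> where "\<tau> = (\<Sum>a\<in>totatives N. chi (int a) * \<zeta> ^ (a * n))"
  have "chi (int b') * \<tau> = \<tau>"
    using sum_chi_dilate[OF cop, of "\<lambda>x. x ^ n"] pow by (simp add: \<tau>_def power_mult[symmetric])
  then have "\<tau> = 0"
    using chi_b' by simp
  moreover have "chi (int n) = 0"
    using False by (simp add: chi_eq_0_iff)
  ultimately show ?thesis
    by (simp add: \<tau>_def inverse_character_def)
qed

text \<open>Fourier inversion recovers \<open>chi 1 = 1\<close> from the twisted sums, so they cannot all vanish.\<close>

lemma gauss_sum_nonzero: "gauss_sum N chi \<zeta> \<noteq> 0"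
proof
  assume zero: "gauss_sum N chi \<zeta> = 0"
  have geometric: "(\<Sum>n<N. (\<zeta> ^ a / \<zeta>) ^ n) = (if a = 1 then of_nat N else 0)" if a: "a \<in> totatives N" for a
  proof (cases "a = 1")
    case True
    then show ?thesis
      using zeta_nonzero by simp
  next
    case False
    have "\<zeta> ^ (a - 1) \<noteq> 1"
      unfolding zeta_pow_eq_1_iff using a False N_gt_1
      by (auto simp: in_totatives_iff dest!: dvd_imp_le)
    moreover have "\<zeta> ^ a / \<zeta> = \<zeta> ^ (a - 1)"
      using a zeta_nonzero by (cases a) (auto simp: in_totatives_iff)
    moreover have "(\<zeta> ^ (a - 1)) ^ N = 1"
      by (simp add: power_mult[symmetric] mult.commute zeta_pow_eq_1_iff)
    ultimately show ?thesis
      using False by (simp add: sum_gp_strict)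
  qed
  have "0 = (\<Sum>n<N. inverse \<zeta> ^ n * (\<Sum>a\<in>totatives N. chi (int a) * \<zeta> ^ (a * n)))"
    by (simp add: twisted_gauss_sum zero)
  also have "\<dots> = (\<Sum>a\<in>totatives N. chi (int a) * (\<Sum>n<N. (\<zeta> ^ a / \<zeta>) ^ n))"
  proof -
    have "inverse \<zeta> ^ n * (chi (int a) * \<zeta> ^ (a * n)) = chi (int a) * (\<zeta> ^ a / \<zeta>) ^ n" for a n
      by (simp only: divide_inverse power_mult_distrib power_mult mult_ac)
    then show ?thesis
      unfolding sum_distrib_left by (simp only:) (rule sum.swap)
  qed
  also have "\<dots> = (\<Sum>a\<in>totatives N. if a = 1 then of_nat N else 0)"
    using geometric chi_1 by (intro sum.cong) auto
  also have "\<dots> = of_nat N"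
    using N_gt_1 by (simp add: in_totatives_iff)
  finally show False
    using N_gt_1 by simp
qed

text \<open>
  The Dirichlet series of \<open>chi\<^sup>-\<^sup>1\<close> is expanded into those of \<open>z\<^sup>n\<close> through the twisted sums.
\<close>

lemma dirichlet_L_inverse_character:
  "dirichlet_L (inverse_character chi) =
     (\<lambda>s. inverse (gauss_sum N chi \<zeta>) * (\<Sum>a\<in>totatives N. chi (int a) * \<zeta> ^ a * lerch (\<zeta> ^ a) s))"
proof (rule dirichlet_L_eqI)
  let ?G = "gauss_sum N chi \<zeta>"
  have za: "norm (\<zeta> ^ a) \<le> 1" for a
    by (simp only: norm_zeta_pow)
  show "(\<lambda>s. inverse ?G * (\<Sum>a\<in>totatives N. chi (int a) * \<zeta> ^ a * lerch (\<zeta> ^ a) s)) holomorphic_on UNIV"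
    by (intro holomorphic_on_mult holomorphic_on_sum holomorphic_on_const holomorphic_lerch za
        zeta_pow_totative_neq_1)
  fix s :: complex assume s: "Re s > 1"
  have "(\<lambda>n. inverse ?G * (\<Sum>a\<in>totatives N. chi (int a) * \<zeta> ^ a * ((\<zeta> ^ a) ^ n * dirichlet_powers s n))) sums
      (inverse ?G * (\<Sum>a\<in>totatives N. chi (int a) * \<zeta> ^ a * lerch (\<zeta> ^ a) s))"
    by (intro sums_mult sums_sum lerch_sums za zeta_pow_totative_neq_1 s)
  moreover have "inverse ?G * (\<Sum>a\<in>totatives N. chi (int a) * \<zeta> ^ a * ((\<zeta> ^ a) ^ n * dirichlet_powers s n)) =
      inverse_character chi (int (Suc n)) / of_nat (Suc n) powr s" for n
  proof -
    have "(\<Sum>a\<in>totatives N. chi (int a) * \<zeta> ^ a * ((\<zeta> ^ a) ^ n * dirichlet_powers s n)) =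
        (\<Sum>a\<in>totatives N. chi (int a) * \<zeta> ^ (a * Suc n)) * dirichlet_powers s n"
      unfolding sum_distrib_right by (intro sum.cong) (simp_all add: power_add power_mult mult_ac)
    then show ?thesis
      using gauss_sum_nonzero
      by (simp only: twisted_gauss_sum) (simp add: dirichlet_powers_def powr_minus divide_inverse del: of_nat_Suc)
  qed
  ultimately show "(\<lambda>n. inverse_character chi (int (Suc n)) / of_nat (Suc n) powr s) sums
      (inverse ?G * (\<Sum>a\<in>totatives N. chi (int a) * \<zeta> ^ a * lerch (\<zeta> ^ a) s))"
    by simp
qed

text \<open>
  Multiplication by \<open>p\<close> permutes the residues, so removing the Euler factor at \<open>p\<close> amounts to
  subtracting the same expression at the \<open>p\<close>-th powers of the roots of unity.
\<close>

lemma dirichlet_L_value_without_Euler_factor: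
  assumes "coprime p N"
  shows "(1 - inverse_character chi (int p) * of_nat p ^ k) * dirichlet_L (inverse_character chi) (- of_nat k) =
    inverse (gauss_sum N chi \<zeta>) * (\<Sum>a\<in>totatives N. chi (int a) *
      (\<zeta> ^ a * polylog_quotient k (\<zeta> ^ a) - of_nat p ^ k * ((\<zeta> ^ a) ^ p * polylog_quotient k ((\<zeta> ^ a) ^ p))))"
proof -
  let ?G = "gauss_sum N chi \<zeta>" and ?Q = "\<lambda>x. x * polylog_quotient k x"
  let ?S = "\<Sum>a\<in>totatives N. chi (int a) * ?Q (\<zeta> ^ a)"
  let ?Sp = "\<Sum>a\<in>totatives N. chi (int a) * ?Q ((\<zeta> ^ a) ^ p)"
  have "lerch (\<zeta> ^ a) (- of_nat k) = polylog_quotient k (\<zeta> ^ a)" if "a \<in> totatives N" for a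
    by (rule lerch_neg_nat) (use that norm_zeta_pow zeta_pow_totative_neq_1 in auto)
  then have L: "dirichlet_L (inverse_character chi) (- of_nat k) = inverse ?G * ?S"
    unfolding dirichlet_L_inverse_character by (simp add: mult.assoc)
  have "chi (int p) \<noteq> 0"
    using assms by (simp add: chi_eq_0_iff)
  moreover have "chi (int p) * ?Sp = ?S"
    using sum_chi_dilate[OF assms, of ?Q] by (simp add: power_mult)
  ultimately have "inverse_character chi (int p) * ?S = ?Sp"
    by (simp add: inverse_character_def field_simps)
  then have "(1 - inverse_character chi (int p) * of_nat p ^ k) * (inverse ?G * ?S) =
      inverse ?G * (?S - of_nat p ^ k * ?Sp)"
    by (simp add: algebra_simps)
  also have "?S - of_nat p ^ k * ?Sp = (\<Sum>a\<in>totatives N. chi (int a) *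
      (?Q (\<zeta> ^ a) - of_nat p ^ k * ?Q ((\<zeta> ^ a) ^ p)))"
    by (simp add: right_diff_distrib sum_subtractf sum_distrib_left mult_ac)
  finally show ?thesis
    unfolding L .
qed

end

section \<open>Interpolation and the Kubota-Leopoldt branch\<close>

locale field_embedding =
  fixes F :: "complex set" and \<iota> :: "complex \<Rightarrow> 'k::complete_nonarch_field"
  assumes embedding: "algebraic_embedding F \<iota>"
begin

lemma F_0 [simp]: "0 \<in> F" and F_1 [simp]: "1 \<in> F"
  and F_uminus: "x \<in> F \<Longrightarrow> - x \<in> F" and F_inverse: "x \<in> F \<Longrightarrow> inverse x \<in> F"
  and F_add: "x \<in> F \<Longrightarrow> y \<in> F \<Longrightarrow> x + y \<in> F" and F_mult: "x \<in> F \<Longrightarrow> y \<in> F \<Longrightarrow> x * y \<in> F"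
  and \<iota>_1 [simp]: "\<iota> 1 = 1"
  and \<iota>_add: "x \<in> F \<Longrightarrow> y \<in> F \<Longrightarrow> \<iota> (x + y) = \<iota> x + \<iota> y"
  and \<iota>_mult: "x \<in> F \<Longrightarrow> y \<in> F \<Longrightarrow> \<iota> (x * y) = \<iota> x * \<iota> y"
  using embedding by (auto simp: algebraic_embedding_def)

lemma \<iota>_0 [simp]: "\<iota> 0 = 0"
  using \<iota>_add[of 0 0] by simp

lemma \<iota>_uminus: "x \<in> F \<Longrightarrow> \<iota> (- x) = - \<iota> x"
  using \<iota>_add[of x "- x"] F_uminus by (simp add: eq_neg_iff_add_eq_0 add.commute)

lemma F_diff: "x \<in> F \<Longrightarrow> y \<in> F \<Longrightarrow> x - y \<in> F"
  using F_add[of x "- y"] F_uminus by simp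

lemma \<iota>_diff: "x \<in> F \<Longrightarrow> y \<in> F \<Longrightarrow> \<iota> (x - y) = \<iota> x - \<iota> y"
  using \<iota>_add[of x "- y"] F_uminus \<iota>_uminus by simp

lemma \<iota>_inverse: "x \<in> F \<Longrightarrow> \<iota> (inverse x) = inverse (\<iota> x)"
  using \<iota>_mult[of x "inverse x"] F_inverse by (cases "x = 0") (auto intro: inverse_unique[symmetric])

lemma \<iota>_eq_0_iff: "x \<in> F \<Longrightarrow> \<iota> x = 0 \<longleftrightarrow> x = 0"
  using \<iota>_mult[of x "inverse x"] F_inverse by (cases "x = 0") auto

lemma \<iota>_eq_1_iff: "x \<in> F \<Longrightarrow> \<iota> x = 1 \<longleftrightarrow> x = 1"
  using \<iota>_eq_0_iff[of "x - 1"] \<iota>_diff[of x 1] F_diff[of x 1] by simp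

lemma F_divide: "x \<in> F \<Longrightarrow> y \<in> F \<Longrightarrow> x / y \<in> F"
  by (simp add: divide_inverse F_mult F_inverse)

lemma \<iota>_divide: "x \<in> F \<Longrightarrow> y \<in> F \<Longrightarrow> \<iota> (x / y) = \<iota> x / \<iota> y"
  by (simp add: divide_inverse F_inverse \<iota>_mult \<iota>_inverse)

lemma F_power: "x \<in> F \<Longrightarrow> x ^ n \<in> F"
  by (induction n) (auto intro: F_mult)

lemma \<iota>_power: "x \<in> F \<Longrightarrow> \<iota> (x ^ n) = \<iota> x ^ n"
  by (induction n) (auto simp: \<iota>_mult F_power)

lemma F_of_nat: "of_nat n \<in> F"
  by (induction n) (auto intro: F_add)

lemma \<iota>_of_nat: "\<iota> (of_nat n) = of_nat n"
  by (induction n) (auto simp: \<iota>_add F_of_nat)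

lemma F_sum: "(\<And>i. i \<in> A \<Longrightarrow> f i \<in> F) \<Longrightarrow> sum f A \<in> F"
  by (induction A rule: infinite_finite_induct) (auto intro: F_add)

lemma \<iota>_sum: "(\<And>i. i \<in> A \<Longrightarrow> f i \<in> F) \<Longrightarrow> \<iota> (sum f A) = (\<Sum>i\<in>A. \<iota> (f i))"
  by (induction A rule: infinite_finite_induct) (auto simp: \<iota>_add F_sum)

text \<open>
  The recursion uses field operations only.
\<close>

lemma polylog_quotient_embedding:
  assumes "z \<in> F"
  shows "polylog_quotient k z \<in> F \<and> \<iota> (polylog_quotient k z) = polylog_quotient k (\<iota> z)"
proof (induction k rule: less_induct)
  case (less k)
  let ?s = "\<lambda>i. of_nat (k choose i) * polylog_quotient i z"
  have s: "?s i \<in> F" if "i \<in> {..<k}" for i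
    using less that by (intro F_mult F_of_nat) auto
  have "\<iota> (\<Sum>i<k. ?s i) = (\<Sum>i<k. \<iota> (?s i))"
    using s by (rule \<iota>_sum)
  also have "\<dots> = (\<Sum>i<k. of_nat (k choose i) * polylog_quotient i (\<iota> z))"
    using less by (intro sum.cong) (auto simp: \<iota>_mult \<iota>_of_nat F_of_nat)
  finally have \<iota>s: "\<iota> (\<Sum>i<k. ?s i) = (\<Sum>i<k. of_nat (k choose i) * polylog_quotient i (\<iota> z))" .
  have S: "(\<Sum>i<k. ?s i) \<in> F"
    using s by (rule F_sum)
  then have num: "1 + z * (\<Sum>i<k. ?s i) \<in> F"
    using assms by (intro F_add F_mult) auto
  have den: "1 - z \<in> F"
    using assms by (intro F_diff) auto
  have "polylog_quotient k z = (1 + z * (\<Sum>i<k. ?s i)) / (1 - z)"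
    by (rule polylog_quotient.simps)
  moreover have "polylog_quotient k (\<iota> z) =
      (1 + \<iota> z * (\<Sum>i<k. of_nat (k choose i) * polylog_quotient i (\<iota> z))) / (1 - \<iota> z)"
    by (rule polylog_quotient.simps)
  ultimately show ?case
    using num den F_divide[OF num den] \<iota>_divide[OF num den] S assms
    by (simp add: \<iota>_add \<iota>_mult \<iota>_diff F_mult \<iota>s)
qed

end

context padic_field
begin

lemma rigid_analytic_continuous_on_Zp:
  assumes "topological_generator p (\<gamma>::'k)" and "rigid_analytic_on_weight_disc \<gamma> f"
  shows "continuous_on Zp f"
proof -
  obtain c where c: "\<And>r::real. 0 \<le> r \<Longrightarrow> r < 1 \<Longrightarrow> (\<lambda>k. absval (c k) * r ^ k) \<longlonglongrightarrow> 0"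
      "\<And>s. s \<in> Zp \<Longrightarrow> (\<lambda>k. c k * (padic_power \<gamma> s - 1) ^ k) sums f s"
    using assms(2) unfolding rigid_analytic_on_weight_disc_def by blast
  show ?thesis
    by (rule continuous_on_power_series[OF topological_generator_mem_one_units[OF assms(1)] c(1) c(2)])
      (use real_p_gt_1 in auto)
qed

text \<open>
  The interpolation property determines the branch, because the integers \<open>n \<ge> 1\<close> in one residue
  class modulo \<open>p - 1\<close> are dense in the \<open>p\<close>-adic integers.
\<close>

lemma kubota_leopoldt_eqI:
  fixes f :: "'k \<Rightarrow> 'k"
  assumes \<gamma>: "topological_generator p \<gamma>" and f: "rigid_analytic_on_weight_disc \<gamma> f"
    and interpolation: "\<And>n::nat. n \<ge> 1 \<Longrightarrow> [int n = j] (mod (int p - 1)) \<Longrightarrow> f (of_nat n) =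
      \<iota> ((1 - \<theta> (int p) * of_nat p ^ (n - 1)) * dirichlet_L \<theta> (1 - of_nat n))"
    and s: "s \<in> Zp"
  shows "kubota_leopoldt p \<iota> \<gamma> \<theta> j (1 - s) = f s"
proof -
  have Zp_1: "1 - t \<in> Zp" if "t \<in> Zp" for t :: 'k
    using that by (intro Zp_diff) auto
  have "kubota_leopoldt p \<iota> \<gamma> \<theta> j = (\<lambda>t\<in>Zp. f (1 - t))"
    unfolding kubota_leopoldt_def
  proof (rule the_equality, intro conjI allI impI)
    show "rigid_analytic_on_weight_disc \<gamma> (\<lambda>s. (\<lambda>t\<in>Zp. f (1 - t)) (1 - s))"
      using f Zp_1 by (simp add: rigid_analytic_on_weight_disc_def cong: conj_cong)
    show "(\<lambda>t\<in>Zp. f (1 - t)) (1 - of_nat n) =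
        \<iota> ((1 - \<theta> (int p) * of_nat p ^ (n - 1)) * dirichlet_L \<theta> (1 - of_nat n))"
      if "1 \<le> n \<and> [int n = j] (mod (int p - 1))" for n
      using interpolation[of n] that Zp_1[of "of_nat n"] by simp
  next
    fix g :: "'k \<Rightarrow> 'k"
    assume g: "g \<in> extensional Zp \<and> rigid_analytic_on_weight_disc \<gamma> (\<lambda>s. g (1 - s)) \<and>
      (\<forall>n::nat. n \<ge> 1 \<and> [int n = j] (mod (int p - 1)) \<longrightarrow> g (1 - of_nat n) =
          \<iota> ((1 - \<theta> (int p) * of_nat p ^ (n - 1)) * dirichlet_L \<theta> (1 - of_nat n)))"
    have cont: "continuous_on Zp f" "continuous_on Zp (\<lambda>s. g (1 - s))"
      using rigid_analytic_continuous_on_Zp[OF \<gamma>] f g by blast+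
    have eq: "g (1 - s) = f s" if s: "s \<in> Zp" for s
    proof -
      obtain x :: "nat \<Rightarrow> nat" where x: "(\<lambda>m. of_nat (x m)) \<longlonglongrightarrow> s" "\<And>m. x m \<ge> 1"
          "\<And>m. [int (x m) = j] (mod (int p - 1))"
        using Zp_sequence_nat_residue_class[OF s, of j] by blast
      have "(\<lambda>m. f (of_nat (x m))) \<longlonglongrightarrow> f s"
        by (rule continuous_on_tendsto_compose[OF cont(1) x(1) s]) simp
      moreover have "(\<lambda>m. g (1 - of_nat (x m))) \<longlonglongrightarrow> g (1 - s)"
        by (rule continuous_on_tendsto_compose[OF cont(2) x(1) s]) simp
      moreover have "g (1 - of_nat (x m)) = f (of_nat (x m))" for m
        using g interpolation x(2,3) by simp
      ultimately show ?thesis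
        using LIMSEQ_unique by auto
    qed
    show "g = (\<lambda>t\<in>Zp. f (1 - t))"
    proof (rule extensionalityI[of _ Zp])
      show "g t = (\<lambda>t\<in>Zp. f (1 - t)) t" if "t \<in> Zp" for t
        using eq[OF Zp_1[OF that]] that by simp
    qed (use g in auto)
  qed auto
  then show ?thesis
    using Zp_1[OF s] by simp
qed

end

theorem theorem4p33:
  fixes p N :: nat
    and chi :: "int \<Rightarrow> complex"
    and \<zeta> :: complex
    and F :: "complex set"
    and \<iota> :: "complex \<Rightarrow> 'k::complete_nonarch_field"
    and \<gamma> :: 'k
    and j :: int
  assumes "prime p" and "odd p"
    and "finite_extension_of_Qp p TYPE('k)"
    and "primitive_character N chi" and "chi (-1) = -1" and "\<not> p dvd N"
    and "algebraic_embedding F \<iota>" and "range chi \<subseteq> F"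
    and "\<zeta> \<in> F" and "primitive_root_of_unity N \<zeta>"
    and "topological_generator p \<gamma>"
  shows "rigid_analytic_on_weight_disc \<gamma> (measure_padic_L p N \<iota> chi \<zeta> j) \<and>
    (\<forall>n::nat. n \<ge> 1 \<and> [int n = j] (mod (int p - 1)) \<longrightarrow>
       measure_padic_L p N \<iota> chi \<zeta> j (of_nat n) =
         \<iota> ((1 - inverse_character chi (int p) * of_nat p ^ (n - 1)) *
            dirichlet_L (inverse_character chi) (1 - of_nat n))) \<and>
    (\<forall>s\<in>Zp. measure_padic_L p N \<iota> chi \<zeta> j s =
       kubota_leopoldt p \<iota> \<gamma> (inverse_character chi) j (1 - s))"
proof -
  interpret padic_field p "TYPE('k)"
    using assms(1,3) by unfold_locales (auto simp: finite_extension_of_Qp_def)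
  have "dirichlet_character N chi"
    using assms(4) by (simp add: primitive_character_def)
  then have "N > 0" "chi 1 = 1" "\<And>a. chi (a + int N) = chi a"
    by (auto simp: dirichlet_character_def)
  \<comment> \<open>For modulus 1 the character would be constant.\<close>
  then have "N \<noteq> 1"
    using assms(5) by (metis add.left_inverse add_0 of_nat_1 one_neq_neg_one)
  with \<open>N > 0\<close> interpret primitive_dirichlet N chi \<zeta>
    using assms(4,10) by unfold_locales auto
  interpret field_embedding F \<iota>
    using assms(7) by unfold_locales

  have coprime_p: "coprime p N"
    using assms(1,6) by (rule prime_imp_coprime)
  have chi_F: "chi a \<in> F" for a
    using assms(8) by auto
  have zeta_F: "\<zeta> ^ a \<in> F" for a
    using assms(9) by (rule F_power)
  define z where "z = (\<lambda>a. \<iota> (\<zeta> ^ a))"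
  define G where "G = \<iota> (gauss_sum N chi \<zeta>)"
  define w where "w = (\<lambda>a. geometric_weight (z a))"
  let ?L = "measure_padic_L p N \<iota> chi \<zeta> j"

  have z_N: "z a ^ N = 1" for a
  proof -
    have "z a ^ N = \<iota> ((\<zeta> ^ N) ^ a)"
      using zeta_F by (simp add: z_def power_mult[symmetric] mult.commute flip: \<iota>_power)
    then show ?thesis
      by (simp add: zeta_pow_N)
  qed
  have z_neq: "z a \<noteq> 1" if "a \<in> totatives N" for a
    using zeta_pow_totative_neq_1[OF that] \<iota>_eq_1_iff[OF zeta_F] by (simp add: z_def)
  have "\<forall>a\<in>totatives N. \<exists>C. bounded_distribution (w a) C"
    using geometric_weight_bounded_distribution[OF z_N z_neq coprime_p] unfolding w_def by metis
  then obtain C where C: "\<And>a. a \<in> totatives N \<Longrightarrow> bounded_distribution (w a) (C a)"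
    by metis

  have L_eq: "?L s = inverse G * (\<Sum>a\<in>totatives N. \<iota> (chi (int a)) *
      riemann_integral (w a) (unit_integrand j (\<lambda>u. padic_power u s)))" if "s \<in> Zp" for s
    unfolding measure_padic_L_def G_def w_def z_def
    using C that by (subst mellin_nu_character_measure) (auto simp: w_def z_def)

  \<comment> \<open>The coefficients are bounded, which suffices on every disc of radius less than 1.\<close>
  have analytic: "rigid_analytic_on_weight_disc \<gamma> ?L"
  proof -
    define i where "i = (\<lambda>a k. riemann_integral (w a) (unit_integrand j (\<lambda>u. padic_log \<gamma> u gchoose k)))"
    define c where "c = (\<lambda>k. inverse G * (\<Sum>a\<in>totatives N. \<iota> (chi (int a)) * i a k))"
    define B where "B = absval (inverse G) * (\<Sum>a\<in>totatives N. absval (\<iota> (chi (int a))) * C a)"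
    have C_nonneg: "C a \<ge> 0" if "a \<in> totatives N" for a
      using bounded_distribution_nonneg[OF C[OF that]] .
    have "absval (i a k) \<le> 1 * C a" if "a \<in> totatives N" for a k
      unfolding i_def
      by (intro absval_riemann_integral_le[OF C[OF that]] unit_integrand_gbinomial_log assms)
    then have "absval (\<iota> (chi (int a)) * i a k) \<le> absval (\<iota> (chi (int a))) * C a"
      if "a \<in> totatives N" for a k
      using that by (simp add: absval_mult mult_left_mono)
    moreover have "absval (\<iota> (chi (int a))) * C a \<le> (\<Sum>a\<in>totatives N. absval (\<iota> (chi (int a))) * C a)"
      if "a \<in> totatives N" for a
      using that C_nonneg by (intro member_le_sum) auto
    ultimately have "absval (\<Sum>a\<in>totatives N. \<iota> (chi (int a)) * i a k) \<le>
        (\<Sum>a\<in>totatives N. absval (\<iota> (chi (int a))) * C a)" for k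
      using C_nonneg by (intro absval_sum_le sum_nonneg) (auto intro: order_trans)
    then have bound: "absval (c k) \<le> B" for k
      unfolding c_def B_def absval_mult by (intro mult_left_mono) auto
    have small: "(\<lambda>k. absval (c k) * r ^ k) \<longlonglongrightarrow> 0" if r: "0 \<le> r" "r < 1" for r :: real
    proof (rule tendsto_sandwich[OF _ _ tendsto_const])
      show "(\<lambda>k. B * r ^ k) \<longlonglongrightarrow> 0"
        using r by (intro tendsto_mult_right_zero LIMSEQ_power_zero) simp
    qed (use bound r in \<open>auto intro!: always_eventually mult_right_mono\<close>)
    have "(\<lambda>k. c k * (padic_power \<gamma> s - 1) ^ k) sums ?L s" if s: "s \<in> Zp" for s
    proof -
      have "(\<lambda>n. inverse G * (\<Sum>a\<in>totatives N. \<iota> (chi (int a)) * (\<Sum>k<n. i a k * (padic_power \<gamma> s - 1) ^ k)))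
          \<longlonglongrightarrow> ?L s"
        unfolding L_eq[OF s] i_def
        by (intro tendsto_mult tendsto_const tendsto_sum
            mellin_power_series[OF assms(11,2) C s, unfolded sums_def])
      moreover have "(\<Sum>k<n. c k * (padic_power \<gamma> s - 1) ^ k) =
          inverse G * (\<Sum>a\<in>totatives N. \<iota> (chi (int a)) * (\<Sum>k<n. i a k * (padic_power \<gamma> s - 1) ^ k))" for n
        unfolding c_def sum_distrib_left sum_distrib_right
        by (subst sum.swap) (simp add: mult_ac)
      ultimately show ?thesis
        by (simp add: sums_def)
    qed
    then show ?thesis
      unfolding rigid_analytic_on_weight_disc_def using small by (intro exI[of _ c]) auto
  qed

  have interpolation: "?L (of_nat n) =
      \<iota> ((1 - inverse_character chi (int p) * of_nat p ^ (n - 1)) *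
         dirichlet_L (inverse_character chi) (1 - of_nat n))"
    if n: "n \<ge> 1" "[int n = j] (mod (int p - 1))" for n
  proof -
    define k where "k = n - 1"
    \<comment> \<open>The algebraic number to which the unit moment for \<open>\<zeta>\<^sup>a\<close> corresponds.\<close>
    define V where "V = (\<lambda>a. \<zeta> ^ a * polylog_quotient k (\<zeta> ^ a) -
        of_nat p ^ k * ((\<zeta> ^ a) ^ p * polylog_quotient k ((\<zeta> ^ a) ^ p)))"
    have pl: "polylog_quotient k (\<zeta> ^ a) \<in> F" "polylog_quotient k ((\<zeta> ^ a) ^ p) \<in> F"
      "\<iota> (polylog_quotient k (\<zeta> ^ a)) = polylog_quotient k (z a)"
      "\<iota> (polylog_quotient k ((\<zeta> ^ a) ^ p)) = polylog_quotient k (z a ^ p)" for a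
      using polylog_quotient_embedding[OF zeta_F, of k a]
        polylog_quotient_embedding[OF F_power[OF zeta_F], of k a p]
      by (simp_all add: z_def \<iota>_power zeta_F)
    have V: "V a \<in> F" "\<iota> (V a) = z a * polylog_quotient k (z a) -
        of_nat p ^ k * (z a ^ p * polylog_quotient k (z a ^ p))" for a
    proof -
      have 1: "\<zeta> ^ a * polylog_quotient k (\<zeta> ^ a) \<in> F"
        by (intro F_mult zeta_F pl)
      have 2: "(\<zeta> ^ a) ^ p * polylog_quotient k ((\<zeta> ^ a) ^ p) \<in> F"
        by (intro F_mult F_power zeta_F pl assms(9))
      have 3: "of_nat p ^ k \<in> F"
        by (intro F_power F_of_nat)
      show "V a \<in> F"
        unfolding V_def by (intro F_diff F_mult[OF 3 2] 1)
      show "\<iota> (V a) = z a * polylog_quotient k (z a) -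
          of_nat p ^ k * (z a ^ p * polylog_quotient k (z a ^ p))"
        unfolding V_def
        by (simp only: \<iota>_diff[OF 1 F_mult[OF 3 2]] \<iota>_mult[OF 3 2] \<iota>_mult[OF zeta_F pl(1)]
            \<iota>_mult[OF F_power[OF zeta_F] pl(2)] \<iota>_power[OF zeta_F] \<iota>_power[OF F_of_nat] \<iota>_of_nat pl z_def)
    qed
    have G_F: "gauss_sum N chi \<zeta> \<in> F"
      unfolding gauss_sum_def by (intro F_sum F_mult chi_F zeta_F)
    have chi_V: "chi (int a) * V a \<in> F" for a
      by (intro F_mult chi_F V)
    have "\<iota> ((1 - inverse_character chi (int p) * of_nat p ^ k) * dirichlet_L (inverse_character chi) (- of_nat k)) =
        \<iota> (inverse (gauss_sum N chi \<zeta>) * (\<Sum>a\<in>totatives N. chi (int a) * V a))"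
      by (simp only: dirichlet_L_value_without_Euler_factor[OF coprime_p] V_def)
    also have "\<dots> = inverse G * (\<Sum>a\<in>totatives N. \<iota> (chi (int a)) * \<iota> (V a))"
      by (simp only: \<iota>_mult[OF F_inverse[OF G_F] F_sum[OF chi_V]] \<iota>_inverse[OF G_F] \<iota>_sum[OF chi_V]
          \<iota>_mult[OF chi_F V(1)] G_def)
    also have "\<dots> = ?L (of_nat n)"
      unfolding L_eq[OF of_nat_mem_Zp] unit_integrand_of_nat[OF n] V(2) w_def k_def
      using riemann_integral_unit_moment[OF z_N z_neq coprime_p] by simp
    finally show ?thesis
      using n(1) by (simp add: k_def of_nat_diff)
  qed

  show ?thesis
    using analytic interpolation kubota_leopoldt_eqI[OF assms(11) analytic interpolation] by auto
qed

end
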